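(* Let $A$ be the universal enveloping algebra $U(\mathfrak g)$ of a Kac-Moody algebra of finite or affine type (over $\mathbb C$), or a quantized universal enveloping algebra $U_q$ of finite or affine type (over $\mathbb F=\mathbb Q(q^{1/d})$). Assume that $B$ is a subalgebra of $A$ and $J$ is a completely prime ideal of $B$. Then $B/J$ is a tempered domain and hence a (left and right) Ore domain.
   Context: Generalized Cartan matrix (GCM): a matrix $[a_{ij}]_{i,j\in I}$ ($I$ finite) of integers with $a_{ii}=2$, $a_{ij}\le 0$ for $i\ne j$, and $a_{ij}=0\iff a_{ji}=0$. It is symmetrizable, symmetrized by positive rationals $\{d_i\}$, if $d_ia_{ij}=d_ja_{ji}$ for all $i,j$. A symmetrizable GCM is of finite type if its principal minors are positive, and of affine type if its proper principal minors are positive and its determinant is zero. A root datum of this type: finitely generated free $\mathbb Z$-modules $X,Y$, a perfect bilinear pairing $\langle\,,\rangle:Y\times X\to\mathbb Z$, and families $\alpha_i^\vee\in Y$, $\alpha_i\in X$ with $\langle\alpha_i^\vee,\alpha_j\rangle=a_{ij}$. Kac-Moody algebra $\mathfrak g$ of the root datum: with $\mathfrak h=\mathbb C\otimes_{\mathbb Z}Y$, the complex Lie algebra generated by $E_i,F_i$ ($i\in I$) and $H\in\mathfrak h$ with relations: $\mathfrak h$ is an abelian Lie subalgebra; $[H,E_i]=\langle H,\alpha_i\rangle E_i$, $[H,F_i]=-\langle H,\alpha_i\rangle F_i$; $[E_i,F_j]=\delta_{ij}\alpha_i^\vee$; $\mathrm{ad}(E_i)^{1-a_{ij}}E_j=0=\mathrm{ad}(F_i)^{1-a_{ij}}F_j$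 for $i\ne j$. Quantized universal enveloping algebra $U_q$ of the root datum: let $d$ be the least common denominator of the $d_i$, $\mathbb F=\mathbb Q(q^{1/d})$ with $q^{1/d}$ an indeterminate, $q_i=q^{d_i}$, $K_i=q^{d_i\alpha_i^\vee}$, and extend the pairing to $d^{-1}Y\times X\to d^{-1}\mathbb Z$. $U_q$ is the $\mathbb F$-algebra generated by $E_i,F_i$ ($i\in I$), $q^\lambda$ ($\lambda\in d^{-1}Y$) with relations $q^0=1$, $q^{\lambda+\mu}=q^\lambda q^\mu$; $q^\lambda E_iq^{-\lambda}=q^{\langle\lambda,\alpha_i\rangle}E_i$, $q^\lambda F_iq^{-\lambda}=q^{-\langle\lambda,\alpha_i\rangle}F_i$; $E_iF_j-F_jE_i=\delta_{ij}\frac{K_i-K_i^{-1}}{q_i-q_i^{-1}}$; and for $i\ne j$ the $q$-Serre relations $\sum_{k=0}^{1-a_{ij}}(-1)^k\begin{bmatrix}1-a_{ij}\\k\end{bmatrix}_{q_i}Z_i^kZ_jZ_i^{1-a_{ij}-k}=0$ for $Z=E$ and $Z=F$, where $[n]_q=\frac{q^n-q^{-n}}{q-q^{-1}}$, $[n]_q!=\prod_{k=1}^n[k]_q$ and $\begin{bmatrix}n\\k\end{bmatrix}_q=\frac{[n]_q[n-1]_q\cdots[n-k+1]_q}{[k]_q!}$. "Of finite (affine) type" means that the GCM is of finite (affine) type. A proper two-sided ideal $J$ of a ring $B$ is completely prime if $B/J$ is an integral domain (possibly non-commutative, nonzero, without zero divisors). Tempered domain: a filtration of an algebra $B$ over a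 field $k$ is an increasing sequence of $k$-subspaces $F_0B\subset F_1B\subset\cdots$ with union $B$, $1\in F_0B$, $F_mB\,F_nB\subset F_{m+n}B$; $B$ is a tempered domain over $k$ if it is an integral domain having a filtration with all $\dim_kF_mB<\infty$ and $\limsup_m(\dim_kF_mB)^{1/m}\le1$. A left (right) Ore domain is an integral domain $B$ with $Ba\cap Bb\neq0$ (resp. $aB\cap bB\ne0$) for all nonzero $a,b\in B$; Ore domain means both left and right. *)

theory Defs
  imports
    Complex_Main
    "HOL-Library.Poly_Mapping"
    "HOL-Library.Liminf_Limsup"
    "HOL-Library.Extended_Real"
    "HOL-Combinatorics.Permutations"
    "HOL-Computational_Algebra.Polynomial"
    "HOL-Computational_Algebra.Fraction_Field"
    "HOL-Algebra.QuotRing"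
    "HOL-Algebra.Subrings"
    "Jordan_Normal_Form.VS_Connect"
begin

section \<open>Associative algebras over a field\<close>

text \<open>
  An associative unital algebra is carried by the record type \<^type>\<open>module\<close>, which already has
  a ring multiplication. The locale \<open>algebra\<close> of HOL-Algebra is not applicable, and neither is
  \<open>domain\<close>: both are commutative.
\<close>

definition assoc_algebra :: "('k, 'm) ring_scheme \<Rightarrow> ('k, 'a, 'n) module_scheme \<Rightarrow> bool" where
  "assoc_algebra k A \<longleftrightarrow> vectorspace k A \<and> ring A \<and>
     (\<forall>c\<in>carrier k. \<forall>x\<in>carrier A. \<forall>y\<in>carrier A.
        (c \<odot>\<^bsub>A\<^esub> x) \<otimes>\<^bsub>A\<^esub> y = c \<odot>\<^bsub>A\<^esub> (x \<otimes>\<^bsub>A\<^esub> y) \<and> x \<otimes>\<^bsub>A\<^esub> (c \<odot>\<^bsub>A\<^esub> y) = c \<odot>\<^bsub>A\<^esub> (x \<otimes>\<^bsub>A\<^esub> y))"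

definition unital_subalgebra ::
    "('k, 'm) ring_scheme \<Rightarrow> 'a set \<Rightarrow> ('k, 'a, 'n) module_scheme \<Rightarrow> bool" where
  "unital_subalgebra k B A \<longleftrightarrow> subring B A \<and> (\<forall>c\<in>carrier k. \<forall>x\<in>B. c \<odot>\<^bsub>A\<^esub> x \<in> B)"

definition integral_domain :: "('a, 'm) ring_scheme \<Rightarrow> bool" where
  "integral_domain R \<longleftrightarrow> ring R \<and> \<one>\<^bsub>R\<^esub> \<noteq> \<zero>\<^bsub>R\<^esub> \<and>
     (\<forall>x\<in>carrier R. \<forall>y\<in>carrier R. x \<otimes>\<^bsub>R\<^esub> y = \<zero>\<^bsub>R\<^esub> \<longrightarrow> x = \<zero>\<^bsub>R\<^esub> \<or> y = \<zero>\<^bsub>R\<^esub>)"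

definition completely_prime :: "'a set \<Rightarrow> ('a, 'm) ring_scheme \<Rightarrow> bool" where
  "completely_prime J R \<longleftrightarrow> ideal J R \<and> J \<noteq> carrier R \<and> integral_domain (R Quot J)"

text \<open>
  The quotient ring of HOL-Algebra, with its scalar multiplication. A two-sided ideal of a unital
  algebra is stable under scalars, so the union below is just the coset of \<open>c \<odot> x\<close> for any \<open>x \<in> X\<close>.
\<close>

definition alg_quot :: "('k, 'a, 'm) module_scheme \<Rightarrow> 'a set \<Rightarrow> ('k, 'a set) module" where
  "alg_quot A J =
     \<lparr>carrier = carrier (A Quot J), mult = mult (A Quot J), one = one (A Quot J),
      zero = zero (A Quot J), add = add (A Quot J),
      smult = (\<lambda>c X. \<Union>x\<in>X. J +>\<^bsub>A\<^esub> (c \<odot>\<^bsub>A\<^esub> x))\<rparr>"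

definition algebra_filtration ::
    "('k, 'm) ring_scheme \<Rightarrow> ('k, 'a, 'n) module_scheme \<Rightarrow> (nat \<Rightarrow> 'a set) \<Rightarrow> bool" where
  "algebra_filtration k A F \<longleftrightarrow>
     (\<forall>m. VectorSpace.subspace k (F m) A) \<and> (\<forall>m. F m \<subseteq> F (Suc m)) \<and>
     (\<Union>m. F m) = carrier A \<and> \<one>\<^bsub>A\<^esub> \<in> F 0 \<and>
     (\<forall>m n. \<forall>x\<in>F m. \<forall>y\<in>F n. x \<otimes>\<^bsub>A\<^esub> y \<in> F (m + n))"

definition tempered_domain :: "('k, 'm) ring_scheme \<Rightarrow> ('k, 'a, 'n) module_scheme \<Rightarrow> bool" where
  "tempered_domain k A \<longleftrightarrow> assoc_algebra k A \<and> integral_domain A \<and>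
     (\<exists>F. algebra_filtration k A F \<and>
        (\<forall>m. vectorspace.fin_dim k (A\<lparr>carrier := F m\<rparr>)) \<and>
        limsup (\<lambda>m. ereal (root m (real (vectorspace.dim k (A\<lparr>carrier := F m\<rparr>))))) \<le> 1)"

definition left_ore_domain :: "('a, 'm) ring_scheme \<Rightarrow> bool" where
  "left_ore_domain R \<longleftrightarrow> integral_domain R \<and>
     (\<forall>a \<in> carrier R - {\<zero>\<^bsub>R\<^esub>}. \<forall>b \<in> carrier R - {\<zero>\<^bsub>R\<^esub>}.
        {x \<otimes>\<^bsub>R\<^esub> a | x. x \<in> carrier R} \<inter> {x \<otimes>\<^bsub>R\<^esub> b | x. x \<in> carrier R} \<noteq> {\<zero>\<^bsub>R\<^esub>})"

definition right_ore_domain :: "('a, 'm) ring_scheme \<Rightarrow> bool" where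
  "right_ore_domain R \<longleftrightarrow> integral_domain R \<and>
     (\<forall>a \<in> carrier R - {\<zero>\<^bsub>R\<^esub>}. \<forall>b \<in> carrier R - {\<zero>\<^bsub>R\<^esub>}.
        {a \<otimes>\<^bsub>R\<^esub> x | x. x \<in> carrier R} \<inter> {b \<otimes>\<^bsub>R\<^esub> x | x. x \<in> carrier R} \<noteq> {\<zero>\<^bsub>R\<^esub>})"

definition ore_domain :: "('a, 'm) ring_scheme \<Rightarrow> bool" where
  "ore_domain R \<longleftrightarrow> left_ore_domain R \<and> right_ore_domain R"


section \<open>Associative algebras presented by generators and relations\<close>

definition pscale :: "'k \<Rightarrow> ('w \<Rightarrow>\<^sub>0 'k) \<Rightarrow> ('w \<Rightarrow>\<^sub>0 'k::semiring_0)" where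
  "pscale c f = Poly_Mapping.map ((*) c) f"

lemma lookup_pscale: "Poly_Mapping.lookup (pscale c f) w = c * Poly_Mapping.lookup f w"
  by (simp add: pscale_def Poly_Mapping.map.rep_eq Poly_Mapping.when_def)

lemma module_pscale: "Modules.module (pscale :: 'k::comm_ring_1 \<Rightarrow> ('w \<Rightarrow>\<^sub>0 'k) \<Rightarrow> _)"
  by unfold_locales
    (auto intro!: poly_mapping_eqI simp: lookup_pscale lookup_add algebra_simps)

text \<open>
  The elements of the free monoid are words. With the convolution product of
  \<^theory>\<open>HOL-Library.Poly_Mapping\<close>, the finitely supported functions on words form the free
  associative algebra.
\<close>

datatype 'g free_monoid = Word (letters: "'g list")

instantiation free_monoid :: (type) monoid_add
begin

definition zero_free_monoid :: "'a free_monoid" where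
  "0 = Word []"

definition plus_free_monoid :: "'a free_monoid \<Rightarrow> 'a free_monoid \<Rightarrow> 'a free_monoid" where
  "v + w = Word (letters v @ letters w)"

instance
  by standard (simp_all add: zero_free_monoid_def plus_free_monoid_def)

end

definition gen :: "'g \<Rightarrow> ('g free_monoid \<Rightarrow>\<^sub>0 'k::field)" where
  "gen g = Poly_Mapping.single (Word [g]) 1"

definition free_algebra :: "'g set \<Rightarrow> ('k::field, 'g free_monoid \<Rightarrow>\<^sub>0 'k) module" where
  "free_algebra G =
     \<lparr>carrier = {f. \<forall>w\<in>Poly_Mapping.keys f. set (letters w) \<subseteq> G},
      mult = (*), one = 1, zero = 0, add = (+), smult = pscale\<rparr>"

lemma ring_free_algebra: "ring (free_algebra G :: ('k::field, 'g free_monoid \<Rightarrow>\<^sub>0 'k) module)"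
proof -
  let ?A = "free_algebra G :: ('k, 'g free_monoid \<Rightarrow>\<^sub>0 'k) module"
  have mult: "f * g \<in> carrier ?A" if "f \<in> carrier ?A" "g \<in> carrier ?A" for f g
  proof -
    have "set (letters w) \<subseteq> G" if w: "w \<in> Poly_Mapping.keys (f * g)" for w
    proof -
      obtain u v where "w = u + v" "u \<in> Poly_Mapping.keys f" "v \<in> Poly_Mapping.keys g"
        using w keys_mult[of f g] by blast
      then show ?thesis
        using \<open>f \<in> carrier ?A\<close> \<open>g \<in> carrier ?A\<close>
        by (simp add: free_algebra_def plus_free_monoid_def)
    qed
    then show ?thesis
      by (simp add: free_algebra_def)
  qed
  have add: "f + g \<in> carrier ?A" if "f \<in> carrier ?A" "g \<in> carrier ?A" for f g
    using that Poly_Mapping.keys_add[of f g] unfolding free_algebra_def by auto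
  have inverse: "\<exists>g\<in>carrier ?A. g \<oplus>\<^bsub>?A\<^esub> f = \<zero>\<^bsub>?A\<^esub>" if "f \<in> carrier ?A" for f
    using that by (intro bexI[of _ "- f"]) (simp_all add: free_algebra_def)
  have units: "\<one>\<^bsub>?A\<^esub> \<in> carrier ?A" "\<zero>\<^bsub>?A\<^esub> \<in> carrier ?A"
    by (simp_all add: free_algebra_def zero_free_monoid_def)
  have ops: "f \<otimes>\<^bsub>?A\<^esub> g = f * g" "f \<oplus>\<^bsub>?A\<^esub> g = f + g" "\<one>\<^bsub>?A\<^esub> = 1" "\<zero>\<^bsub>?A\<^esub> = 0" for f g
    by (simp_all add: free_algebra_def)
  show ?thesis
    by (intro ringI abelian_groupI monoidI inverse units)
      (simp_all only: ops mult add ring_distribs mult.assoc ac_simps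
        mult_1_left mult_1_right add_0_left add_0_right)
qed

definition presented_algebra ::
    "'g set \<Rightarrow> ('g free_monoid \<Rightarrow>\<^sub>0 'k) set \<Rightarrow> ('k::field, ('g free_monoid \<Rightarrow>\<^sub>0 'k) set) module" where
  "presented_algebra G R = alg_quot (free_algebra G) (genideal (free_algebra G) R)"


section \<open>Lie algebras presented by generators and relations\<close>

record ('k, 'a) lie_algebra =
  lie_carrier :: "'a set"
  lie_add :: "'a \<Rightarrow> 'a \<Rightarrow> 'a"
  lie_smult :: "'k \<Rightarrow> 'a \<Rightarrow> 'a"
  lie_bracket :: "'a \<Rightarrow> 'a \<Rightarrow> 'a"

text \<open>
  As in Bourbaki, the free Lie algebra is the free nonassociative algebra (on the free magma) modulo
  the two-sided ideal generated by all \<open>[f, f]\<close> and all Jacobi sums; the defining relations are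
  divided out at the same time.
\<close>

datatype 'g magma = Leaf 'g | Prod "'g magma" "'g magma"

definition mgen :: "'g \<Rightarrow> ('g magma \<Rightarrow>\<^sub>0 'k::field)" where
  "mgen g = Poly_Mapping.single (Leaf g) 1"

definition mbr :: "('g magma \<Rightarrow>\<^sub>0 'k) \<Rightarrow> ('g magma \<Rightarrow>\<^sub>0 'k) \<Rightarrow> ('g magma \<Rightarrow>\<^sub>0 'k::field)" where
  "mbr f g = (\<Sum>s\<in>Poly_Mapping.keys f. \<Sum>t\<in>Poly_Mapping.keys g.
     Poly_Mapping.single (Prod s t) (Poly_Mapping.lookup f s * Poly_Mapping.lookup g t))"

definition free_nonassoc :: "'g set \<Rightarrow> ('g magma \<Rightarrow>\<^sub>0 'k::field) set" where
  "free_nonassoc G = {f. \<forall>w\<in>Poly_Mapping.keys f. set_magma w \<subseteq> G}"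

inductive_set lie_ideal :: "'g set \<Rightarrow> ('g magma \<Rightarrow>\<^sub>0 'k::field) set \<Rightarrow> ('g magma \<Rightarrow>\<^sub>0 'k) set"
  for G :: "'g set" and R :: "('g magma \<Rightarrow>\<^sub>0 'k) set" where
  rel: "r \<in> R \<Longrightarrow> r \<in> lie_ideal G R"
| alternating: "f \<in> free_nonassoc G \<Longrightarrow> mbr f f \<in> lie_ideal G R"
| jacobi: "f \<in> free_nonassoc G \<Longrightarrow> g \<in> free_nonassoc G \<Longrightarrow> h \<in> free_nonassoc G \<Longrightarrow>
    mbr f (mbr g h) + mbr g (mbr h f) + mbr h (mbr f g) \<in> lie_ideal G R"
| zero: "0 \<in> lie_ideal G R"
| add: "f \<in> lie_ideal G R \<Longrightarrow> g \<in> lie_ideal G R \<Longrightarrow> f + g \<in> lie_ideal G R"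
| scale: "f \<in> lie_ideal G R \<Longrightarrow> pscale c f \<in> lie_ideal G R"
| left: "f \<in> free_nonassoc G \<Longrightarrow> g \<in> lie_ideal G R \<Longrightarrow> mbr f g \<in> lie_ideal G R"
| right: "f \<in> free_nonassoc G \<Longrightarrow> g \<in> lie_ideal G R \<Longrightarrow> mbr g f \<in> lie_ideal G R"

definition lie_coset ::
    "'g set \<Rightarrow> ('g magma \<Rightarrow>\<^sub>0 'k::field) set \<Rightarrow> ('g magma \<Rightarrow>\<^sub>0 'k) \<Rightarrow> ('g magma \<Rightarrow>\<^sub>0 'k) set" where
  "lie_coset G R f = {f + r | r. r \<in> lie_ideal G R}"

definition presented_lie_algebra ::
    "'g set \<Rightarrow> ('g magma \<Rightarrow>\<^sub>0 'k::field) set \<Rightarrow> ('k, ('g magma \<Rightarrow>\<^sub>0 'k) set) lie_algebra" where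
  "presented_lie_algebra G R =
     \<lparr>lie_carrier = lie_coset G R ` free_nonassoc G,
      lie_add = (\<lambda>X Y. \<Union>f\<in>X. \<Union>g\<in>Y. lie_coset G R (f + g)),
      lie_smult = (\<lambda>c X. \<Union>f\<in>X. lie_coset G R (pscale c f)),
      lie_bracket = (\<lambda>X Y. \<Union>f\<in>X. \<Union>g\<in>Y. lie_coset G R (mbr f g))\<rparr>"

text \<open>
  The first two families of relations turn the free algebra on the set \<open>L\<close> into the tensor algebra of
  the vector space \<open>L\<close>.
\<close>

definition enveloping_algebra ::
    "('k::field, 'a) lie_algebra \<Rightarrow> ('k, ('a free_monoid \<Rightarrow>\<^sub>0 'k) set) module" where
  "enveloping_algebra L = presented_algebra (lie_carrier L)
     ({gen (lie_add L x y) - gen x - gen y | x y. x \<in> lie_carrier L \<and> y \<in> lie_carrier L} \<union>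
      {gen (lie_smult L c x) - pscale c (gen x) | c x. x \<in> lie_carrier L} \<union>
      {gen (lie_bracket L x y) - (gen x * gen y - gen y * gen x) | x y.
         x \<in> lie_carrier L \<and> y \<in> lie_carrier L})"


section \<open>Generalized Cartan matrices and root data\<close>

definition gcm :: "'i set \<Rightarrow> ('i \<Rightarrow> 'i \<Rightarrow> int) \<Rightarrow> bool" where
  "gcm I a \<longleftrightarrow> finite I \<and> (\<forall>i\<in>I. a i i = 2) \<and>
     (\<forall>i\<in>I. \<forall>j\<in>I. i \<noteq> j \<longrightarrow> a i j \<le> 0) \<and>
     (\<forall>i\<in>I. \<forall>j\<in>I. a i j = 0 \<longleftrightarrow> a j i = 0)"

definition symmetrized_by :: "'i set \<Rightarrow> ('i \<Rightarrow> 'i \<Rightarrow> int) \<Rightarrow> ('i \<Rightarrow> rat) \<Rightarrow> bool" where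
  "symmetrized_by I a d \<longleftrightarrow> (\<forall>i\<in>I. d i > 0) \<and>
     (\<forall>i\<in>I. \<forall>j\<in>I. d i * of_int (a i j) = d j * of_int (a j i))"

text \<open>
  The determinant of \<open>(a i j)\<close> with \<open>i, j \<in> S\<close>, by the Leibniz formula, since the index set is
  neither a type nor an initial segment of the natural numbers.
\<close>

definition principal_minor :: "('i \<Rightarrow> 'i \<Rightarrow> int) \<Rightarrow> 'i set \<Rightarrow> int" where
  "principal_minor a S = (\<Sum>p | p permutes S. sign p * (\<Prod>i\<in>S. a i (p i)))"

definition finite_type :: "'i set \<Rightarrow> ('i \<Rightarrow> 'i \<Rightarrow> int) \<Rightarrow> bool" where
  "finite_type I a \<longleftrightarrow> (\<forall>S\<subseteq>I. principal_minor a S > 0)"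

definition affine_type :: "'i set \<Rightarrow> ('i \<Rightarrow> 'i \<Rightarrow> int) \<Rightarrow> bool" where
  "affine_type I a \<longleftrightarrow> (\<forall>S\<subset>I. principal_minor a S > 0) \<and> principal_minor a I = 0"

definition int_scale :: "int \<Rightarrow> 'a::ab_group_add \<Rightarrow> 'a" where
  "int_scale n x = (if n \<ge> 0 then ((+) x ^^ nat n) 0 else - (((+) x ^^ nat (- n)) 0))"

lemma module_int_scale: "Modules.module (int_scale :: int \<Rightarrow> 'a::ab_group_add \<Rightarrow> 'a)"
proof -
  define N :: "nat \<Rightarrow> 'a \<Rightarrow> 'a" where "N = (\<lambda>n x. ((+) x ^^ n) 0)"
  have N_0: "N 0 x = 0" and N_Suc: "N (Suc n) x = x + N n x" for n x
    by (simp_all add: N_def)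
  have N_add: "N (m + n) x = N m x + N n x" for m n x
    by (induction m) (simp_all add: N_0 N_Suc add.assoc)
  have N_plus: "N n (x + y) = N n x + N n y" for n x y
    by (induction n) (simp_all add: N_0 N_Suc algebra_simps)
  have N_minus: "N n (x - y) = N n x - N n y" for n x y
    using N_plus[of n "x - y" y] by simp
  have N_mult: "N (m * n) x = N m (N n x)" for m n x
    by (induction m) (simp_all add: N_0 N_Suc N_add)
  have diff: "int_scale (int m - int n) x = N m x - N n x" for m n x
  proof (cases "n \<le> m")
    case True
    then show ?thesis
      using N_add[of "m - n" n x] by (simp add: int_scale_def N_def nat_diff_distrib)
  next
    case False
    then show ?thesis
      using N_add[of "n - m" m x] by (simp add: int_scale_def N_def nat_diff_distrib)
  qed
  show ?thesis
  proof
    fix k l :: int and x y :: 'a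
    obtain a b where k: "k = int a - int b" by (metis int_diff_cases)
    obtain c d where l: "l = int c - int d" by (metis int_diff_cases)
    show "int_scale k (x + y) = int_scale k x + int_scale k y"
      by (simp add: k diff N_plus)
    have "k + l = int (a + c) - int (b + d)"
      by (simp add: k l)
    then show "int_scale (k + l) x = int_scale k x + int_scale l x"
      by (simp only: k l diff N_add) simp
    have "k * l = int (a * c + b * d) - int (a * d + b * c)"
      by (simp add: k l algebra_simps)
    then show "int_scale k (int_scale l x) = int_scale (k * l) x"
      by (simp only: k l diff N_add N_mult N_minus) simp
    show "int_scale 1 x = x"
      by (simp add: int_scale_def)
  qed
qed

definition fg_free :: "'a::ab_group_add itself \<Rightarrow> bool" where
  "fg_free _ \<longleftrightarrow> (\<exists>B :: 'a set. finite B \<and>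
     \<not> Modules.module.dependent int_scale B \<and> Modules.module.span int_scale B = UNIV)"

definition perfect_pairing :: "('y::ab_group_add \<Rightarrow> 'x::ab_group_add \<Rightarrow> int) \<Rightarrow> bool" where
  "perfect_pairing p \<longleftrightarrow>
     (\<forall>x. Modules.additive (\<lambda>y. p y x)) \<and> (\<forall>y. Modules.additive (p y)) \<and>
     bij_betw p UNIV {f. Modules.additive f} \<and>
     bij_betw (\<lambda>x y. p y x) UNIV {f. Modules.additive f}"

definition root_datum ::
    "'i set \<Rightarrow> ('i \<Rightarrow> 'i \<Rightarrow> int) \<Rightarrow> ('y::ab_group_add \<Rightarrow> 'x::ab_group_add \<Rightarrow> int) \<Rightarrow>
     ('i \<Rightarrow> 'y) \<Rightarrow> ('i \<Rightarrow> 'x) \<Rightarrow> bool" where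
  "root_datum I a p \<alpha>v \<alpha> \<longleftrightarrow> fg_free TYPE('y) \<and> fg_free TYPE('x) \<and> perfect_pairing p \<and>
     (\<forall>i\<in>I. \<forall>j\<in>I. p (\<alpha>v i) (\<alpha> j) = a i j)"


section \<open>The complexification of an abelian group\<close>

text \<open>
  The tensor product of \<open>\<complex>\<close> and \<open>Y\<close> over \<open>\<int>\<close>, as the complex vector space on the symbols
  \<open>1 \<otimes> y\<close> modulo additivity in \<open>y\<close> (which implies \<open>1 \<otimes> n y = n \<otimes> y\<close> for integers \<open>n\<close>).
\<close>

definition tensor_null :: "('y::ab_group_add \<Rightarrow>\<^sub>0 complex) set" where
  "tensor_null = Modules.module.span pscale
     {Poly_Mapping.single (y + z) 1 - Poly_Mapping.single y 1 - Poly_Mapping.single z 1 | y z. True}"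

definition tensor_rel :: "('y::ab_group_add \<Rightarrow>\<^sub>0 complex) \<Rightarrow> ('y \<Rightarrow>\<^sub>0 complex) \<Rightarrow> bool" where
  "tensor_rel f g \<longleftrightarrow> f - g \<in> tensor_null"

lemma tensor_null_zero: "0 \<in> tensor_null"
  unfolding tensor_null_def by (rule module.span_zero[OF module_pscale])

lemma tensor_null_add: "f \<in> tensor_null \<Longrightarrow> g \<in> tensor_null \<Longrightarrow> f + g \<in> tensor_null"
  unfolding tensor_null_def by (rule module.span_add[OF module_pscale])

lemma tensor_null_diff: "f \<in> tensor_null \<Longrightarrow> g \<in> tensor_null \<Longrightarrow> f - g \<in> tensor_null"
  unfolding tensor_null_def by (rule module.span_diff[OF module_pscale])

lemma tensor_null_scale: "f \<in> tensor_null \<Longrightarrow> pscale c f \<in> tensor_null"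
  unfolding tensor_null_def by (rule module.span_scale[OF module_pscale])

lemma equivp_tensor_rel: "equivp (tensor_rel :: ('y::ab_group_add \<Rightarrow>\<^sub>0 complex) \<Rightarrow> _)"
proof (rule equivpI)
  show "reflp (tensor_rel :: ('y::ab_group_add \<Rightarrow>\<^sub>0 complex) \<Rightarrow> _)"
    by (simp add: reflp_def tensor_rel_def tensor_null_zero)
  show "symp (tensor_rel :: ('y \<Rightarrow>\<^sub>0 complex) \<Rightarrow> _)"
  proof (rule sympI)
    fix f g :: "'y \<Rightarrow>\<^sub>0 complex"
    assume "tensor_rel f g"
    then show "tensor_rel g f"
      using tensor_null_diff[OF tensor_null_zero, of "f - g"] by (simp add: tensor_rel_def)
  qed
  show "transp (tensor_rel :: ('y \<Rightarrow>\<^sub>0 complex) \<Rightarrow> _)"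
  proof (rule transpI)
    fix f g h :: "'y \<Rightarrow>\<^sub>0 complex"
    assume "tensor_rel f g" "tensor_rel g h"
    then show "tensor_rel f h"
      using tensor_null_add[of "f - g" "g - h"] by (simp add: tensor_rel_def)
  qed
qed

quotient_type (overloaded) 'y complexification = "'y::ab_group_add \<Rightarrow>\<^sub>0 complex" / tensor_rel
  by (rule equivp_tensor_rel)

instantiation complexification :: (ab_group_add) ab_group_add
begin

lift_definition zero_complexification :: "'a complexification" is 0 .

lift_definition plus_complexification ::
    "'a complexification \<Rightarrow> 'a complexification \<Rightarrow> 'a complexification" is "(+)"
proof -
  fix f f' g g' :: "'a \<Rightarrow>\<^sub>0 complex"
  assume "tensor_rel f f'" "tensor_rel g g'"
  then show "tensor_rel (f + g) (f' + g')"
    using tensor_null_add[of "f - f'" "g - g'"] by (simp add: tensor_rel_def algebra_simps)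
qed

lift_definition uminus_complexification :: "'a complexification \<Rightarrow> 'a complexification" is uminus
proof -
  fix f f' :: "'a \<Rightarrow>\<^sub>0 complex"
  assume "tensor_rel f f'"
  then show "tensor_rel (- f) (- f')"
    using tensor_null_diff[OF tensor_null_zero, of "f - f'"] by (simp add: tensor_rel_def)
qed

definition minus_complexification ::
    "'a complexification \<Rightarrow> 'a complexification \<Rightarrow> 'a complexification" where
  "minus_complexification h h' = h + (- h')"

instance
proof
  fix x y z :: "'a complexification"
  show "x + y + z = x + (y + z)"
    by transfer (simp add: tensor_rel_def tensor_null_zero algebra_simps)
  show "x + y = y + x"
    by transfer (simp add: tensor_rel_def tensor_null_zero algebra_simps)
  show "0 + x = x"
    by transfer (simp add: tensor_rel_def tensor_null_zero)
  show "- x + x = 0"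
    by transfer (simp add: tensor_rel_def tensor_null_zero)
  show "x - y = x + - y"
    by (simp add: minus_complexification_def)
qed

end

lift_definition complexification_scale ::
    "complex \<Rightarrow> 'y::ab_group_add complexification \<Rightarrow> 'y complexification" is pscale
proof -
  fix c and f f' :: "'y \<Rightarrow>\<^sub>0 complex"
  assume "tensor_rel f f'"
  then show "tensor_rel (pscale c f) (pscale c f')"
    using tensor_null_scale[of "f - f'" c]
    by (simp add: tensor_rel_def module.scale_right_diff_distrib[OF module_pscale])
qed

lift_definition of_lattice :: "'y::ab_group_add \<Rightarrow> 'y complexification" is
  "\<lambda>y. Poly_Mapping.single y 1" .

text \<open>
  The complex-linear extension of a pairing to the complexification, computed on a representative.
  The choice is immaterial for a pairing that is additive in its first argument.
\<close>

definition pairing_ext ::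
    "('y::ab_group_add \<Rightarrow> 'x \<Rightarrow> int) \<Rightarrow> 'y complexification \<Rightarrow> 'x \<Rightarrow> complex" where
  "pairing_ext p h x =
     (let f = rep_complexification h in
      \<Sum>y\<in>Poly_Mapping.keys f. Poly_Mapping.lookup f y * of_int (p y x))"

lemma pairing_ext_abs:
  assumes "Modules.additive (\<lambda>y. p y x)"
  shows "pairing_ext p (abs_complexification f) x =
    (\<Sum>y\<in>Poly_Mapping.keys f. Poly_Mapping.lookup f y * of_int (p y x))"
proof -
  define e :: "('a \<Rightarrow>\<^sub>0 complex) \<Rightarrow> complex" where
    "e = (\<lambda>f. \<Sum>y\<in>Poly_Mapping.keys f. Poly_Mapping.lookup f y * of_int (p y x))"
  have e_alt: "e f = (\<Sum>y\<in>A. Poly_Mapping.lookup f y * of_int (p y x))"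
    if "finite A" "Poly_Mapping.keys f \<subseteq> A" for f A
    unfolding e_def using that by (intro sum.mono_neutral_left) (auto simp: in_keys_iff)
  have e_add: "e (f + g) = e f + e g" for f g
    using keys_add[of f g]
    by (subst (1 2 3) e_alt[of "Poly_Mapping.keys f \<union> Poly_Mapping.keys g"])
      (auto simp: lookup_add ring_distribs sum.distrib)
  have e_scale: "e (pscale c f) = c * e f" for c f
    by (subst (1 2) e_alt[of "Poly_Mapping.keys f"])
      (auto simp: in_keys_iff lookup_pscale sum_distrib_left mult.assoc)
  have e_diff: "e (f - g) = e f - e g" for f g
    using e_add[of "f - g" g] by simp
  have e_single: "e (Poly_Mapping.single y 1) = of_int (p y x)" for y
    by (simp add: e_def)
  have null: "e f = 0" if "f \<in> tensor_null" for f
    using that unfolding tensor_null_def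
  proof (induction rule: module.span_induct_alt[OF module_pscale, consumes 1, case_names base step])
    case base
    then show ?case by (simp add: e_def)
  next
    case (step c g h)
    then show ?case
      by (auto simp: e_add e_scale e_diff e_single additive.add[OF assms])
  qed
  have "tensor_rel (rep_complexification (abs_complexification f)) f"
    unfolding complexification.abs_eq_iff[symmetric]
    by (rule Quotient3_abs_rep[OF Quotient3_complexification])
  then have "e (rep_complexification (abs_complexification f)) = e f"
    using null e_diff by (fastforce simp: tensor_rel_def)
  then show ?thesis
    by (simp add: pairing_ext_def e_def Let_def)
qed


section \<open>Kac--Moody algebras\<close>

datatype ('i, 'h) km_gen = KE 'i | KF 'i | KH 'h

definition km_generators :: "'i set \<Rightarrow> ('i, 'h) km_gen set" where
  "km_generators I = KE ` I \<union> KF ` I \<union> range KH"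

definition km_relations ::
    "'i set \<Rightarrow> ('i \<Rightarrow> 'i \<Rightarrow> int) \<Rightarrow> ('y::ab_group_add \<Rightarrow> 'x::ab_group_add \<Rightarrow> int) \<Rightarrow>
     ('i \<Rightarrow> 'y) \<Rightarrow> ('i \<Rightarrow> 'x) \<Rightarrow> (('i, 'y complexification) km_gen magma \<Rightarrow>\<^sub>0 complex) set" where
  "km_relations I a p \<alpha>v \<alpha> =
     (let E = (\<lambda>i. mgen (KE i)); F = (\<lambda>i. mgen (KF i)); H = (\<lambda>h. mgen (KH h)) in
     {H (h + h') - H h - H h' | h h'. True} \<union>
     {H (complexification_scale c h) - pscale c (H h) | c h. True} \<union>
     {mbr (H h) (H h') | h h'. True} \<union>
     {mbr (H h) (E i) - pscale (pairing_ext p h (\<alpha> i)) (E i) | h i. i \<in> I} \<union>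
     {mbr (H h) (F i) + pscale (pairing_ext p h (\<alpha> i)) (F i) | h i. i \<in> I} \<union>
     {mbr (E i) (F j) - (if i = j then H (of_lattice (\<alpha>v i)) else 0) | i j. i \<in> I \<and> j \<in> I} \<union>
     {(mbr (E i) ^^ nat (1 - a i j)) (E j) | i j. i \<in> I \<and> j \<in> I \<and> i \<noteq> j} \<union>
     {(mbr (F i) ^^ nat (1 - a i j)) (F j) | i j. i \<in> I \<and> j \<in> I \<and> i \<noteq> j})"

definition kac_moody ::
    "'i set \<Rightarrow> ('i \<Rightarrow> 'i \<Rightarrow> int) \<Rightarrow> ('y::ab_group_add \<Rightarrow> 'x::ab_group_add \<Rightarrow> int) \<Rightarrow>
     ('i \<Rightarrow> 'y) \<Rightarrow> ('i \<Rightarrow> 'x) \<Rightarrow>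
     (complex, (('i, 'y complexification) km_gen magma \<Rightarrow>\<^sub>0 complex) set) lie_algebra" where
  "kac_moody I a p \<alpha>v \<alpha> = presented_lie_algebra (km_generators I) (km_relations I a p \<alpha>v \<alpha>)"


section \<open>Quantized universal enveloping algebras\<close>

definition common_denom :: "'i set \<Rightarrow> ('i \<Rightarrow> rat) \<Rightarrow> nat" where
  "common_denom I d = (LEAST n. n > 0 \<and> (\<forall>i\<in>I. of_nat n * d i \<in> \<int>))"

text \<open>
  Write \<open>D\<close> for the common denominator. The field \<open>\<rat>(q\<^bsup>1/D\<^esup>)\<close> is \<^typ>\<open>rat poly fract\<close>, with
  \<open>q\<^bsup>1/D\<^esup>\<close> as the polynomial variable, so that \<open>q\<^bsup>m/D\<^esup>\<close> is \<open>q_root powi m\<close>. Since \<open>Y\<close> is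
  torsion free, multiplication by \<open>D\<close> identifies \<open>D\<^sup>-\<^sup>1 Y\<close> with \<open>Y\<close>: the generator \<open>q\<^bsup>y/D\<^esup>\<close> is
  written \<open>QK y\<close>. Hence \<open>K\<^sub>i = QK (D d\<^sub>i \<alpha>\<^sub>i\<^sup>v)\<close>, where \<open>D d\<^sub>i\<close> is an integer, and
  conjugation by \<open>QK y\<close> scales \<open>E\<^sub>i\<close> by \<open>q\<close> to the power \<open>p y \<alpha>\<^sub>i / D\<close>, i.e. by
  \<open>q_root powi p y \<alpha>\<^sub>i\<close>.
\<close>

definition q_root :: "rat poly fract" where
  "q_root = Fract [:0, 1:] 1"

definition scaled_d :: "'i set \<Rightarrow> ('i \<Rightarrow> rat) \<Rightarrow> 'i \<Rightarrow> int" where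
  "scaled_d I d i = \<lfloor>of_nat (common_denom I d) * d i\<rfloor>"

definition q_sub :: "'i set \<Rightarrow> ('i \<Rightarrow> rat) \<Rightarrow> 'i \<Rightarrow> rat poly fract" where
  "q_sub I d i = q_root powi scaled_d I d i"

definition q_int :: "'k::field \<Rightarrow> nat \<Rightarrow> 'k" where
  "q_int v n = (v powi int n - v powi - int n) / (v - inverse v)"

definition q_binomial :: "'k::field \<Rightarrow> nat \<Rightarrow> nat \<Rightarrow> 'k" where
  "q_binomial v n k = (\<Prod>j<k. q_int v (n - j)) / (\<Prod>j=1..k. q_int v j)"

datatype ('i, 'y) q_gen = QE 'i | QF 'i | QK 'y

definition q_generators :: "'i set \<Rightarrow> ('i, 'y) q_gen set" where
  "q_generators I = QE ` I \<union> QF ` I \<union> range QK"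

definition q_serre :: "'k \<Rightarrow> nat \<Rightarrow> ('g free_monoid \<Rightarrow>\<^sub>0 'k) \<Rightarrow> ('g free_monoid \<Rightarrow>\<^sub>0 'k) \<Rightarrow>
     ('g free_monoid \<Rightarrow>\<^sub>0 'k::field)" where
  "q_serre v n x y = (\<Sum>k=0..n. pscale ((-1) ^ k * q_binomial v n k) (x ^ k * y * x ^ (n - k)))"

definition q_relations ::
    "'i set \<Rightarrow> ('i \<Rightarrow> 'i \<Rightarrow> int) \<Rightarrow> ('i \<Rightarrow> rat) \<Rightarrow> ('y::ab_group_add \<Rightarrow> 'x::ab_group_add \<Rightarrow> int) \<Rightarrow>
     ('i \<Rightarrow> 'y) \<Rightarrow> ('i \<Rightarrow> 'x) \<Rightarrow> (('i, 'y) q_gen free_monoid \<Rightarrow>\<^sub>0 rat poly fract) set" where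
  "q_relations I a d p \<alpha>v \<alpha> =
     (let E = (\<lambda>i. gen (QE i)); F = (\<lambda>i. gen (QF i)); K = (\<lambda>y. gen (QK y));
          q = q_sub I d; \<kappa> = (\<lambda>i. int_scale (scaled_d I d i) (\<alpha>v i)) in
     {K 0 - 1} \<union>
     {K (y + z) - K y * K z | y z. True} \<union>
     {K y * E i * K (- y) - pscale (q_root powi p y (\<alpha> i)) (E i) | y i. i \<in> I} \<union>
     {K y * F i * K (- y) - pscale (q_root powi - p y (\<alpha> i)) (F i) | y i. i \<in> I} \<union>
     {E i * F j - F j * E i -
        (if i = j then pscale (inverse (q i - inverse (q i))) (K (\<kappa> i) - K (- \<kappa> i)) else 0) | i j.
        i \<in> I \<and> j \<in> I} \<union>
     {q_serre (q i) (nat (1 - a i j)) (E i) (E j) | i j. i \<in> I \<and> j \<in> I \<and> i \<noteq> j} \<union>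
     {q_serre (q i) (nat (1 - a i j)) (F i) (F j) | i j. i \<in> I \<and> j \<in> I \<and> i \<noteq> j})"

definition quantized_enveloping_algebra ::
    "'i set \<Rightarrow> ('i \<Rightarrow> 'i \<Rightarrow> int) \<Rightarrow> ('i \<Rightarrow> rat) \<Rightarrow> ('y::ab_group_add \<Rightarrow> 'x::ab_group_add \<Rightarrow> int) \<Rightarrow>
     ('i \<Rightarrow> 'y) \<Rightarrow> ('i \<Rightarrow> 'x) \<Rightarrow>
     (rat poly fract, (('i, 'y) q_gen free_monoid \<Rightarrow>\<^sub>0 rat poly fract) set) module" where
  "quantized_enveloping_algebra I a d p \<alpha>v \<alpha> =
     presented_algebra (q_generators I) (q_relations I a d p \<alpha>v \<alpha>)"

end

theory Submission
  imports Defs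
begin

text \<open>
  Everything rests on a growth bound for the algebra generated by the \<open>E\<^sub>i\<close> subject to the Serre
  relations. The representation theory of \<open>sl(2)\<close> makes the dimensions of the weight spaces of its
  Lie algebra invariant under simple reflections. The symmetrized Cartan matrix is positive
  semidefinite, so a weight of positive norm can be reflected down to a simple root and has
  multiplicity at most one; any other weight lies in the radical of the form, so removing a simple
  root from it leaves a weight of positive norm, which bounds its multiplicity by the number of
  simple roots. Hence the dimension of the Lie algebra in degree \<open>h\<close> is polynomial in \<open>h\<close>, and
  ordered monomials give a subexponential growth bound. Specialization at \<open>q = 1\<close> carries it over
  to the \<open>q\<close>-Serre algebra, the triangular decomposition to the whole enveloping algebra, and it
  is inherited by subquotients. Finally, if \<open>B a \<inter> B b = 0\<close> in a filtered domain \<open>B\<close> with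
  \<open>a\<close> and \<open>b\<close> in degree \<open>r\<close>, then \<open>F\<^sub>m a \<oplus> F\<^sub>m b \<subseteq> F\<^sub>m\<^sub>+\<^sub>r\<close>, so the dimensions double every \<open>r\<close>
  steps and grow exponentially.
\<close>

text \<open>Every estimate is an upper bound for a dimension. Until the last step the algebras are
  therefore represented as a free algebra modulo a subspace \<open>N\<close>, and a bound is a
  finite set that spans modulo \<open>N\<close>. Representation theory of sl(2) enters as
  surjectivity of a power of \<open>ad (gen i)\<close> from a weight space onto its mirror image.
  The lowering operators it requires exist already on the free algebra. They preserve the Serre
  ideal, because the exponents in the Serre relations are those for which these operators kill the
  relations.

  Spanning sets of Lie elements and of ordered monomials are converted back into sets of words,
  since a word has a meaning over each coefficient field and in the classical as well as the quantum
  algebra. The comparison at q = 1 is then semicontinuity of rank: words that span at the special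
  point also span generically.

  A subalgebra B need not be finitely generated. Its filtration is cut out of the ambient one, and a
  spanning set of the same bounded size is chosen inside each intersection; this is why exchange
  lemmas relative to a subspace come at the start.\<close>

section \<open>Linear algebra modulo a subspace\<close>

context vector_space
begin

text \<open>Steinitz exchange relative to \<open>N\<close>: elements are peeled off \<open>Z\<close>
  as long as \<open>w\<close> stays in the span of the rest; the first \<open>z\<close> whose
  removal loses \<open>w\<close> can be exchanged for it.\<close>

lemma exchange_mod:
  assumes "finite Z" "w \<in> span (Z \<union> N)" "w \<notin> span N"
  shows "\<exists>z\<in>Z. z \<in> span (insert w (Z - {z} \<union> N))"
  using assms
proof (induction Z rule: finite_induct)
  case empty
  then show ?case by simp
next
  case (insert z Z)
  show ?case
  proof (cases "w \<in> span (Z \<union> N)")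
    case True
    then obtain y where y: "y \<in> Z" "y \<in> span (insert w (Z - {y} \<union> N))"
      using insert by blast
    moreover have "insert w (Z - {y} \<union> N) \<subseteq> insert w (insert z Z - {y} \<union> N)"
      by blast
    ultimately show ?thesis
      by (meson insertI2 span_mono subsetD)
  next
    case False
    have "w \<in> span (insert z (Z \<union> N))"
      using insert.prems(1) by simp
    then have "z \<in> span (insert w (Z \<union> N))"
      using False by (rule in_span_insert)
    then show ?thesis
      using insert.hyps(2) by auto
  qed
qed

text \<open>Exchanged elements are absorbed into \<open>N\<close>, hence the induction generalizes
  over \<open>N\<close>. The point is that the small spanning set lies in \<open>W\<close> itself:
  this turns sets of Lie monomials into sets of words and later bounds the dimension of a
  subspace.\<close>

lemma spanning_subset_mod:
  assumes "finite Z" "W \<subseteq> span (Z \<union> N)"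
  shows "\<exists>Z'\<subseteq>W. finite Z' \<and> card Z' \<le> card Z \<and> W \<subseteq> span (Z' \<union> N)"
  using assms
proof (induction "card Z" arbitrary: Z N)
  case 0
  then show ?case by (intro exI[of _ "{}"]) auto
next
  case (Suc n)
  show ?case
  proof (cases "W \<subseteq> span N")
    case True
    then show ?thesis by (intro exI[of _ "{}"]) auto
  next
    case False
    then obtain w where w: "w \<in> W" "w \<notin> span N"
      by blast
    obtain z where z: "z \<in> Z" "z \<in> span (insert w (Z - {z} \<union> N))"
      using exchange_mod[OF Suc.prems(1) _ w(2)] w(1) Suc.prems(2) by blast
    let ?N = "insert w N"
    have "Z \<union> N \<subseteq> span (Z - {z} \<union> ?N)"
      using z by (auto intro: span_base)
    then have "W \<subseteq> span (Z - {z} \<union> ?N)"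
      using Suc.prems(2) span_minimal[OF _ subspace_span] by blast
    moreover have "n = card (Z - {z})"
      using Suc.hyps(2) Suc.prems(1) z(1) by simp
    ultimately obtain Z' where Z': "Z' \<subseteq> W" "finite Z'" "card Z' \<le> card (Z - {z})"
      "W \<subseteq> span (Z' \<union> ?N)"
      using Suc.hyps(1)[of "Z - {z}" ?N] Suc.prems(1) by auto
    show ?thesis
    proof (intro exI[of _ "insert w Z'"] conjI)
      have "card (insert w Z') \<le> Suc (card Z')"
        by (simp add: card_insert_if Z'(2))
      also have "\<dots> \<le> card Z"
        using Z'(3) \<open>n = card (Z - {z})\<close> Suc.hyps(2) by simp
      finally show "card (insert w Z') \<le> card Z" .
    qed (use Z' w in auto)
  qed
qed

text \<open>Failure to span is witnessed by a functional; the passage to q = 1 operates on such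
  witnesses.\<close>

lemma ex_separating_functional:
  assumes "w \<notin> span V"
  shows "\<exists>\<phi>. Vector_Spaces.linear scale (*) \<phi> \<and> (\<forall>v\<in>V. \<phi> v = 0) \<and> \<phi> w = 1"
proof -
  interpret s: vector_space "(*) :: 'a \<Rightarrow> 'a \<Rightarrow> 'a"
    by unfold_locales (simp_all add: algebra_simps)
  interpret p: vector_space_pair scale "(*) :: 'a \<Rightarrow> 'a \<Rightarrow> 'a"
    by unfold_locales
  obtain B where B: "B \<subseteq> V" "independent B" "V \<subseteq> span B"
    using basis_exists[of V] by metis
  have "span B = span V"
    using B by (metis span_mono span_span subset_antisym)
  then have "w \<notin> span B"
    using assms by simp
  then have "independent (insert w B)"
    using B(2) independent_insert by auto
  then obtain \<phi> where \<phi>: "Vector_Spaces.linear scale (*) \<phi>"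
    "\<forall>x\<in>insert w B. \<phi> x = (if x = w then 1 else 0)"
    using p.linear_independent_extend[of "insert w B" "\<lambda>x. if x = w then 1 else 0"] by blast
  have "\<phi> v = 0" if "v \<in> span B" for v
    using \<phi> \<open>w \<notin> span B\<close> span_base[of w B]
    by (intro p.linear_eq_0_on_span[OF \<phi>(1) _ that]) auto
  then show ?thesis
    using \<phi> B(3) by (intro exI[of _ \<phi>]) auto
qed

end

section \<open>Opposite weight spaces of locally nilpotent sl(2)-modules\<close>

section \<open>Representations of sl(2)\<close>

text \<open>
  A graded vector space on which \<open>e\<close> and \<open>f\<close> satisfy the relations of \<open>sl(2)\<close> modulo a stable
  subspace \<open>N\<close>; the space \<open>L k\<close> consists of vectors of weight \<open>k\<close>.
\<close>

locale sl2_mod = vector_space scale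
  for scale :: "'k::field_char_0 \<Rightarrow> 'v::ab_group_add \<Rightarrow> 'v" +
  fixes e f :: "'v \<Rightarrow> 'v" and N :: "'v set" and L :: "int \<Rightarrow> 'v set"
  assumes linear_e: "Vector_Spaces.linear scale scale e"
    and linear_f: "Vector_Spaces.linear scale scale f"
    and subspace_N: "subspace N"
    and subspace_L: "subspace (L k)"
    and e_N: "x \<in> N \<Longrightarrow> e x \<in> N"
    and f_N: "x \<in> N \<Longrightarrow> f x \<in> N"
    and e_L: "x \<in> L k \<Longrightarrow> e x \<in> L (k + 2)"
    and f_L: "x \<in> L k \<Longrightarrow> f x \<in> L (k - 2)"
    and e_f: "x \<in> L k \<Longrightarrow> e (f x) - f (e x) - scale (of_int k) x \<in> N"
    and e_nilpotent: "x \<in> L k \<Longrightarrow> \<exists>r. (e ^^ r) x \<in> N"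
begin

lemma e_add: "e (x + y) = e x + e y" and e_scale: "e (scale c x) = scale c (e x)"
  and e_diff: "e (x - y) = e x - e y"
  and f_add: "f (x + y) = f x + f y" and f_scale: "f (scale c x) = scale c (f x)"
  and f_diff: "f (x - y) = f x - f y"
proof -
  interpret e: Vector_Spaces.linear scale scale e by (rule linear_e)
  interpret f: Vector_Spaces.linear scale scale f by (rule linear_f)
  show "e (x + y) = e x + e y" "e (scale c x) = scale c (e x)" "e (x - y) = e x - e y"
    "f (x + y) = f x + f y" "f (scale c x) = scale c (f x)" "f (x - y) = f x - f y"
    by (simp_all add: e.add e.scale e.diff f.add f.scale f.diff)
qed

lemma pow_e_scale: "(e ^^ n) (scale c x) = scale c ((e ^^ n) x)"
  by (induction n) (simp_all add: e_scale)

lemma pow_e_diff: "(e ^^ n) (x - y) = (e ^^ n) x - (e ^^ n) y"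
  by (induction n) (simp_all add: e_diff)

lemma pow_e_N: "x \<in> N \<Longrightarrow> (e ^^ n) x \<in> N"
  by (induction n) (simp_all add: e_N)

lemma pow_e_L: "x \<in> L k \<Longrightarrow> (e ^^ n) x \<in> L (k + 2 * int n)"
proof (induction n)
  case (Suc n)
  then show ?case
    using e_L[of "(e ^^ n) x" "k + 2 * int n"] by (simp add: algebra_simps)
qed simp

lemma pow_f_L: "x \<in> L k \<Longrightarrow> (f ^^ n) x \<in> L (k - 2 * int n)"
proof (induction n)
  case (Suc n)
  then show ?case
    using f_L[of "(f ^^ n) x" "k - 2 * int n"] by (simp add: algebra_simps)
qed simp

text \<open>The classical formula for a primitive vector \<open>y\<close> of weight
  \<open>M\<close>, read modulo \<open>N\<close>. The coefficient is the sum of the weights of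
  \<open>y\<close>, \<open>f y\<close>, ..., \<open>(f ^^ k) y\<close>.\<close>

lemma e_pow_f:
  assumes "y \<in> L M" "e y \<in> N"
  shows "e ((f ^^ Suc k) y) - scale (of_int (int (Suc k) * (M - int k))) ((f ^^ k) y) \<in> N"
proof (induction k)
  case 0
  have "e (f y) - scale (of_int M) y = (e (f y) - f (e y) - scale (of_int M) y) + f (e y)"
    by simp
  also have "\<dots> \<in> N"
    by (intro subspace_add[OF subspace_N] e_f f_N assms)
  finally show ?case by simp
next
  case (Suc k)
  let ?c = "of_int (int (Suc k) * (M - int k)) :: 'k"
  let ?z = "(f ^^ Suc k) y"
  let ?w = "M - 2 * int (Suc k)"
  have "?z \<in> L ?w"
    by (rule pow_f_L[OF assms(1)])
  then have 1: "e (f ?z) - f (e ?z) - scale (of_int ?w) ?z \<in> N"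
    by (rule e_f)
  have 2: "f (e ?z - scale ?c ((f ^^ k) y)) \<in> N"
    by (rule f_N[OF Suc.IH])
  have "int (Suc (Suc k)) * (M - int (Suc k)) = ?w + int (Suc k) * (M - int k)"
    by (simp add: algebra_simps)
  then have "of_int (int (Suc (Suc k)) * (M - int (Suc k))) = of_int ?w + ?c"
    by (metis of_int_add)
  then have "e ((f ^^ Suc (Suc k)) y) -
      scale (of_int (int (Suc (Suc k)) * (M - int (Suc k)))) ?z
    = (e (f ?z) - f (e ?z) - scale (of_int ?w) ?z) + f (e ?z - scale ?c ((f ^^ k) y))"
    by (simp add: f_diff f_scale scale_left_distrib)
  also have "\<dots> \<in> N"
    by (rule subspace_add[OF subspace_N 1 2])
  finally show ?case .
qed

text \<open>The factors \<open>(j + 1) * (M - j)\<close> with \<open>j < M\<close> are nonzero in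
  characteristic 0, so climbing back up the string loses only a nonzero scalar.\<close>

lemma pow_e_pow_f:
  assumes "y \<in> L M" "e y \<in> N" "int r + int s \<le> M"
  shows "\<exists>c. c \<noteq> 0 \<and> (e ^^ r) ((f ^^ (r + s)) y) - scale c ((f ^^ s) y) \<in> N"
  using assms(3)
proof (induction r)
  case 0
  then show ?case
    by (intro exI[of _ 1]) (simp add: subspace_0[OF subspace_N])
next
  case (Suc r)
  then obtain c where c: "c \<noteq> 0" "(e ^^ r) ((f ^^ (r + s)) y) - scale c ((f ^^ s) y) \<in> N"
    by auto
  let ?b = "of_int (int (Suc (r + s)) * (M - int (r + s))) :: 'k"
  let ?z = "(f ^^ (r + s)) y"
  have "(e ^^ r) (e ((f ^^ Suc (r + s)) y) - scale ?b ?z) \<in> N"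
    by (rule pow_e_N[OF e_pow_f[OF assms(1,2)]])
  then have 1: "(e ^^ Suc r) ((f ^^ (Suc r + s)) y) - scale ?b ((e ^^ r) ?z) \<in> N"
    by (simp add: pow_e_diff pow_e_scale funpow_swap1)
  have 2: "scale ?b ((e ^^ r) ?z - scale c ((f ^^ s) y)) \<in> N"
    by (rule subspace_scale[OF subspace_N c(2)])
  have "(e ^^ Suc r) ((f ^^ (Suc r + s)) y) - scale (?b * c) ((f ^^ s) y) \<in> N"
    using subspace_add[OF subspace_N 1 2] by (simp add: scale_right_diff_distrib)
  moreover have "?b \<noteq> 0"
    using Suc.prems unfolding of_int_eq_0_iff by simp
  ultimately show ?case
    using c(1) by (intro exI[of _ "?b * c"]) simp
qed

text \<open>Induction on the nilpotency order of \<open>x\<close> under \<open>e\<close>. The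
  iterate \<open>y = (e ^^ r) x\<close> is primitive modulo \<open>N\<close>, and on its string
  everything is explicit; removing from \<open>x\<close> its part in that string lowers the
  order.\<close>

lemma weight_reflection_surj:
  assumes "x \<in> L (int m)"
  shows "\<exists>y\<in>L (- int m). x - (e ^^ m) y \<in> N"
proof -
  have "\<exists>y\<in>L (- int m). x - (e ^^ m) y \<in> N" if "x \<in> L (int m)" "(e ^^ r) x \<in> N" for r x
    using that
  proof (induction r arbitrary: x)
    case 0
    then show ?case
      by (intro bexI[of _ 0])
        (simp_all add: subspace_0[OF subspace_L] pow_e_scale[of m 0 0, simplified])
  next
    case (Suc r)
    define y where "y = (e ^^ r) x"
    let ?M = "int m + 2 * int r"
    have y: "y \<in> L ?M" "e y \<in> N"
      unfolding y_def using pow_e_L[OF Suc.prems(1), of r] Suc.prems(2) by simp_all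
    obtain c where c: "c \<noteq> 0" "(e ^^ r) ((f ^^ (r + 0)) y) - scale c ((f ^^ 0) y) \<in> N"
      using pow_e_pow_f[OF y, of r 0] by auto
    obtain b where b: "b \<noteq> 0" "(e ^^ m) ((f ^^ (m + r)) y) - scale b ((f ^^ r) y) \<in> N"
      using pow_e_pow_f[OF y, of m r] by auto
    \<comment> \<open>The scalar is chosen so that \<open>e ^^ r\<close> maps the subtracted term to
      \<open>y\<close> modulo \<open>N\<close>.\<close>
    define x' where "x' = x - scale (inverse c) ((f ^^ r) y)"
    have "(f ^^ r) y \<in> L (int m)"
      using pow_f_L[OF y(1), of r] by simp
    then have "x' \<in> L (int m)"
      unfolding x'_def
      using Suc.prems(1) by (intro subspace_diff[OF subspace_L] subspace_scale[OF subspace_L])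
    moreover have "(e ^^ r) x' \<in> N"
    proof -
      have "scale (- inverse c) ((e ^^ r) ((f ^^ r) y) - scale c y) \<in> N"
        using c(2) by (intro subspace_scale[OF subspace_N]) simp
      also have "scale (- inverse c) ((e ^^ r) ((f ^^ r) y) - scale c y) = (e ^^ r) x'"
        using c(1) by (simp add: x'_def pow_e_diff pow_e_scale y_def scale_right_diff_distrib)
      finally show ?thesis .
    qed
    ultimately obtain z where z: "z \<in> L (- int m)" "x' - (e ^^ m) z \<in> N"
      using Suc.IH by blast
    \<comment> \<open>\<open>e ^^ m\<close> maps \<open>(f ^^ (m + r)) y\<close> to \<open>b\<close>
      times \<open>(f ^^ r) y\<close>, so this summand restores the part of \<open>x\<close> removed
      in \<open>x'\<close>. The formula applies because \<open>m + r\<close> does not exceed the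
      weight \<open>m + 2 r\<close> of \<open>y\<close>.\<close>
    define w where "w = z + scale (inverse (c * b)) ((f ^^ (m + r)) y)"
    have "(f ^^ (m + r)) y \<in> L (- int m)"
      using pow_f_L[OF y(1), of "m + r"] by simp
    then have "w \<in> L (- int m)"
      unfolding w_def
      using z(1) by (intro subspace_add[OF subspace_L] subspace_scale[OF subspace_L])
    moreover have "x - (e ^^ m) w \<in> N"
    proof -
      let ?u = "(e ^^ m) ((f ^^ (m + r)) y) - scale b ((f ^^ r) y)"
      have "x' - (e ^^ m) z - scale (inverse (c * b)) ?u \<in> N"
        by (intro subspace_diff[OF subspace_N] subspace_scale[OF subspace_N] z b)
      also have "x' - (e ^^ m) z - scale (inverse (c * b)) ?u = x - (e ^^ m) w"
      proof -
        have "(e ^^ m) (x + y) = (e ^^ m) x + (e ^^ m) y" for x y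
          by (induction m) (simp_all add: e_add)
        then show ?thesis
          using b(1) c(1)
          by (simp add: x'_def w_def pow_e_scale scale_right_diff_distrib algebra_simps)
      qed
      finally show ?thesis .
    qed
    ultimately show ?case by blast
  qed
  with assms e_nilpotent show ?thesis by blast
qed

end

section \<open>Linear maps given on words, and two-sided ideals\<close>

section \<open>The free algebra\<close>

interpretation pvs: vector_space "pscale :: 'k::field \<Rightarrow> ('w \<Rightarrow>\<^sub>0 'k) \<Rightarrow> ('w \<Rightarrow>\<^sub>0 'k)"
  using module_pscale unfolding Modules.module_def vector_space_def by blast

abbreviation klinear :: "(('v \<Rightarrow>\<^sub>0 'k) \<Rightarrow> ('w \<Rightarrow>\<^sub>0 'k::field)) \<Rightarrow> bool" where
  "klinear \<equiv> Vector_Spaces.linear pscale pscale"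

lemma klinearI:
  assumes "\<And>x y. F (x + y) = F x + F y" "\<And>c x. F (pscale c x) = pscale c (F x)"
  shows "klinear F"
  using assms by unfold_locales auto

lemma klinear_add: "klinear F \<Longrightarrow> F (x + y) = F x + F y"
  and klinear_scale: "klinear F \<Longrightarrow> F (pscale c x) = pscale c (F x)"
  by (simp_all add: Vector_Spaces.linear_iff)

lemma klinear_diff: "klinear F \<Longrightarrow> F (x - y) = F x - F y"
  and klinear_0: "klinear F \<Longrightarrow> F 0 = 0"
  and klinear_sum: "klinear F \<Longrightarrow> F (\<Sum>j\<in>A. g j) = (\<Sum>j\<in>A. F (g j))"
proof -
  assume "klinear F"
  then interpret Vector_Spaces.linear pscale pscale F .
  show "F (x - y) = F x - F y" "F 0 = 0"
    "F (\<Sum>j\<in>A. g j) = (\<Sum>j\<in>A. F (g j))"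
    by (simp_all add: diff neg sum)
qed

lemma klinear_span_subset:
  assumes "klinear F" "x \<in> pvs.span S" "\<And>y. y \<in> S \<Longrightarrow> F y \<in> V" "pvs.subspace V"
  shows "F x \<in> V"
  using assms(2)
proof (induction rule: pvs.span_induct_alt)
  case base
  then show ?case
    using assms by (simp add: klinear_0 pvs.subspace_0)
next
  case (step c y z)
  then show ?case
    using assms by (simp add: klinear_add klinear_scale pvs.subspace_add pvs.subspace_scale)
qed

lemma pscale_single [simp]: "pscale c (Poly_Mapping.single w b) = Poly_Mapping.single w (c * b)"
  by (rule poly_mapping_eqI) (simp add: lookup_pscale lookup_single when_def)

lemma sum_singles: "f = (\<Sum>w\<in>Poly_Mapping.keys f. pscale (Poly_Mapping.lookup f w) (Poly_Mapping.single w 1))"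
  for f :: "'w \<Rightarrow>\<^sub>0 'k::field"
  by (rule poly_mapping_eqI)
    (simp add: lookup_sum lookup_single when_def in_keys_iff sum.delta' sum.delta)

lemma pscale_mult_left: "pscale c f * g = pscale c (f * g)"
  for f g :: "'w::monoid_add \<Rightarrow>\<^sub>0 'k::field"
  by (simp add: pscale_def mult_map_scale_conv_mult mult.assoc)

lemma mult_single_0_commute: "f * Poly_Mapping.single 0 c = Poly_Mapping.single 0 c * f"
  for f :: "'w::monoid_add \<Rightarrow>\<^sub>0 'k::field"
proof -
  let ?s = "Poly_Mapping.single 0 c :: 'w \<Rightarrow>\<^sub>0 'k"
  have *: "pscale b (Poly_Mapping.single w 1) * ?s = ?s * pscale b (Poly_Mapping.single w 1)"
    for b and w :: 'w
    by (simp add: mult_single mult.commute)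
  show ?thesis
    by (subst (1 2) sum_singles[of f]) (simp only: sum_distrib_left sum_distrib_right *)
qed

lemma pscale_mult_right: "f * pscale c g = pscale c (f * g)"
  for f g :: "'w::monoid_add \<Rightarrow>\<^sub>0 'k::field"
proof -
  have "f * pscale c g = (f * Poly_Mapping.single 0 c) * g"
    by (simp add: pscale_def mult_map_scale_conv_mult mult.assoc)
  then show ?thesis
    by (simp add: mult_single_0_commute pscale_def mult_map_scale_conv_mult mult.assoc)
qed

definition wd :: "'g list \<Rightarrow> ('g free_monoid \<Rightarrow>\<^sub>0 'k::field)" where
  "wd xs = Poly_Mapping.single (Word xs) 1"

lemma wd_append: "wd (xs @ ys) = wd xs * wd ys"
  by (simp add: wd_def mult_single plus_free_monoid_def)

lemma wd_Nil [simp]: "wd [] = 1"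
  by (simp add: wd_def single_one flip: zero_free_monoid_def)

lemma wd_Cons: "wd (j # xs) = gen j * wd xs"
  using wd_append[of "[j]" xs] by (simp add: wd_def gen_def)

lemma span_wd: "x \<in> pvs.span (wd ` {xs. Word xs \<in> Poly_Mapping.keys x})"
proof -
  have "pscale (Poly_Mapping.lookup x w) (Poly_Mapping.single w 1)
      \<in> pvs.span (wd ` {xs. Word xs \<in> Poly_Mapping.keys x})" if "w \<in> Poly_Mapping.keys x" for w
    using that by (cases w) (auto intro!: pvs.span_scale[OF pvs.span_base] simp: wd_def simp del: pscale_single)
  then show ?thesis
    by (subst sum_singles) (rule pvs.span_sum)
qed

lemma span_range_wd: "x \<in> pvs.span (range wd)"
  using span_wd pvs.span_mono[of "wd ` {xs. Word xs \<in> Poly_Mapping.keys x}" "range wd"] by blast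

lemma klinear_eqI:
  assumes "klinear F" "klinear G" "\<And>xs. F (wd xs) = G (wd xs)"
  shows "F x = G x"
proof -
  have "klinear (\<lambda>x. F x - G x)"
    using assms(1,2)
    by (intro klinearI) (simp_all add: klinear_add klinear_scale pvs.scale_right_diff_distrib)
  then have "F x - G x \<in> {0}"
    by (rule klinear_span_subset[OF _ span_range_wd])
      (use assms(3) in \<open>auto simp: pvs.subspace_single_0\<close>)
  then show ?thesis by simp
qed

definition lin_ext :: "('g list \<Rightarrow> ('w \<Rightarrow>\<^sub>0 'k)) \<Rightarrow> ('g free_monoid \<Rightarrow>\<^sub>0 'k::field) \<Rightarrow> ('w \<Rightarrow>\<^sub>0 'k)" where
  "lin_ext \<phi> f = (\<Sum>w\<in>Poly_Mapping.keys f. pscale (Poly_Mapping.lookup f w) (\<phi> (letters w)))"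

lemma lin_ext_superset:
  assumes "finite A" "Poly_Mapping.keys f \<subseteq> A"
  shows "lin_ext \<phi> f = (\<Sum>w\<in>A. pscale (Poly_Mapping.lookup f w) (\<phi> (letters w)))"
  unfolding lin_ext_def using assms
  by (intro sum.mono_neutral_left) (auto simp: in_keys_iff)

lemma klinear_lin_ext:
  fixes \<phi> :: "'g list \<Rightarrow> ('w \<Rightarrow>\<^sub>0 'k::field)"
  shows "klinear (lin_ext \<phi>)"
proof (rule klinearI)
  fix f g :: "'g free_monoid \<Rightarrow>\<^sub>0 'k"
  show "lin_ext \<phi> (f + g) = lin_ext \<phi> f + lin_ext \<phi> g"
    using keys_add[of f g]
    by (subst (1 2 3) lin_ext_superset[of "Poly_Mapping.keys f \<union> Poly_Mapping.keys g"])
      (auto simp: lookup_add pvs.scale_left_distrib sum.distrib)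
next
  fix c and f :: "'g free_monoid \<Rightarrow>\<^sub>0 'k"
  show "lin_ext \<phi> (pscale c f) = pscale c (lin_ext \<phi> f)"
    by (subst (1 2) lin_ext_superset[of "Poly_Mapping.keys f"])
      (auto simp: in_keys_iff lookup_pscale pvs.scale_sum_right)
qed

lemma lin_ext_wd [simp]: "lin_ext \<phi> (wd xs) = \<phi> xs"
  by (simp add: lin_ext_def wd_def)

lemma lin_ext_1 [simp]: "lin_ext \<phi> 1 = \<phi> []"
  using lin_ext_wd[of \<phi> "[]"] by simp

text \<open>The two-sided ideal generated by \<open>R\<close> in the free algebra on the whole type.
  As a span of products it lets linear maps be checked on \<open>wd u * r * wd v\<close>.\<close>

definition ideal_of :: "('g free_monoid \<Rightarrow>\<^sub>0 'k) set \<Rightarrow> ('g free_monoid \<Rightarrow>\<^sub>0 'k::field) set" where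
  "ideal_of R = pvs.span {wd u * r * wd v | u r v. r \<in> R}"

lemma subspace_ideal_of: "pvs.subspace (ideal_of R)"
  by (simp add: ideal_of_def pvs.subspace_span)

lemmas ideal_of_0 = pvs.subspace_0[OF subspace_ideal_of]
  and ideal_of_add = pvs.subspace_add[OF subspace_ideal_of]
  and ideal_of_diff = pvs.subspace_diff[OF subspace_ideal_of]
  and ideal_of_scale = pvs.subspace_scale[OF subspace_ideal_of]

lemma ideal_of_base: "r \<in> R \<Longrightarrow> r \<in> ideal_of R"
  unfolding ideal_of_def
  by (rule pvs.span_base) (auto intro!: exI[of _ "[]"])

lemma klinear_mult_left: "klinear (\<lambda>x. y * x)"
  and klinear_mult_right: "klinear (\<lambda>x. x * y)"
  for y :: "'w::monoid_add \<Rightarrow>\<^sub>0 'k::field"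
  by (auto intro!: klinearI simp: algebra_simps pscale_mult_left pscale_mult_right)

lemma ideal_of_mult_left:
  assumes "x \<in> ideal_of R"
  shows "y * x \<in> ideal_of R"
proof -
  have *: "wd ys * x \<in> ideal_of R" for ys
  proof (rule klinear_span_subset[OF klinear_mult_left assms[unfolded ideal_of_def]])
    fix z :: "'a free_monoid \<Rightarrow>\<^sub>0 'b" assume "z \<in> {wd u * r * wd v | u r v. r \<in> R}"
    then obtain u r v where z: "z = wd u * r * wd v" "r \<in> R"
      by blast
    have "wd ys * z = wd (ys @ u) * r * wd v"
      by (simp add: z wd_append mult.assoc)
    then show "wd ys * z \<in> ideal_of R"
      unfolding ideal_of_def using z(2) by (auto intro!: pvs.span_base)
  qed (rule subspace_ideal_of)
  show ?thesis
    by (rule klinear_span_subset[OF klinear_mult_right span_range_wd])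
      (auto simp: * subspace_ideal_of)
qed

lemma ideal_of_mult_right:
  assumes "x \<in> ideal_of R"
  shows "x * y \<in> ideal_of R"
proof -
  have *: "x * wd ys \<in> ideal_of R" for ys
  proof (rule klinear_span_subset[OF klinear_mult_right assms[unfolded ideal_of_def]])
    fix z :: "'a free_monoid \<Rightarrow>\<^sub>0 'b" assume "z \<in> {wd u * r * wd v | u r v. r \<in> R}"
    then obtain u r v where z: "z = wd u * r * wd v" "r \<in> R"
      by blast
    have "z * wd ys = wd u * r * wd (v @ ys)"
      by (simp add: z wd_append mult.assoc)
    then show "z * wd ys \<in> ideal_of R"
      unfolding ideal_of_def using z(2) by (auto intro!: pvs.span_base)
  qed (rule subspace_ideal_of)
  show ?thesis
    by (rule klinear_span_subset[OF klinear_mult_left span_range_wd])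
      (auto simp: * subspace_ideal_of)
qed

definition ad :: "'a::ring \<Rightarrow> 'a \<Rightarrow> 'a" where
  "ad x y = x * y - y * x"

lemma klinear_ad: "klinear (ad x)" for x :: "'w::monoid_add \<Rightarrow>\<^sub>0 'k::field"
  by (auto intro!: klinearI
      simp: ad_def algebra_simps pscale_mult_left pscale_mult_right pvs.scale_right_diff_distrib)

lemma ad_self [simp]: "ad x x = 0"
  by (simp add: ad_def)

lemma ideal_of_ad: "y \<in> ideal_of R \<Longrightarrow> ad x y \<in> ideal_of R"
  and ideal_of_ad_left: "x \<in> ideal_of R \<Longrightarrow> ad x y \<in> ideal_of R"
  by (simp_all add: ad_def ideal_of_diff ideal_of_mult_left ideal_of_mult_right)

section \<open>The free algebra as a lowest weight module\<close>

section \<open>Lowering operators on the free algebra\<close>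

text \<open>
  The free algebra is the lowest weight module of lowest weight zero over the Lie algebra with
  generators \<open>e\<^sub>i\<close>, \<open>f\<^sub>i\<close>, \<open>h\<^sub>i\<close> without Serre relations: \<open>e\<^sub>j\<close> acts by left multiplication, and
  \<open>Hop\<close> and \<open>Fop\<close> are the actions of \<open>h\<^sub>i\<close> and \<open>f\<^sub>i\<close>. The derivation \<open>dop\<close> measures the failure of
  \<open>Fop\<close> to be a derivation.
\<close>

definition hwt :: "('i \<Rightarrow> 'i \<Rightarrow> int) \<Rightarrow> 'i \<Rightarrow> 'i list \<Rightarrow> int" where
  "hwt a i xs = (\<Sum>j\<leftarrow>xs. a i j)"

lemma hwt_simps [simp]: "hwt a i [] = 0" "hwt a i (j # xs) = a i j + hwt a i xs"
  "hwt a i (xs @ ys) = hwt a i xs + hwt a i ys"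
  by (simp_all add: hwt_def)

definition Hop :: "('i \<Rightarrow> 'i \<Rightarrow> int) \<Rightarrow> 'i \<Rightarrow> ('i free_monoid \<Rightarrow>\<^sub>0 'k) \<Rightarrow> ('i free_monoid \<Rightarrow>\<^sub>0 'k::field)" where
  "Hop a i = lin_ext (\<lambda>xs. pscale (of_int (hwt a i xs)) (wd xs))"

primrec dword :: "'i \<Rightarrow> 'i list \<Rightarrow> ('i free_monoid \<Rightarrow>\<^sub>0 'k::field)" where
  "dword i [] = 0"
| "dword i (j # xs) = (if i = j then wd xs else 0) + gen j * dword i xs"

definition dop :: "'i \<Rightarrow> ('i free_monoid \<Rightarrow>\<^sub>0 'k) \<Rightarrow> ('i free_monoid \<Rightarrow>\<^sub>0 'k::field)" where
  "dop i = lin_ext (dword i)"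

primrec Fword :: "('i \<Rightarrow> 'i \<Rightarrow> int) \<Rightarrow> 'i \<Rightarrow> 'i list \<Rightarrow> ('i free_monoid \<Rightarrow>\<^sub>0 'k::field)" where
  "Fword a i [] = 0"
| "Fword a i (j # xs) =
    gen j * Fword a i xs - (if i = j then pscale (of_int (hwt a i xs)) (wd xs) else 0)"

definition Fop :: "('i \<Rightarrow> 'i \<Rightarrow> int) \<Rightarrow> 'i \<Rightarrow> ('i free_monoid \<Rightarrow>\<^sub>0 'k) \<Rightarrow> ('i free_monoid \<Rightarrow>\<^sub>0 'k::field)" where
  "Fop a i = lin_ext (Fword a i)"

lemma klinear_Hop: "klinear (Hop a i)" and klinear_dop: "klinear (dop i)"
  and klinear_Fop: "klinear (Fop a i)"
  by (simp_all add: Hop_def dop_def Fop_def klinear_lin_ext)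

lemma dop_1 [simp]: "dop i 1 = 0" and Fop_1 [simp]: "Fop a i 1 = 0"
  and Hop_1 [simp]: "Hop a i 1 = 0"
  by (simp_all add: Fop_def dop_def Hop_def)

lemmas Hop_linear = klinear_add[OF klinear_Hop] klinear_scale[OF klinear_Hop]
    klinear_diff[OF klinear_Hop] klinear_0[OF klinear_Hop]
  and dop_linear = klinear_add[OF klinear_dop] klinear_scale[OF klinear_dop]
    klinear_diff[OF klinear_dop] klinear_0[OF klinear_dop]
  and Fop_linear = klinear_add[OF klinear_Fop] klinear_scale[OF klinear_Fop]
    klinear_diff[OF klinear_Fop] klinear_0[OF klinear_Fop]

lemma gen_eq_wd: "gen j = wd [j]"
  by (simp add: wd_Cons)

lemma dop_gen_left: "dop i (gen j * x) = (if i = j then x else 0) + gen j * dop i x"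
proof (rule klinear_eqI[of "\<lambda>x. dop i (gen j * x)"
      "\<lambda>x. (if i = j then x else 0) + gen j * dop i x"])
  fix xs
  show "dop i (gen j * wd xs) = (if i = j then wd xs else 0) + gen j * dop i (wd xs)"
    by (simp add: dop_def flip: wd_Cons)
qed (auto intro!: klinearI simp: dop_linear algebra_simps pscale_mult_left pscale_mult_right
      pvs.scale_right_distrib)

lemma dop_gen [simp]: "dop i (gen j) = (if i = j then 1 else 0)"
  using dop_gen_left[of i j 1] by simp

lemma dop_gen_right: "dop i (x * gen j) = (if i = j then x else 0) + dop i x * gen j"
proof (rule klinear_eqI[of "\<lambda>x. dop i (x * gen j)"
      "\<lambda>x. (if i = j then x else 0) + dop i x * gen j"])
  fix xs
  show "dop i (wd xs * gen j) = (if i = j then wd xs else 0) + dop i (wd xs) * gen j"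
  proof (induction xs)
    case Nil
    show ?case
      using dop_gen by simp
  next
    case (Cons k xs)
    then show ?case
      by (simp only: wd_Cons mult.assoc dop_gen_left) (simp add: algebra_simps)
  qed
qed (auto intro!: klinearI simp: dop_linear algebra_simps pscale_mult_left pscale_mult_right
      pvs.scale_right_distrib)

lemma Hop_wd: "Hop a i (wd xs) = pscale (of_int (hwt a i xs)) (wd xs)"
  by (simp add: Hop_def)

lemma Hop_gen_left: "Hop a i (gen j * x) = pscale (of_int (a i j)) (gen j * x) + gen j * Hop a i x"
proof (rule klinear_eqI[of "\<lambda>x. Hop a i (gen j * x)"
      "\<lambda>x. pscale (of_int (a i j)) (gen j * x) + gen j * Hop a i x"])
  fix xs
  show "Hop a i (gen j * wd xs) =
      pscale (of_int (a i j)) (gen j * wd xs) + gen j * Hop a i (wd xs)"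
    by (simp add: Hop_wd pvs.scale_left_distrib pscale_mult_right flip: wd_Cons)
qed (auto intro!: klinearI simp: Hop_linear algebra_simps pscale_mult_left pscale_mult_right
      pvs.scale_right_distrib)

lemma Hop_gen_right: "Hop a i (x * gen j) = pscale (of_int (a i j)) (x * gen j) + Hop a i x * gen j"
proof (rule klinear_eqI[of "\<lambda>x. Hop a i (x * gen j)"
      "\<lambda>x. pscale (of_int (a i j)) (x * gen j) + Hop a i x * gen j"])
  fix xs
  show "Hop a i (wd xs * gen j) =
      pscale (of_int (a i j)) (wd xs * gen j) + Hop a i (wd xs) * gen j"
    by (simp add: Hop_wd pvs.scale_left_distrib pscale_mult_left gen_eq_wd add.commute
        flip: wd_append)
qed (auto intro!: klinearI simp: Hop_linear algebra_simps pscale_mult_left pscale_mult_right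
      pvs.scale_right_distrib)

lemma Fop_gen_left: "Fop a i (gen j * x) = gen j * Fop a i x - (if i = j then Hop a i x else 0)"
proof (rule klinear_eqI[of "\<lambda>x. Fop a i (gen j * x)"
      "\<lambda>x. gen j * Fop a i x - (if i = j then Hop a i x else 0)"])
  fix xs
  show "Fop a i (gen j * wd xs) = gen j * Fop a i (wd xs) - (if i = j then Hop a i (wd xs) else 0)"
    by (simp add: Hop_wd Fop_def flip: wd_Cons)
qed (auto intro!: klinearI simp: Fop_linear Hop_linear algebra_simps pscale_mult_left
      pscale_mult_right pvs.scale_right_diff_distrib)

lemma Fop_gen [simp]: "Fop a i (gen j) = 0"
  using Fop_gen_left[of a i j 1] by (simp split: if_splits)

text \<open>Passing \<open>Fop\<close> through \<open>x\<close> deletes a letter \<open>i\<close>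
  and leaves the weight of the word to its right as a coefficient. A further letter \<open>j\<close>
  on the right shifts that weight by \<open>a i j\<close>, and \<open>dop\<close> collects the
  places where this happens.\<close>

lemma Fop_gen_right:
  "Fop a i (x * gen j) = Fop a i x * gen j - pscale (of_int (a i j)) (dop i x * gen j)"
proof (rule klinear_eqI[of "\<lambda>x. Fop a i (x * gen j)"
      "\<lambda>x. Fop a i x * gen j - pscale (of_int (a i j)) (dop i x * gen j)"])
  fix xs
  show "Fop a i (wd xs * gen j) =
    Fop a i (wd xs) * gen j - pscale (of_int (a i j)) (dop i (wd xs) * gen j)"
  proof (induction xs)
    case Nil
    show ?case
      using Fop_gen by simp
  next
    case (Cons k xs)
    then show ?case
      by (simp only: wd_Cons mult.assoc Fop_gen_left dop_gen_left Hop_gen_right)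
        (auto simp: algebra_simps pscale_mult_left pscale_mult_right pvs.scale_right_distrib)
  qed
qed (auto intro!: klinearI simp: Fop_linear dop_linear algebra_simps pscale_mult_left
      pscale_mult_right pvs.scale_right_diff_distrib pvs.scale_left_commute)

text \<open>\<open>Fop\<close> of a product involves \<open>Hop\<close> and \<open>dop\<close> of a
  factor, so the property that propagates from the generators to the ideal is invariance under all
  three operators together.\<close>

lemma ideal_of_stable:
  assumes R: "\<And>r. r \<in> R \<Longrightarrow> Hop a i r \<in> ideal_of R \<and> dop i r \<in> ideal_of R \<and> Fop a i r \<in> ideal_of R"
    and x: "x \<in> ideal_of R"
  shows "Fop a i x \<in> ideal_of R"
proof -
  define P where "P x \<longleftrightarrow> x \<in> ideal_of R \<and>
    Hop a i x \<in> ideal_of R \<and> dop i x \<in> ideal_of R \<and> Fop a i x \<in> ideal_of R" for x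
  have left: "P (gen j * x)" and right: "P (x * gen j)" if "P x" for x j
    using that unfolding P_def
    by (auto simp add: Hop_gen_left Hop_gen_right dop_gen_left dop_gen_right Fop_gen_left
        Fop_gen_right ideal_of_add ideal_of_diff ideal_of_scale ideal_of_mult_left
        ideal_of_mult_right ideal_of_0)
  have "P (wd u * r * wd v)" if "r \<in> R" for u r v
  proof -
    have "P (r * wd v)"
    proof (induction v rule: rev_induct)
      case Nil
      then show ?case
        using R[OF that] ideal_of_base[OF that] by (simp add: P_def)
    next
      case (snoc j v)
      then show ?case
        using right[of "r * wd v" j] by (simp add: wd_append gen_eq_wd mult.assoc)
    qed
    then show ?thesis
      by (induction u) (simp_all add: wd_Cons mult.assoc left)
  qed
  then show ?thesis
    by (intro klinear_span_subset[OF klinear_Fop x[unfolded ideal_of_def] _ subspace_ideal_of])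
      (auto simp: P_def)
qed

lemma Hop_ad: "Hop a i (ad (gen j) x) = pscale (of_int (a i j)) (ad (gen j) x) + ad (gen j) (Hop a i x)"
  by (simp add: ad_def Hop_linear Hop_gen_left Hop_gen_right pvs.scale_right_diff_distrib)

lemma dop_ad: "dop i (ad (gen j) x) = ad (gen j) (dop i x)"
  by (simp add: ad_def dop_linear dop_gen_left dop_gen_right)

text \<open>On elements killed by \<open>dop\<close> the operator \<open>Fop\<close> acts like a
  bracket with f_i: the identity reads [f_i, [e_j, x]] = [e_j, [f_i, x]] - [h_i, x] for i = j, and
  the last term is absent otherwise.\<close>

lemma Fop_ad:
  "dop i x = 0 \<Longrightarrow>
    Fop a i (ad (gen j) x) = ad (gen j) (Fop a i x) - (if i = j then Hop a i x else 0)"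
  by (simp add: ad_def Fop_linear Fop_gen_left Fop_gen_right)

section \<open>Right-normed commutators and stability of the Serre ideal\<close>

section \<open>The Serre algebra\<close>

lemma klinear_compose: "klinear F \<Longrightarrow> klinear G \<Longrightarrow> klinear (\<lambda>x. F (G x))"
  by (rule klinearI) (simp_all add: klinear_add[of G] klinear_scale[of G] klinear_add[of F] klinear_scale[of F])

lemma klinear_sub:
  assumes "klinear F" "klinear G"
  shows "klinear (\<lambda>x. F x - G x)"
  by (rule klinearI)
    (simp_all add: klinear_add[OF assms(1)] klinear_add[OF assms(2)] klinear_scale[OF assms(1)]
      klinear_scale[OF assms(2)] pvs.scale_right_diff_distrib)

lemma klinear_pscale: "klinear (pscale c)"
  by (rule klinearI) (simp_all add: pvs.scale_right_distrib mult.commute)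

text \<open>Right-normed commutators; by the Jacobi identity they span the Lie algebra generated by
  the \<open>gen i\<close>. The value 0 at the empty word is a default.\<close>

fun rnc :: "'i list \<Rightarrow> ('i free_monoid \<Rightarrow>\<^sub>0 'k::field)" where
  "rnc [] = 0"
| "rnc [i] = gen i"
| "rnc (i # j # w) = ad (gen i) (rnc (j # w))"

lemma rnc_Cons: "w \<noteq> [] \<Longrightarrow> rnc (i # w) = ad (gen i) (rnc w)"
  by (cases w) simp_all

lemma rnc_replicate_append: "rnc (replicate n i @ [j]) = (ad (gen i) ^^ n) (gen j)"
  by (induction n) (simp_all add: rnc_Cons)

text \<open>\<open>dop\<close> commutes with \<open>ad (gen j)\<close>, because it maps generators
  to scalars, and \<open>ad (gen j) 1 = 0\<close>.\<close>

lemma dop_rnc: "dop i (rnc w) = (if w = [i] then 1 else 0)"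
proof (induction w rule: rnc.induct)
  case (3 i j w)
  then show ?case
    by (auto simp: dop_ad) (simp_all add: ad_def)
qed (simp_all add: dop_linear)

lemma Hop_gen [simp]: "Hop a i (gen j) = pscale (of_int (a i j)) (gen j)"
  using Hop_wd[of a i "[j]"] by (simp add: gen_eq_wd)

lemma Hop_rnc: "Hop a i (rnc w) = pscale (of_int (hwt a i w)) (rnc w)"
proof (induction w rule: rnc.induct)
  case (3 i j w)
  then show ?case
    by (simp add: Hop_ad pvs.scale_left_distrib klinear_add[OF klinear_ad]
        klinear_scale[OF klinear_ad])
qed (simp_all add: Hop_linear)

definition serre_rel :: "'i set \<Rightarrow> ('i \<Rightarrow> 'i \<Rightarrow> int) \<Rightarrow> ('i free_monoid \<Rightarrow>\<^sub>0 'k::field) set" where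
  "serre_rel I a = {(ad (gen i) ^^ nat (1 - a i j)) (gen j) | i j. i \<in> I \<and> j \<in> I \<and> i \<noteq> j}"

text \<open>The coefficient vanishes for \<open>n = - a j k\<close>; this is where the exponent
  \<open>1 - a j k\<close> of the Serre relation comes from.\<close>

lemma Fop_serre_same:
  fixes a :: "'i \<Rightarrow> 'i \<Rightarrow> int"
  assumes "j \<noteq> k" "a j j = 2"
  shows "Fop a j (rnc (replicate (Suc n) j @ [k]) :: 'i free_monoid \<Rightarrow>\<^sub>0 'k::field) =
    pscale (- of_int (int (Suc n) * (a j k + int n))) (rnc (replicate n j @ [k]))"
proof (induction n)
  case 0
  then show ?case
    using assms by (simp add: ad_def Fop_linear Fop_gen_left)
next
  case (Suc n)
  let ?x = "rnc (replicate (Suc n) j @ [k]) :: 'i free_monoid \<Rightarrow>\<^sub>0 'k"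
  have hwt: "hwt a j (replicate m j @ [k]) = a j k + 2 * int m" for m
    by (induction m) (simp_all add: assms)
  have "rnc (replicate (Suc (Suc n)) j @ [k]) = ad (gen j) ?x"
    by simp
  then have "Fop a j (rnc (replicate (Suc (Suc n)) j @ [k])) =
      ad (gen j) (Fop a j ?x) - Hop a j ?x"
    using assms(1) by (simp add: Fop_ad dop_rnc)
  also have "ad (gen j) (Fop a j ?x) = pscale (- of_int (int (Suc n) * (a j k + int n))) ?x"
    by (simp only: Suc.IH klinear_scale[OF klinear_ad]) (simp add: rnc_Cons)
  also have "Hop a j ?x = pscale (of_int (a j k + 2 * int (Suc n))) ?x"
    by (simp only: Hop_rnc hwt)
  also have "pscale (- of_int (int (Suc n) * (a j k + int n))) ?x -
      pscale (of_int (a j k + 2 * int (Suc n))) ?x =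
    pscale (- of_int (int (Suc n) * (a j k + int n) + (a j k + 2 * int (Suc n)))) ?x"
    by (simp only: pvs.scale_left_diff_distrib[symmetric]) (simp only: of_int_add minus_diff_commute
        minus_add_distrib diff_conv_add_uminus)
  also have "int (Suc n) * (a j k + int n) + (a j k + 2 * int (Suc n)) =
      int (Suc (Suc n)) * (a j k + int (Suc n))"
    by (simp add: algebra_simps)
  finally show ?case .
qed

text \<open>For \<open>i = k\<close> and \<open>n = 0\<close> a multiple of \<open>gen j\<close>
  survives. In a Serre relation this occurs only if \<open>a j k = 0\<close>, and then
  \<open>a k j = 0\<close> as well.\<close>

lemma Fop_serre_other:
  assumes "j \<noteq> k" "i \<noteq> j"
  shows "Fop a i (rnc (replicate (Suc n) j @ [k])) =
    (if i = k \<and> n = 0 then pscale (of_int (a i j)) (gen j) else 0)"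
proof (induction n)
  case 0
  then show ?case
    using assms
    by (auto simp add: ad_def Fop_linear Fop_gen_left pscale_mult_left pscale_mult_right)
next
  case (Suc n)
  then show ?case
    using assms by (simp add: Fop_ad dop_rnc klinear_scale[OF klinear_ad] klinear_0[OF klinear_ad])
qed

text \<open>\<open>field_type\<close> fixes the coefficient field, which neither \<open>I\<close>
  nor \<open>a\<close> mentions: the complex numbers for the enveloping algebra, the rational
  numbers for the classical limit of the quantum one.\<close>

locale serre =
  fixes I :: "'i set" and a :: "'i \<Rightarrow> 'i \<Rightarrow> int" and field_type :: "'k::field_char_0 itself"
  assumes gcm: "gcm I a"
begin

abbreviation N :: "('i free_monoid \<Rightarrow>\<^sub>0 'k) set" where
  "N \<equiv> ideal_of (serre_rel I a)"

lemma a_diag: "i \<in> I \<Longrightarrow> a i i = 2"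
  and a_nonpos: "i \<in> I \<Longrightarrow> j \<in> I \<Longrightarrow> i \<noteq> j \<Longrightarrow> a i j \<le> 0"
  and a_zero: "i \<in> I \<Longrightarrow> j \<in> I \<Longrightarrow> a i j = 0 \<Longrightarrow> a j i = 0"
  and finite_I: "finite I"
  using gcm by (auto simp: gcm_def)

text \<open>Serre elements are annihilated by \<open>Fop\<close> and \<open>dop\<close> and are
  eigenvectors of \<open>Hop\<close>, so \<open>ideal_of_stable\<close> applies.\<close>

lemma Fop_N:
  assumes i: "i \<in> I" and x: "x \<in> N"
  shows "Fop a i x \<in> N"
proof (rule ideal_of_stable[OF _ x])
  fix r :: "'i free_monoid \<Rightarrow>\<^sub>0 'k" assume r: "r \<in> serre_rel I a"
  then obtain j k where jk: "j \<in> I" "k \<in> I" "j \<noteq> k"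
    and "r = (ad (gen j) ^^ nat (1 - a j k)) (gen k)"
    unfolding serre_rel_def by blast
  moreover define n where "n = nat (- a j k)"
  moreover have "nat (1 - a j k) = Suc n" "int n = - a j k"
    using a_nonpos[OF jk] by (simp_all add: n_def)
  ultimately have r_eq: "r = rnc (replicate (Suc n) j @ [k])" and n: "int n = - a j k"
    by (simp_all only: rnc_replicate_append)
  have "Fop a i r = 0"
  proof (cases "i = j")
    case True
    then show ?thesis
      unfolding r_eq True Fop_serre_same[of j k a, OF jk(3) a_diag[OF jk(1)]] using n by simp
  next
    case False
    then show ?thesis
      unfolding r_eq Fop_serre_other[OF jk(3) False] using n a_zero[OF jk(1,2)] by auto
  qed
  moreover have "Hop a i r \<in> N"
    by (simp only: r_eq Hop_rnc) (use r r_eq in \<open>auto intro: ideal_of_scale ideal_of_base\<close>)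
  moreover have "dop i r = 0"
    using jk(3) by (simp add: r_eq dop_rnc)
  ultimately show "Hop a i r \<in> N \<and> dop i r \<in> N \<and> Fop a i r \<in> N"
    by (simp add: ideal_of_0)
qed

lemma Fop_rnc: "Fop a i (rnc w) \<in> pvs.span {rnc w' | w'. mset w = add_mset i (mset w')}"
  (is "_ \<in> pvs.span (?S w)")
proof (induction w rule: rnc.induct)
  case 1
  then show ?case by (simp add: Fop_linear pvs.span_zero)
next
  case (2 j)
  then show ?case by (simp add: pvs.span_zero)
next
  case (3 j k w)
  show ?case
  proof (cases "k # w = [i]")
    case True
    have "rnc [j] \<in> ?S [j, i]"
      by (rule CollectI, rule exI[of _ "[j]"]) simp
    then have 1: "pscale c (gen j) \<in> pvs.span (?S [j, i])" for c
      by (auto intro: pvs.span_scale pvs.span_base)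
    have *: "Fop a i (rnc [j, i]) = (if i = j then 0 else pscale (of_int (a i j)) (gen j))"
      by (simp add: ad_def Fop_linear Fop_gen_left Fop_gen_right pscale_mult_left)
    show ?thesis
      unfolding True * using 1 by (auto simp: pvs.span_zero)
  next
    case False
    let ?x = "rnc (k # w)"
    have "ad (gen j) (Fop a i ?x) \<in> pvs.span (?S (j # k # w))"
    proof (rule klinear_span_subset[OF klinear_ad 3])
      fix y assume "y \<in> ?S (k # w)"
      then obtain w' where w': "y = rnc w'" "mset (k # w) = add_mset i (mset w')"
        by blast
      have "w' \<noteq> []"
        using w'(2) False by auto
      then have "ad (gen j) y = rnc (j # w')"
        by (simp add: w'(1) rnc_Cons)
      moreover have "mset (j # k # w) = add_mset i (mset (j # w'))"
        using w'(2) by simp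
      ultimately show "ad (gen j) y \<in> pvs.span (?S (j # k # w))"
        by (intro pvs.span_base) blast
    qed (simp add: pvs.subspace_span)
    moreover have "?x \<in> ?S (j # k # w)" if "i = j"
      using that by (intro CollectI exI[of _ "k # w"]) simp
    then have "pscale c ?x \<in> pvs.span (?S (j # k # w))" if "i = j" for c
      using that by (intro pvs.span_scale pvs.span_base) blast
    moreover have *: "Fop a i (rnc (j # k # w)) =
        ad (gen j) (Fop a i ?x) - (if i = j then Hop a i ?x else 0)"
      using False by (simp add: Fop_ad dop_rnc)
    ultimately show ?thesis
      unfolding * Hop_rnc by (cases "i = j") (simp_all add: pvs.span_diff del: rnc.simps mset.simps)
  qed
qed

lemma ad_pow_N: "x \<in> N \<Longrightarrow> (ad (gen i) ^^ n) x \<in> N"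
  by (induction n) (simp_all add: ideal_of_ad)

lemma ad_pow_N_le: "(ad (gen i) ^^ n) x \<in> N \<Longrightarrow> n \<le> m \<Longrightarrow> (ad (gen i) ^^ m) x \<in> N"
proof -
  assume x: "(ad (gen i) ^^ n) x \<in> N" and le: "n \<le> m"
  have *: "ad (gen i) ^^ m = (ad (gen i) ^^ (m - n)) \<circ> (ad (gen i) ^^ n)"
    using le by (simp flip: funpow_add)
  show ?thesis
    unfolding * comp_apply by (rule ad_pow_N[OF x])
qed

lemma klinear_ad_pow: "klinear (ad x ^^ n)" for x :: "'w::monoid_add \<Rightarrow>\<^sub>0 'k"
  by (induction n)
    (auto intro!: klinearI simp: klinear_add klinear_scale klinear_ad)

text \<open>Leibniz rule and pigeonhole principle, run as an induction on \<open>p + q\<close>: one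
  application of the derivation falls on one of the two factors and lowers its exponent.\<close>

lemma ad_pow_bracket:
  "(ad (gen i) ^^ p) x \<in> N \<Longrightarrow> (ad (gen i) ^^ q) y \<in> N \<Longrightarrow> (ad (gen i) ^^ (p + q)) (ad x y) \<in> N"
proof (induction "p + q" arbitrary: p q x y)
  case 0
  then show ?case by (simp add: ideal_of_ad)
next
  case (Suc n)
  show ?case
  proof (cases "p = 0 \<or> q = 0")
    case True
    then have "ad x y \<in> N"
      using Suc.prems by (auto intro: ideal_of_ad ideal_of_ad_left)
    then show ?thesis by (rule ad_pow_N)
  next
    case False
    then obtain p' q' where pq: "p = Suc p'" "q = Suc q'"
      by (meson not0_implies_Suc)
    have "(ad (gen i) ^^ (p' + q)) (ad (ad (gen i) x) y) \<in> N"
      using Suc.prems pq Suc.hyps by (intro Suc.hyps) (simp_all add: funpow_swap1)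
    moreover have "(ad (gen i) ^^ (p + q')) (ad x (ad (gen i) y)) \<in> N"
      using Suc.prems pq Suc.hyps by (intro Suc.hyps) (simp_all add: funpow_swap1)
    ultimately have "(ad (gen i) ^^ (p' + q)) (ad (ad (gen i) x) y + ad x (ad (gen i) y)) \<in> N"
      unfolding klinear_add[OF klinear_ad_pow] using pq by (intro ideal_of_add) auto
    moreover have "ad (ad (gen i) x) y + ad x (ad (gen i) y) = ad (gen i) (ad x y)"
      by (simp add: ad_def algebra_simps)
    ultimately show ?thesis
      using pq by (simp add: funpow_swap1)
  qed
qed

text \<open>The Serre relations and \<open>ad (gen i) (gen i) = 0\<close> give nilpotency on the
  generators; brackets inherit it by \<open>ad_pow_bracket\<close>.\<close>

lemma ad_nilpotent_rnc:
  assumes "i \<in> I" "set w \<subseteq> I"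
  shows "\<exists>r. (ad (gen i) ^^ r) (rnc w) \<in> N"
  using assms(2)
proof (induction w rule: rnc.induct)
  case 1
  then show ?case by (intro exI[of _ 0]) (simp add: ideal_of_0)
next
  case (2 j)
  show ?case
  proof (cases "i = j")
    case True
    then show ?thesis by (intro exI[of _ 1]) (simp add: ideal_of_0)
  next
    case False
    then show ?thesis
      using 2 assms(1)
      by (intro exI[of _ "nat (1 - a i j)"]) (auto intro!: ideal_of_base simp: serre_rel_def)
  qed
next
  case (3 j k w)
  have "\<exists>r. (ad (gen i) ^^ r) (gen j) \<in> N"
  proof (cases "i = j")
    case True
    then show ?thesis by (intro exI[of _ 1]) (simp add: ideal_of_0)
  next
    case False
    then show ?thesis
      using 3(2) assms(1)
      by (intro exI[of _ "nat (1 - a i j)"]) (auto intro!: ideal_of_base simp: serre_rel_def)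
  qed
  then show ?case
    using ad_pow_bracket 3 by fastforce
qed

section \<open>Root spaces and simple reflections\<close>

definition Lsp :: "'i multiset \<Rightarrow> ('i free_monoid \<Rightarrow>\<^sub>0 'k) set" where
  "Lsp \<beta> = pvs.span {rnc w | w. set w \<subseteq> I \<and> mset w = \<beta>}"

text \<open>The pairing of the simple coroot of \<open>i\<close> with the weight \<beta>.\<close>

definition hmul :: "'i \<Rightarrow> 'i multiset \<Rightarrow> int" where
  "hmul i \<beta> = (\<Sum>j\<in>#\<beta>. a i j)"

lemma hmul_mset: "hmul i (mset w) = hwt a i w"
  by (induction w) (simp_all add: hmul_def)

text \<open>The weight string through \<open>\<beta>\<close> in the direction of \<open>\<alpha>\<^sub>i\<close>, indexed by the weight.\<close>

definition string_space :: "'i \<Rightarrow> 'i multiset \<Rightarrow> int \<Rightarrow> ('i free_monoid \<Rightarrow>\<^sub>0 'k) set" where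
  "string_space i M k = pvs.span {rnc w | w. set w \<subseteq> I \<and>
     filter_mset ((\<noteq>) i) (mset w) = M \<and> hwt a i w = k}"

text \<open>The condition on \<open>M\<close> excludes multiples of the simple root of
  \<open>i\<close>: the bracket of f_i with e_i is a multiple of the coroot, outside the positive
  part, whereas \<open>Fop a i (gen i) = 0\<close>.\<close>

lemma string_space_sl2:
  assumes i: "i \<in> I" and M: "M \<noteq> {#}"
  shows "sl2_mod pscale (ad (gen i)) (Fop a i) N (string_space i M)"
proof -
  have e_f: "ad (gen i) (Fop a i x) - Fop a i (ad (gen i) x) - pscale (of_int k) x = 0"
    if "x \<in> string_space i M k" for x k
  proof -
    have *: "ad (gen i) (Fop a i (rnc w)) - Fop a i (ad (gen i) (rnc w)) - pscale (of_int k) (rnc w) = 0"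
      if "filter_mset ((\<noteq>) i) (mset w) = M" "hwt a i w = k" for w
    proof -
      have "w \<noteq> [i]"
        using that M by auto
      then show ?thesis
        using that(2) by (simp add: Fop_ad dop_rnc Hop_rnc)
    qed
    have "klinear (\<lambda>x. ad (gen i) (Fop a i x) - Fop a i (ad (gen i) x) - pscale (of_int k) x)"
      by (intro klinear_sub klinear_compose[OF klinear_ad klinear_Fop]
          klinear_compose[OF klinear_Fop klinear_ad] klinear_pscale)
    from this that[unfolded string_space_def]
    have "ad (gen i) (Fop a i x) - Fop a i (ad (gen i) x) - pscale (of_int k) x \<in> {0}"
      by (rule klinear_span_subset) (use * pvs.subspace_single_0 in blast)+
    then show ?thesis by simp
  qed
  have e: "ad (gen i) x \<in> string_space i M (k + 2)" if "x \<in> string_space i M k" for x k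
    using that unfolding string_space_def[of _ _ k]
  proof (rule klinear_span_subset[OF klinear_ad])
    fix y :: "'i free_monoid \<Rightarrow>\<^sub>0 'k"
    assume "y \<in> {rnc w | w. set w \<subseteq> I \<and> filter_mset ((\<noteq>) i) (mset w) = M \<and> hwt a i w = k}"
    then obtain w where w: "y = rnc w" "set w \<subseteq> I" "filter_mset ((\<noteq>) i) (mset w) = M" "hwt a i w = k"
      by blast
    then have "w \<noteq> []"
      using M by auto
    then have "ad (gen i) y = rnc (i # w)"
      by (simp add: rnc_Cons w(1))
    moreover have "set (i # w) \<subseteq> I \<and> filter_mset ((\<noteq>) i) (mset (i # w)) = M \<and> hwt a i (i # w) = k + 2"
      using w i a_diag by simp
    ultimately show "ad (gen i) y \<in> string_space i M (k + 2)"
      unfolding string_space_def by (intro pvs.span_base) blast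
  qed (simp add: string_space_def pvs.subspace_span)
  have f: "Fop a i x \<in> string_space i M (k - 2)" if "x \<in> string_space i M k" for x k
    using that unfolding string_space_def[of _ _ k]
  proof (rule klinear_span_subset[OF klinear_Fop])
    fix y :: "'i free_monoid \<Rightarrow>\<^sub>0 'k"
    assume "y \<in> {rnc w | w. set w \<subseteq> I \<and> filter_mset ((\<noteq>) i) (mset w) = M \<and> hwt a i w = k}"
    then obtain w where w: "y = rnc w" "set w \<subseteq> I" "filter_mset ((\<noteq>) i) (mset w) = M" "hwt a i w = k"
      by blast
    have "{rnc w' | w'. mset w = add_mset i (mset w')} \<subseteq>
      {rnc w | w. set w \<subseteq> I \<and> filter_mset ((\<noteq>) i) (mset w) = M \<and> hwt a i w = k - 2}"
    proof safe
      fix w' assume w': "mset w = add_mset i (mset w')"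
      have "hwt a i w = hwt a i w' + 2"
        unfolding hmul_mset[symmetric] w' using a_diag i by (simp add: hmul_def)
      moreover have "set w' \<subseteq> set w"
        using w' by (metis set_mset_add_mset_insert set_mset_mset subset_insertI)
      moreover have "filter_mset ((\<noteq>) i) (mset w') = filter_mset ((\<noteq>) i) (mset w)"
        by (simp add: w')
      ultimately have "set w' \<subseteq> I \<and> filter_mset ((\<noteq>) i) (mset w') = M \<and> hwt a i w' = k - 2"
        using w by auto
      then show "\<exists>v. rnc w' = rnc v \<and> set v \<subseteq> I \<and> filter_mset ((\<noteq>) i) (mset v) = M \<and> hwt a i v = k - 2"
        by blast
    qed
    then show "Fop a i y \<in> string_space i M (k - 2)"
      unfolding w(1) string_space_def using Fop_rnc pvs.span_mono by blast
  qed (simp add: string_space_def pvs.subspace_span)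
  have nilp: "\<exists>r. (ad (gen i) ^^ r) x \<in> N" if "x \<in> string_space i M k" for x k
    using that unfolding string_space_def
  proof (induction rule: pvs.span_induct_alt)
    case base
    then show ?case by (intro exI[of _ 0]) (simp add: ideal_of_0)
  next
    case (step c x y)
    obtain r s where "(ad (gen i) ^^ r) x \<in> N" "(ad (gen i) ^^ s) y \<in> N"
      using step ad_nilpotent_rnc[OF i] by blast
    then have "(ad (gen i) ^^ max r s) x \<in> N" "(ad (gen i) ^^ max r s) y \<in> N"
      by (auto intro: ad_pow_N_le)
    then have "(ad (gen i) ^^ max r s) (pscale c x + y) \<in> N"
      by (simp add: klinear_add[OF klinear_ad_pow] klinear_scale[OF klinear_ad_pow]
          ideal_of_add ideal_of_scale)
    then show ?case by blast
  qed
  have sub: "pvs.subspace (string_space i M k)" for k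
    by (simp add: string_space_def pvs.subspace_span)
  show ?thesis
    by unfold_locales
      (auto simp: e_f e f nilp sub ideal_of_0 klinear_ad klinear_Fop Fop_N[OF i] ideal_of_ad
        subspace_ideal_of klinear_add[OF klinear_ad]
        klinear_scale[OF klinear_ad] klinear_add[OF klinear_Fop] klinear_scale[OF klinear_Fop])
qed

text \<open>Weight \<open>- m\<close> in the string belongs to the reflected weight. If \<beta>
  contains fewer than \<open>m\<close> letters \<open>i\<close>, the reflected weight is not a sum
  of simple roots; its space is zero and the conclusion says that \<open>x\<close> lies in
  \<open>N\<close>.\<close>

lemma reflection:
  assumes i: "i \<in> I" and \<beta>: "filter_mset ((\<noteq>) i) \<beta> \<noteq> {#}" and m: "hmul i \<beta> = int m" "m > 0"
    and x: "x \<in> Lsp \<beta>"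
  shows "\<exists>y\<in>(if m \<le> count \<beta> i then Lsp (\<beta> - replicate_mset m i) else {0}).
    x - (ad (gen i) ^^ m) y \<in> N"
proof -
  let ?M = "filter_mset ((\<noteq>) i) \<beta>"
  interpret sl2_mod pscale "ad (gen i)" "Fop a i" N "string_space i ?M"
    using i \<beta> by (rule string_space_sl2)
  have "Lsp \<beta> \<subseteq> string_space i ?M (int m)"
    unfolding Lsp_def string_space_def using m(1) by (intro pvs.span_mono) (auto simp flip: hmul_mset)
  then obtain y where y: "y \<in> string_space i ?M (- int m)" "x - (ad (gen i) ^^ m) y \<in> N"
    using weight_reflection_surj x by blast
  have split: "hmul i \<gamma> = 2 * int (count \<gamma> i) + hmul i (filter_mset ((\<noteq>) i) \<gamma>)" for \<gamma>
    by (induction \<gamma>) (auto simp: hmul_def a_diag[OF i])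
  \<comment> \<open>Each letter \<open>i\<close> contributes 2 to the weight, so passing from weight
    \<open>m\<close> to \<open>- m\<close> within the string removes exactly \<open>m\<close> of
    them.\<close>
  have key: "m \<le> count \<beta> i \<and> mset w = \<beta> - replicate_mset m i"
    if w: "filter_mset ((\<noteq>) i) (mset w) = ?M" "hwt a i w = - int m" for w
  proof -
    have cnt: "count \<beta> i = count (mset w) i + m"
      using split[of \<beta>] split[of "mset w"] w m(1) by (simp add: hmul_mset)
    moreover have "count (mset w) j = count (\<beta> - replicate_mset m i) j" for j
    proof (cases "j = i")
      case False
      then show ?thesis
        using arg_cong[OF w(1), of "\<lambda>M. count M j"] by (auto simp: count_filter_mset)
    qed (simp add: cnt)
    ultimately show ?thesis
      by (auto intro: multiset_eqI)
  qed
  have "string_space i ?M (- int m) \<subseteq> (if m \<le> count \<beta> i then Lsp (\<beta> - replicate_mset m i) else {0})"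
  proof (cases "m \<le> count \<beta> i")
    case True
    then show ?thesis
      unfolding Lsp_def string_space_def using key by (auto intro!: pvs.span_mono)
  next
    case False
    then have empty: "{rnc w | w. set w \<subseteq> I \<and> filter_mset ((\<noteq>) i) (mset w) = ?M \<and> hwt a i w = - int m} = {}"
      using key by blast
    show ?thesis
      unfolding string_space_def empty using False by simp
  qed
  then show ?thesis
    using y by blast
qed

end

section \<open>Schur complements and completion of squares\<close>

section \<open>Positivity of the symmetrized Cartan form\<close>

text \<open>\<open>principal_minor\<close> for rational matrices, because elimination leaves the
  integers.\<close>

definition minor_on :: "('i \<Rightarrow> 'i \<Rightarrow> rat) \<Rightarrow> 'i set \<Rightarrow> rat" where
  "minor_on M S = (\<Sum>p | p permutes S. of_int (sign p) * (\<Prod>i\<in>S. M i (p i)))"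

lemma of_int_principal_minor: "of_int (principal_minor a S) = minor_on (\<lambda>i j. of_int (a i j)) S"
  by (simp add: principal_minor_def minor_on_def)

lemma minor_on_row_linear:
  assumes "finite S" "k \<in> S"
  shows "minor_on (M(k := \<lambda>j. r j + c * s j)) S = minor_on (M(k := r)) S + c * minor_on (M(k := s)) S"
proof -
  have *: "(\<Prod>i\<in>S. (M(k := t)) i (p i)) = t (p k) * (\<Prod>i\<in>S - {k}. M i (p i))" for t p
    by (subst prod.remove[OF assms]) (auto intro!: prod.cong)
  show ?thesis
    unfolding minor_on_def * sum_distrib_left sum.distrib[symmetric]
    by (intro sum.cong) (simp_all add: algebra_simps)
qed

lemma minor_on_equal_rows:
  assumes "finite S" "k \<in> S" "l \<in> S" "k \<noteq> l" "M k = M l"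
  shows "minor_on M S = 0"
proof -
  let ?\<tau> = "transpose k l"
  have \<tau>: "?\<tau> permutes S"
    using assms by (simp add: permutes_swap_id)
  have rows: "M (?\<tau> i) = M i" for i
    by (auto simp: transpose_def assms(5))
  have bij: "bij_betw (\<lambda>p. p \<circ> ?\<tau>) {p. p permutes S} {p. p permutes S}"
    by (rule bij_betwI[where g = "\<lambda>p. p \<circ> ?\<tau>"])
      (auto simp: permutes_compose[OF \<tau>] o_assoc[symmetric])
  have "minor_on M S = (\<Sum>p | p permutes S. of_int (sign (p \<circ> ?\<tau>)) * (\<Prod>i\<in>S. M i ((p \<circ> ?\<tau>) i)))"
    unfolding minor_on_def by (rule sum.reindex_bij_betw[OF bij, symmetric])
  also have "\<dots> = (\<Sum>p | p permutes S. - (of_int (sign p) * (\<Prod>i\<in>S. M i (p i))))"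
  proof (intro sum.cong refl)
    fix p assume "p \<in> {p. p permutes S}"
    then have "sign (p \<circ> ?\<tau>) = sign p * sign ?\<tau>"
      using \<tau> assms(1) by (intro sign_compose) (auto simp: permutation_permutes)
    then have "sign (p \<circ> ?\<tau>) = - sign p"
      using assms(4) by (simp add: sign_swap_id)
    moreover have "(\<Prod>i\<in>S. M i ((p \<circ> ?\<tau>) i)) = (\<Prod>i\<in>S. M i (p i))"
      using prod.permute[OF \<tau>, of "\<lambda>i. M i (p i)"] by (simp add: o_def rows)
    ultimately show "of_int (sign (p \<circ> ?\<tau>)) * (\<Prod>i\<in>S. M i ((p \<circ> ?\<tau>) i)) =
        - (of_int (sign p) * (\<Prod>i\<in>S. M i (p i)))"
      by simp
  qed
  also have "\<dots> = - minor_on M S"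
    by (simp add: minor_on_def sum_negf)
  finally show ?thesis by simp
qed

text \<open>Gaussian elimination with pivot \<open>M k k\<close>: the rows in \<open>S\<close>
  become those of the Schur complement and vanish in column \<open>k\<close>.\<close>

lemma minor_on_schur:
  assumes S: "finite S" "k \<notin> S" and k: "M k k \<noteq> 0"
  shows "minor_on M (insert k S) = M k k * minor_on (\<lambda>i j. M i j - M i k / M k k * M k j) S"
proof -
  let ?M = "\<lambda>i j. M i j - M i k / M k k * M k j"
  \<comment> \<open>\<open>R A\<close> is the matrix after the rows in \<open>A\<close> have been
    treated; each treatment subtracts a multiple of row \<open>k\<close>, which is never changed
    itself.\<close>
  define R where "R A = (\<lambda>i. if i \<in> A then ?M i else M i)" for A
  have "minor_on (R A) (insert k S) = minor_on M (insert k S)" if "A \<subseteq> S" for A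
    using finite_subset[OF that S(1)] that
  proof (induction A rule: finite_induct)
    case empty
    then show ?case by (simp add: R_def)
  next
    case (insert i A)
    then have i: "i \<in> S" "i \<noteq> k"
      using S(2) by auto
    have "R (insert i A) = (R A)(i := \<lambda>j. M i j + (- M i k / M k k) * M k j)"
      by (auto simp: R_def fun_eq_iff)
    then have "minor_on (R (insert i A)) (insert k S) =
        minor_on ((R A)(i := M i)) (insert k S) + (- M i k / M k k) * minor_on ((R A)(i := M k)) (insert k S)"
      by (simp only:) (rule minor_on_row_linear, use S(1) i in auto)
    moreover have "minor_on ((R A)(i := M k)) (insert k S) = 0"
      using S i insert.prems by (intro minor_on_equal_rows[of _ i k]) (auto simp: R_def)
    moreover have "(R A)(i := M i) = R A"
      using insert.hyps(2) by (auto simp: R_def)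
    ultimately show ?case
      using insert by simp
  qed
  then have "minor_on M (insert k S) = minor_on (R S) (insert k S)"
    by simp
  also have "\<dots> = (\<Sum>p | p permutes S. of_int (sign p) * (\<Prod>i\<in>insert k S. R S i (p i)))"
    unfolding minor_on_def
  proof (intro sum.mono_neutral_right ballI)
    show "finite {p. p permutes insert k S}"
      using S(1) by (simp add: finite_permutations)
    show "{p. p permutes S} \<subseteq> {p. p permutes insert k S}"
      using permutes_subset by blast
    fix p assume "p \<in> {p. p permutes insert k S} - {p. p permutes S}"
    then have p: "p permutes insert k S" "\<not> p permutes S"
      by auto
    \<comment> \<open>A permutation moving \<open>k\<close> uses column \<open>k\<close> in some row
      of \<open>S\<close>, where the entry is now 0.\<close>
    have "p k \<noteq> k"
      using permutes_superset[OF p(1), of S] p(2) by auto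
    moreover obtain i where i: "p i = k"
      using permutes_surj[OF p(1)] by (metis surjD)
    ultimately have "i \<noteq> k" "i \<in> insert k S"
      using permutes_not_in[OF p(1), of i] by (metis, metis)
    then have "i \<in> S" "R S i (p i) = 0"
      using i k by (auto simp: R_def)
    then have "(\<Prod>i\<in>insert k S. R S i (p i)) = 0"
      using S(1) by (auto intro!: prod_zero)
    then show "of_int (sign p) * (\<Prod>i\<in>insert k S. R S i (p i)) = 0"
      by simp
  qed
  also have "\<dots> = (\<Sum>p | p permutes S. M k k * (of_int (sign p) * (\<Prod>i\<in>S. ?M i (p i))))"
  proof (intro sum.cong refl)
    fix p assume "p \<in> {p. p permutes S}"
    then have "p k = k"
      using S(2) permutes_not_in by fastforce
    then have "(\<Prod>i\<in>insert k S. R S i (p i)) = M k k * (\<Prod>i\<in>S. ?M i (p i))"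
      using S by (simp add: R_def)
    then show "of_int (sign p) * (\<Prod>i\<in>insert k S. R S i (p i)) =
        M k k * (of_int (sign p) * (\<Prod>i\<in>S. ?M i (p i)))"
      by simp
  qed
  finally show ?thesis
    by (simp add: minor_on_def sum_distrib_left)
qed

lemma minor_on_singleton: "minor_on M {k} = M k k"
proof -
  have "{p. p permutes {k}} = {id}"
    by (auto simp: permutes_sing)
  then show ?thesis
    by (simp add: minor_on_def)
qed

text \<open>Completing the square in \<open>x k\<close> leaves the form of the Schur complement. Its
  minors are those of \<open>M\<close> divided by the positive pivot, so the hypotheses pass to
  it.\<close>

lemma positive_semidefinite:
  assumes "finite S" and "\<And>i. i \<in> S \<Longrightarrow> d i > 0"
    and "\<And>i j. i \<in> S \<Longrightarrow> j \<in> S \<Longrightarrow> d i * M i j = d j * M j i"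
    and "\<And>T. T \<subset> S \<Longrightarrow> minor_on M T > 0" and "minor_on M S \<ge> 0"
  shows "(\<Sum>i\<in>S. \<Sum>j\<in>S. d i * x i * M i j * x j) \<ge> (0 :: rat)"
  using assms
proof (induction S arbitrary: M rule: finite_induct)
  case (insert k S)
  show ?case
  proof (cases "S = {}")
    \<comment> \<open>A single row is treated apart: \<open>{k}\<close> is then not a proper subset,
      and the pivot may be 0.\<close>
    case True
    then have "M k k \<ge> 0" "d k > 0"
      using insert.prems by (auto simp: minor_on_singleton)
    then have "0 \<le> d k * M k k * (x k * x k)"
      by (intro mult_nonneg_nonneg zero_le_square) auto
    then show ?thesis
      using True by (simp add: algebra_simps)
  next
    case False
    then have "{k} \<subset> insert k S"
      using insert.hyps(2) by auto
    then have Mkk: "M k k > 0"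
      using insert.prems(3) minor_on_singleton by metis
    let ?M = "\<lambda>i j. M i j - M i k / M k k * M k j"
    have schur: "minor_on M (insert k T) = M k k * minor_on ?M T" if "T \<subseteq> S" for T
      using that insert.hyps Mkk by (intro minor_on_schur) (auto intro: finite_subset)
    have sym: "d i * M i j = d j * M j i" if "i \<in> insert k S" "j \<in> insert k S" for i j
      using insert.prems(2) that by blast
    have IH: "(\<Sum>i\<in>S. \<Sum>j\<in>S. d i * x i * ?M i j * x j) \<ge> 0"
    proof (rule insert.IH)
      show "d i > 0" if "i \<in> S" for i
        using insert.prems(1) that by simp
      show "d i * ?M i j = d j * ?M j i" if "i \<in> S" "j \<in> S" for i j
      proof -
        have "d i * ?M i j = d i * M i j - (d i * M i k) * M k j / M k k"
          by (simp add: algebra_simps)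
        also have "\<dots> = d j * M j i - (d k * M k j) * M k i / M k k"
          using sym[of i j] sym[of i k] that by (simp add: algebra_simps)
        also have "\<dots> = d j * ?M j i"
          using sym[of j k] that by (simp add: algebra_simps)
        finally show ?thesis .
      qed
      show "minor_on ?M T > 0" if "T \<subset> S" for T
      proof -
        have "insert k T \<subset> insert k S"
          using that insert.hyps(2) by auto
        then have "M k k * minor_on ?M T > 0"
          using insert.prems(3)[of "insert k T"] schur[OF psubset_imp_subset[OF that]] by (simp only:)
        then show ?thesis
          using Mkk by (simp add: zero_less_mult_iff)
      qed
      show "minor_on ?M S \<ge> 0"
        using insert.prems(4) schur[of S] Mkk by (simp add: zero_le_mult_iff)
    qed
    define s where "s = (\<Sum>j\<in>S. M k j * x j)"
    have col: "(\<Sum>i\<in>S. d i * x i * M i k) = d k * s"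
      unfolding s_def sum_distrib_left
    proof (rule sum.cong[OF refl])
      fix i assume "i \<in> S"
      then show "d i * x i * M i k = d k * (M k i * x i)"
        using sym[of i k] by (simp add: algebra_simps)
    qed
    have "(\<Sum>i\<in>insert k S. \<Sum>j\<in>insert k S. d i * x i * M i j * x j) =
      d k * M k k * x k * x k + (\<Sum>j\<in>S. d k * x k * M k j * x j) +
      ((\<Sum>i\<in>S. d i * x i * M i k * x k) + (\<Sum>i\<in>S. \<Sum>j\<in>S. d i * x i * M i j * x j))"
      using insert.hyps by (simp add: sum.distrib algebra_simps)
    also have "(\<Sum>j\<in>S. d k * x k * M k j * x j) = d k * x k * s"
      by (simp add: s_def sum_distrib_left mult.assoc)
    also have "(\<Sum>i\<in>S. d i * x i * M i k * x k) = d k * s * x k"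
      by (simp flip: col sum_distrib_right)
    also have "(\<Sum>i\<in>S. \<Sum>j\<in>S. d i * x i * M i j * x j) =
      (\<Sum>i\<in>S. \<Sum>j\<in>S. d i * x i * ?M i j * x j) + (\<Sum>i\<in>S. \<Sum>j\<in>S. (d i * x i * M i k) * (M k j * x j) / M k k)"
      using Mkk by (simp add: sum.distrib[symmetric] field_simps)
    also have "(\<Sum>i\<in>S. \<Sum>j\<in>S. (d i * x i * M i k) * (M k j * x j) / M k k) = d k * s * s / M k k"
      unfolding sum_divide_distrib[symmetric] sum_product[symmetric] col s_def[symmetric] ..
    finally have "(\<Sum>i\<in>insert k S. \<Sum>j\<in>insert k S. d i * x i * M i j * x j) =
        d k * M k k * (x k + s / M k k)\<^sup>2 + (\<Sum>i\<in>S. \<Sum>j\<in>S. d i * x i * ?M i j * x j)"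
      using Mkk by (simp add: power2_eq_square field_simps)
    moreover have "d k * M k k * (x k + s / M k k)\<^sup>2 \<ge> 0"
      using Mkk insert.prems(1)[of k] by (intro mult_nonneg_nonneg) auto
    ultimately show ?thesis
      using IH by linarith
  qed
qed simp

section \<open>Norms of weights and descent by reflections\<close>

section \<open>Root multiplicities\<close>

lemma finite_multisets_of_size:
  assumes "finite I"
  shows "finite {\<beta>. set_mset \<beta> \<subseteq> I \<and> size \<beta> = h}"
    and "card {\<beta>. set_mset \<beta> \<subseteq> I \<and> size \<beta> = h} \<le> (h + 1) ^ card I"
proof -
  let ?B = "{\<beta>. set_mset \<beta> \<subseteq> I \<and> size \<beta> = h}"
  let ?r = "\<lambda>\<beta>. restrict (count \<beta>) I"
  have inj: "inj_on ?r ?B"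
  proof (rule inj_onI)
    fix \<beta> \<gamma> assume *: "\<beta> \<in> ?B" "\<gamma> \<in> ?B" "?r \<beta> = ?r \<gamma>"
    show "\<beta> = \<gamma>"
    proof (rule multiset_eqI)
      fix i show "count \<beta> i = count \<gamma> i"
      proof (cases "i \<in> I")
        case True
        then show ?thesis
          using fun_cong[OF *(3), of i] by simp
      next
        case False
        then have "i \<notin># \<beta>" "i \<notin># \<gamma>"
          using *(1,2) by auto
        then show ?thesis
          by (simp add: not_in_iff)
      qed
    qed
  qed
  have sub: "?r ` ?B \<subseteq> I \<rightarrow>\<^sub>E {..h}"
    by (auto simp: count_le_size)
  have fin: "finite (I \<rightarrow>\<^sub>E {..h})"
    using assms by (simp add: finite_PiE)
  show "finite ?B"
    using inj_on_finite[OF inj sub fin] .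
  show "card ?B \<le> (h + 1) ^ card I"
    using card_inj_on_le[OF inj sub fin] assms by (simp add: card_PiE)
qed

locale serre_affine = serre I a field_type
  for I :: "'i set" and a and field_type :: "'k::field_char_0 itself" +
  fixes d :: "'i \<Rightarrow> rat"
  assumes sym: "symmetrized_by I a d" and type: "finite_type I a \<or> affine_type I a"
begin

lemma d_pos: "i \<in> I \<Longrightarrow> d i > 0"
  and d_sym: "i \<in> I \<Longrightarrow> j \<in> I \<Longrightarrow> d i * of_int (a i j) = d j * of_int (a j i)"
  using sym by (auto simp: symmetrized_by_def)

lemma form_nonneg: "(\<Sum>i\<in>I. \<Sum>j\<in>I. d i * x i * of_int (a i j) * x j) \<ge> 0"
proof (rule positive_semidefinite)
  have "principal_minor a T > 0" if "T \<subset> I" for T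
    using type that unfolding finite_type_def affine_type_def by blast
  then show "minor_on (\<lambda>i j. of_int (a i j)) T > 0" if "T \<subset> I" for T
    using that by (simp flip: of_int_principal_minor)
  have "principal_minor a I \<ge> 0"
    using type by (auto simp: finite_type_def affine_type_def intro: less_imp_le)
  then show "minor_on (\<lambda>i j. of_int (a i j)) I \<ge> 0"
    by (simp flip: of_int_principal_minor)
qed (use finite_I d_pos d_sym in auto)

text \<open>The norm of the weight \<beta> in the symmetrized Cartan form.\<close>

definition bil :: "'i multiset \<Rightarrow> rat" where
  "bil \<beta> = (\<Sum>i\<in>#\<beta>. d i * of_int (hmul i \<beta>))"

lemma hmul_union: "hmul i (\<beta> + \<gamma>) = hmul i \<beta> + hmul i \<gamma>"
  and hmul_add_mset: "hmul i (add_mset j \<beta>) = a i j + hmul i \<beta>"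
  and hmul_replicate: "hmul i (replicate_mset m j) = int m * a i j"
  by (simp_all add: hmul_def)

lemma sum_mset_hmul_swap:
  assumes "set_mset \<beta> \<subseteq> I" "j \<in> I"
  shows "(\<Sum>i\<in>#\<beta>. d i * of_int (a i j)) = d j * of_int (hmul j \<beta>)"
  using assms(1)
proof (induction \<beta>)
  case (add i \<beta>)
  then show ?case
    using d_sym[of i j] assms(2) by (simp add: hmul_def algebra_simps)
qed (simp add: hmul_def)

text \<open>Simple reflections are isometries: the two correction terms cancel because \<beta> pairs
  to \<open>m\<close> with the coroot and the reflected weight to \<open>- m\<close>.\<close>

lemma bil_reflection:
  assumes "set_mset \<beta> \<subseteq> I" "i \<in> I" "hmul i \<beta> = int m" "m \<le> count \<beta> i"
  shows "bil (\<beta> - replicate_mset m i) = bil \<beta>"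
proof -
  define \<gamma> where "\<gamma> = \<beta> - replicate_mset m i"
  have \<beta>: "\<beta> = \<gamma> + replicate_mset m i"
    using assms(4) by (simp add: \<gamma>_def flip: count_le_replicate_mset_subset_eq)
  have \<gamma>: "set_mset \<gamma> \<subseteq> I"
    using assms(1) unfolding \<beta> by simp
  have h: "hmul i \<gamma> = - int m"
    using assms(3) a_diag[OF assms(2)] unfolding \<beta> by (simp add: hmul_union hmul_replicate)
  have "bil \<beta> = (\<Sum>l\<in>#\<gamma>. d l * of_int (hmul l \<gamma>) + of_int (int m) * (d l * of_int (a l i)))
      + of_nat m * (d i * of_int (hmul i \<beta>))"
    by (simp add: bil_def \<beta> hmul_union hmul_replicate algebra_simps)
  also have "\<dots> = bil \<gamma> + of_int (int m) * (d i * of_int (hmul i \<gamma>)) + of_nat m * (d i * of_int (hmul i \<beta>))"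
    by (simp only: sum_mset.distrib bil_def sum_mset_distrib_left[symmetric]
        sum_mset_hmul_swap[OF \<gamma> assms(2)])
  also have "\<dots> = bil \<gamma>"
    by (simp add: h assms(3))
  finally show ?thesis
    by (simp add: \<gamma>_def)
qed

lemma sum_mset_count: "set_mset \<beta> \<subseteq> I \<Longrightarrow> (\<Sum>i\<in>#\<beta>. f i) = (\<Sum>i\<in>I. of_nat (count \<beta> i) * f i)"
  for f :: "'i \<Rightarrow> rat"
proof (induction \<beta>)
  case (add i \<beta>)
  have "(\<Sum>j\<in>I. of_nat (count (add_mset i \<beta>) j) * f j) =
      (\<Sum>j\<in>I. (if j = i then f i else 0) + of_nat (count \<beta> j) * f j)"
    by (intro sum.cong) (auto simp: algebra_simps)
  then show ?case
    using add finite_I by (simp add: sum.distrib)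
qed simp

lemma of_int_hmul: "of_int (hmul i \<beta>) = (\<Sum>j\<in>#\<beta>. of_int (a i j) :: rat)"
  by (induction \<beta>) (simp_all add: hmul_def)

lemma form_hmul:
  assumes "set_mset \<beta> \<subseteq> I"
  shows "(\<Sum>i\<in>I. \<Sum>j\<in>I. d i * x i * of_int (a i j) * of_nat (count \<beta> j)) = (\<Sum>i\<in>I. d i * x i * of_int (hmul i \<beta>))"
  by (simp add: of_int_hmul sum_mset_count[OF assms] sum_distrib_left algebra_simps)

text \<open>An isotropic vector of a semidefinite form is orthogonal to everything: otherwise adding
  a multiple of \<beta> to the simple root of \<open>k\<close> would make the form negative.\<close>

lemma radical:
  assumes \<beta>: "set_mset \<beta> \<subseteq> I" and "bil \<beta> \<le> 0" and k: "k \<in> I"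
  shows "hmul k \<beta> = 0"
proof (rule ccontr)
  assume nz: "hmul k \<beta> \<noteq> 0"
  define h :: rat where "h = of_int (hmul k \<beta>)"
  have h: "h \<noteq> 0"
    using nz by (simp add: h_def)
  \<comment> \<open>With this \<open>t\<close> the mixed terms contribute \<open>- 4 * d k\<close>,
    which outweighs the norm \<open>2 * d k\<close> of the simple root.\<close>
  define t where "t = - 2 / h"
  define c where "c i = (of_nat (count \<beta> i) :: rat)" for i
  define \<delta> where "\<delta> i = (if i = k then 1 else 0 :: rat)" for i
  define B where "B x y = (\<Sum>i\<in>I. \<Sum>j\<in>I. d i * x i * of_int (a i j) * y j)" for x y :: "'i \<Rightarrow> rat"
  have B_sym: "B x y = B y x" for x y
    unfolding B_def
    by (subst sum.swap) (intro sum.cong refl, use d_sym in \<open>simp add: algebra_simps\<close>)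
  have lin: "B x (\<lambda>i. t * y i + z i) = t * B x y + B x z" for x y z
    by (simp add: B_def sum_distrib_left sum.distrib algebra_simps)
  have Bc: "B x c = (\<Sum>i\<in>I. d i * x i * of_int (hmul i \<beta>))" for x
    unfolding B_def c_def by (rule form_hmul[OF \<beta>])
  have "B c c = bil \<beta>"
    by (simp add: Bc bil_def sum_mset_count[OF \<beta>] c_def algebra_simps)
  then have Bcc: "B c c \<le> 0"
    using assms(2) by simp
  have B\<delta>c: "B \<delta> c = d k * h"
    using k finite_I by (simp add: Bc \<delta>_def h_def if_distrib if_distribR cong: if_cong)
  have pick: "(\<Sum>j\<in>I. f j * \<delta> j) = f k" for f
  proof -
    have "f j * \<delta> j = (if j = k then f j else 0)" for j
      by (simp add: \<delta>_def)
    then show ?thesis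
      using k finite_I by (simp add: sum.delta)
  qed
  have "B \<delta> \<delta> = (\<Sum>i\<in>I. d i * \<delta> i * of_int (a i k))"
    by (simp only: B_def pick)
  also have "\<dots> = (\<Sum>i\<in>I. d i * of_int (a i k) * \<delta> i)"
    by (rule sum.cong) simp_all
  finally have B\<delta>\<delta>: "B \<delta> \<delta> = 2 * d k"
    using a_diag[OF k] by (simp add: pick)
  have "0 \<le> B (\<lambda>i. t * c i + \<delta> i) (\<lambda>i. t * c i + \<delta> i)"
    unfolding B_def by (rule form_nonneg)
  also have "\<dots> = t * (t * B c c + B \<delta> c) + (t * B \<delta> c + B \<delta> \<delta>)"
    using B_sym by (simp add: lin)
  also have "\<dots> \<le> 2 * (t * (d k * h)) + 2 * d k"
    using mult_nonneg_nonpos[OF zero_le_square[of t] Bcc] by (simp add: B\<delta>c B\<delta>\<delta> algebra_simps)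
  also have "\<dots> = - 2 * d k"
    using h by (simp add: t_def field_simps)
  also have "\<dots> < 0"
    using d_pos[OF k] by simp
  finally show False by simp
qed

text \<open>The norm is a combination of the numbers \<open>hmul i \<beta>\<close>, for letters
  \<open>i\<close> of \<beta>, with positive coefficients. One of them is therefore positive, and
  reflection in \<open>i\<close> shortens \<beta>. The descent ends at a multiple of a simple root,
  where there is only one word, or at a weight that is not a sum of simple roots.\<close>

lemma real_multiplicity:
  assumes "set_mset \<beta> \<subseteq> I" "bil \<beta> > 0"
  shows "\<exists>x. Lsp \<beta> \<subseteq> pvs.span ({x} \<union> N)"
  using assms
proof (induction "size \<beta>" arbitrary: \<beta> rule: less_induct)
  case less
  obtain i where i: "i \<in># \<beta>" "hmul i \<beta> > 0"
  proof (rule ccontr)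
    assume neg: "\<not> thesis"
    have "(\<Sum>i\<in>#\<beta>. d i * of_int (hmul i \<beta>)) \<le> (\<Sum>i\<in>#\<beta>. 0)"
    proof (intro sum_mset_mono)
      fix i assume "i \<in># \<beta>"
      moreover from this have "hmul i \<beta> \<le> 0"
        using neg that by force
      ultimately show "d i * of_int (hmul i \<beta>) \<le> 0"
        using d_pos[of i] less.prems(1) by (intro mult_nonneg_nonpos) auto
    qed
    then show False
      using less.prems(2) by (simp add: bil_def)
  qed
  then have iI: "i \<in> I"
    using less.prems(1) by auto
  show ?case
  proof (cases "filter_mset ((\<noteq>) i) \<beta> = {#}")
    case True
    then have "set_mset \<beta> \<subseteq> {i}"
      using arg_cong[OF True, of set_mset] by auto
    then have "w = replicate (length w) i \<and> length w = size \<beta>" if "mset w = \<beta>" for w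
      using that by (auto intro!: replicate_eqI)
    then have "{rnc w | w. set w \<subseteq> I \<and> mset w = \<beta>} \<subseteq> {rnc (replicate (size \<beta>) i)} \<union> N"
      by (smt (verit, best) Un_iff insertI1 mem_Collect_eq subsetI)
    then show ?thesis
      unfolding Lsp_def using pvs.span_mono by blast
  next
    case False
    obtain m where m: "hmul i \<beta> = int m" "m > 0"
      using i(2) by (metis pos_int_cases)
    let ?T = "if m \<le> count \<beta> i then Lsp (\<beta> - replicate_mset m i) else {0}"
    have "\<exists>x. ?T \<subseteq> pvs.span ({x} \<union> N)"
    proof (cases "m \<le> count \<beta> i")
      case True
      then have "replicate_mset m i \<subseteq># \<beta>"
        by (simp flip: count_le_replicate_mset_subset_eq)
      then have "size (\<beta> - replicate_mset m i) < size \<beta>"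
        using m(2) by (simp add: size_Diff_submset size_mset_mono nonempty_has_size
            diff_less i(1)) (metis diff_less i(1) nonempty_has_size empty_iff set_mset_empty)
      moreover have "set_mset (\<beta> - replicate_mset m i) \<subseteq> I"
        using less.prems(1) by (meson in_diffD subset_iff)
      ultimately show ?thesis
        using less.hyps True bil_reflection[OF less.prems(1) iI m(1) True] less.prems(2) by simp
    qed (auto simp: pvs.span_zero)
    then obtain x where x: "?T \<subseteq> pvs.span ({x} \<union> N)"
      by blast
    let ?e = "ad (gen i) ^^ m"
    have "Lsp \<beta> \<subseteq> pvs.span ({?e x} \<union> N)"
    proof
      fix z assume "z \<in> Lsp \<beta>"
      then obtain y where y: "y \<in> ?T" "z - ?e y \<in> N"
        using reflection[OF iI False m] by blast
      have "?e y \<in> pvs.span ({?e x} \<union> N)"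
      proof (rule klinear_span_subset[OF klinear_ad_pow])
        show "y \<in> pvs.span ({x} \<union> N)"
          using y(1) x by blast
        show "?e v \<in> pvs.span ({?e x} \<union> N)" if "v \<in> {x} \<union> N" for v
          using that by (auto intro: pvs.span_base ad_pow_N)
      qed (rule pvs.subspace_span)
      moreover have "z - ?e y \<in> pvs.span ({?e x} \<union> N)"
        using y(2) by (intro pvs.span_base) simp
      ultimately show "z \<in> pvs.span ({?e x} \<union> N)"
        using pvs.span_add by fastforce
    qed
    then show ?thesis by blast
  qed
qed

lemma multiplicity_bound:
  assumes \<beta>: "set_mset \<beta> \<subseteq> I"
  shows "\<exists>S. finite S \<and> card S \<le> card I + 1 \<and> Lsp \<beta> \<subseteq> pvs.span (S \<union> N)"
proof (cases "bil \<beta> > 0")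
  case True
  then obtain x where "Lsp \<beta> \<subseteq> pvs.span ({x} \<union> N)"
    using real_multiplicity[OF \<beta>] by blast
  then show ?thesis
    by (intro exI[of _ "{x}"]) simp
next
  case False
  then have rad: "hmul k \<beta> = 0" if "k \<in> I" for k
    using radical[OF \<beta>] that by simp
  have "\<exists>x. Lsp (\<beta> - {#j#}) \<subseteq> pvs.span ({x} \<union> N)" if j: "j \<in># \<beta>" for j
  proof -
    define \<gamma> where "\<gamma> = \<beta> - {#j#}"
    have b: "\<beta> = add_mset j \<gamma>"
      using j by (simp add: \<gamma>_def)
    have jI: "j \<in> I" and \<gamma>: "set_mset \<gamma> \<subseteq> I"
      using \<beta> b by auto
    have h: "hmul i \<gamma> = - a i j" if "i \<in> I" for i
      using rad[OF that] by (simp add: b hmul_add_mset)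
    \<comment> \<open>As \<beta> is in the radical, \<gamma> pairs with every coroot like minus the
      simple root of \<open>j\<close>; hence its norm is that of the simple root.\<close>
    have "bil \<gamma> = (\<Sum>i\<in>#\<gamma>. - 1 * (d i * of_int (a i j)))"
      unfolding bil_def using h \<gamma>
      by (intro arg_cong[of _ _ sum_mset] image_mset_cong) auto
    also have "\<dots> = - (d j * of_int (hmul j \<gamma>))"
      by (simp only: sum_mset_distrib_left[symmetric] sum_mset_hmul_swap[OF \<gamma> jI])
    also have "\<dots> = 2 * d j"
      using h[OF jI] a_diag[OF jI] by simp
    finally have "bil \<gamma> > 0"
      using d_pos[OF jI] by simp
    then show ?thesis
      using real_multiplicity[OF \<gamma>] by (simp add: \<gamma>_def)
  qed
  then obtain x where x: "\<And>j. j \<in># \<beta> \<Longrightarrow> Lsp (\<beta> - {#j#}) \<subseteq> pvs.span ({x j} \<union> N)"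
    by metis
  let ?S = "(\<lambda>j. ad (gen j) (x j)) ` set_mset \<beta>"
  have "rnc w \<in> pvs.span (?S \<union> N)" if w: "set w \<subseteq> I" "mset w = \<beta>" for w
  proof (cases w)
    case Nil
    then show ?thesis by (simp add: pvs.span_zero)
  next
    case (Cons j w')
    \<comment> \<open>A single letter pairs to 2 with its own coroot and so is not in the
      radical.\<close>
    have "w' \<noteq> []"
    proof
      assume "w' = []"
      then have "hmul j \<beta> = 2" "j \<in> I"
        using Cons w a_diag by (auto simp: hmul_def)
      then show False
        using rad by simp
    qed
    then have *: "rnc w = ad (gen j) (rnc w')"
      by (simp add: Cons rnc_Cons)
    have j: "j \<in># \<beta>" "mset w' = \<beta> - {#j#}"
      using Cons w by auto
    have "rnc w' \<in> Lsp (\<beta> - {#j#})"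
      unfolding Lsp_def using w Cons j by (intro pvs.span_base) auto
    then have "rnc w' \<in> pvs.span ({x j} \<union> N)"
      using x[OF j(1)] by blast
    then show ?thesis
      unfolding *
    proof (rule klinear_span_subset[OF klinear_ad])
      show "ad (gen j) v \<in> pvs.span (?S \<union> N)" if "v \<in> {x j} \<union> N" for v
        using that j(1) by (auto intro: pvs.span_base ideal_of_ad)
    qed (rule pvs.subspace_span)
  qed
  then have "Lsp \<beta> \<subseteq> pvs.span (?S \<union> N)"
    unfolding Lsp_def by (intro pvs.span_minimal pvs.subspace_span) blast
  moreover have "card ?S \<le> card I"
    using card_image_le[of "set_mset \<beta>"] card_mono[OF finite_I \<beta>] by (meson finite_set_mset le_trans)
  ultimately show ?thesis
    by (intro exI[of _ ?S]) auto
qed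

text \<open>Multiplicities are uniformly bounded, and a weight of height \<open>h\<close> is given
  by \<open>card I\<close> coefficients between 0 and \<open>h\<close>; together this is a
  polynomial in \<open>h\<close>.\<close>

lemma height_multiplicity_bound:
  "\<exists>S. finite S \<and> card S \<le> (card I + 1) * (h + 1) ^ card I \<and>
     {rnc w | w. set w \<subseteq> I \<and> length w = h} \<subseteq> pvs.span (S \<union> N)"
proof -
  let ?B = "{\<beta>. set_mset \<beta> \<subseteq> I \<and> size \<beta> = h}"
  note B = finite_multisets_of_size[OF finite_I, of h]
  obtain S where S: "\<And>\<beta>. \<beta> \<in> ?B \<Longrightarrow> finite (S \<beta>) \<and> card (S \<beta>) \<le> card I + 1 \<and> Lsp \<beta> \<subseteq> pvs.span (S \<beta> \<union> N)"
    using multiplicity_bound by (metis (no_types, lifting) mem_Collect_eq)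
  show ?thesis
  proof (intro exI conjI)
    show "finite (\<Union>\<beta>\<in>?B. S \<beta>)"
      using B(1) S by blast
    have "card (\<Union>\<beta>\<in>?B. S \<beta>) \<le> (\<Sum>\<beta>\<in>?B. card (S \<beta>))"
      using B(1) by (rule card_UN_le)
    also have "\<dots> \<le> (\<Sum>\<beta>\<in>?B. card I + 1)"
      using S by (intro sum_mono) blast
    also have "\<dots> \<le> (card I + 1) * (h + 1) ^ card I"
      using B(2) by (simp add: mult.commute del: mult_Suc mult_Suc_right)
    finally show "card (\<Union>\<beta>\<in>?B. S \<beta>) \<le> (card I + 1) * (h + 1) ^ card I" .
    show "{rnc w | w. set w \<subseteq> I \<and> length w = h} \<subseteq> pvs.span ((\<Union>\<beta>\<in>?B. S \<beta>) \<union> N)"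
    proof safe
      fix w assume w: "set w \<subseteq> I" "h = length w"
      then have "mset w \<in> ?B"
        by simp
      moreover have "rnc w \<in> Lsp (mset w)"
        unfolding Lsp_def using w by (intro pvs.span_base) blast
      ultimately have "rnc w \<in> pvs.span (S (mset w) \<union> N)"
        using S by blast
      moreover have "S (mset w) \<subseteq> (\<Union>\<beta>\<in>{\<beta>. set_mset \<beta> \<subseteq> I \<and> size \<beta> = length w}. S \<beta>)"
        using w by (intro UN_upper) simp
      ultimately show "rnc w \<in> pvs.span ((\<Union>\<beta>\<in>{\<beta>. set_mset \<beta> \<subseteq> I \<and> size \<beta> = length w}. S \<beta>) \<union> N)"
        using pvs.span_mono[OF Un_mono[OF _ subset_refl]] by blast
    qed
  qed
qed

end

section \<open>Generating functions of weighted multisets\<close>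

section \<open>Subexponential growth\<close>

text \<open>Equivalent to the limit superior of the \<open>m\<close>-th roots of \<open>s m\<close>
  being at most 1. In this form stability under products and partial sums is elementary.\<close>

definition subexponential :: "(nat \<Rightarrow> nat) \<Rightarrow> bool" where
  "subexponential s \<longleftrightarrow> (\<forall>t. 0 < t \<and> t < 1 \<longrightarrow> (\<exists>K. \<forall>m. real (s m) * t ^ m \<le> K))"

definition weighted_multisets :: "('j \<Rightarrow> nat) \<Rightarrow> 'j set \<Rightarrow> nat \<Rightarrow> 'j multiset set" where
  "weighted_multisets dg J l = {M. set_mset M \<subseteq> J \<and> (\<Sum>j\<in>#M. dg j) = l}"

text \<open>The product is the generating function of the weighted multisets at \<open>t\<close>; a
  term of a series with nonnegative terms is at most its sum. The induction splits off the
  multiplicity of one element, which gives a geometric series.\<close>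

lemma weighted_multisets_bound:
  assumes "finite J" "\<And>j. j \<in> J \<Longrightarrow> dg j \<ge> 1" "0 < t" "t < 1"
  shows "finite (weighted_multisets dg J l) \<and>
    real (card (weighted_multisets dg J l)) * t ^ l \<le> (\<Prod>j\<in>J. 1 / (1 - t ^ dg j))"
  using assms(1,2)
proof (induction J arbitrary: l rule: finite_induct)
  case empty
  have sub: "weighted_multisets dg {} l \<subseteq> {{#}}"
    by (auto simp: weighted_multisets_def)
  have "card (weighted_multisets dg {} l) \<le> 1"
    using card_mono[OF _ sub] by simp
  then have "real (card (weighted_multisets dg {} l)) * t ^ l \<le> 1 * 1"
    using assms(3,4) by (intro mult_mono) (auto simp: power_le_one)
  then show ?case
    using finite_subset[OF sub] by simp
next
  case (insert j J)
  let ?W = "weighted_multisets dg"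
  let ?d = "dg j"
  \<comment> \<open>\<open>k\<close> is the multiplicity of \<open>j\<close>. The bound
    \<open>k \<le> l\<close> follows from \<open>dg j \<ge> 1\<close> and makes finiteness of
    \<open>A\<close> evident.\<close>
  define A where "A = {k. k \<le> l \<and> k * ?d \<le> l}"
  have A: "finite A"
    by (simp add: A_def)
  have sub: "?W (insert j J) l \<subseteq> (\<Union>k\<in>A. (\<lambda>M. M + replicate_mset k j) ` ?W J (l - k * ?d))"
  proof
    fix M assume M: "M \<in> ?W (insert j J) l"
    define k where "k = count M j"
    define M' where "M' = filter_mset ((\<noteq>) j) M"
    have split: "M = M' + replicate_mset k j"
      by (rule multiset_eqI) (auto simp: M'_def k_def)
    have sum: "(\<Sum>i\<in>#M'. dg i) + k * ?d = l"
      using M unfolding weighted_multisets_def by (subst (asm) split) simp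
    have "set_mset M' \<subseteq> J"
      using M by (auto simp: weighted_multisets_def M'_def)
    moreover have "k \<le> k * ?d"
      using insert.prems[of j] by simp
    then have "k \<le> l"
      using sum by linarith
    ultimately have "k \<in> A" "M' \<in> ?W J (l - k * ?d)"
      using sum by (auto simp: A_def weighted_multisets_def)
    then show "M \<in> (\<Union>k\<in>A. (\<lambda>M. M + replicate_mset k j) ` ?W J (l - k * ?d))"
      using split by blast
  qed
  have fin: "finite (?W J m)" and IH: "real (card (?W J m)) * t ^ m \<le> (\<Prod>j\<in>J. 1 / (1 - t ^ dg j))" for m
    using insert.IH insert.prems by auto
  let ?P = "\<Prod>j\<in>J. 1 / (1 - t ^ dg j)"
  have tpow: "t ^ dg i < 1" if "i \<in> insert j J" for i
    using assms(3,4) insert.prems[OF that] by (simp add: power_less_one_iff)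
  have P: "?P \<ge> 0"
    using tpow by (intro prod_nonneg) (auto simp: less_imp_le)
  have finU: "finite (\<Union>k\<in>A. (\<lambda>M. M + replicate_mset k j) ` ?W J (l - k * ?d))"
    using A fin by blast
  have "card (?W (insert j J) l) \<le> card (\<Union>k\<in>A. (\<lambda>M. M + replicate_mset k j) ` ?W J (l - k * ?d))"
    by (rule card_mono[OF finU sub])
  also have "\<dots> \<le> (\<Sum>k\<in>A. card ((\<lambda>M. M + replicate_mset k j) ` ?W J (l - k * ?d)))"
    using A by (rule card_UN_le)
  also have "\<dots> \<le> (\<Sum>k\<in>A. card (?W J (l - k * ?d)))"
    by (intro sum_mono card_image_le fin)
  finally have "real (card (?W (insert j J) l)) * t ^ l \<le> real (\<Sum>k\<in>A. card (?W J (l - k * ?d))) * t ^ l"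
    using assms(3) by (intro mult_right_mono of_nat_mono) auto
  also have "\<dots> = (\<Sum>k\<in>A. (real (card (?W J (l - k * ?d))) * t ^ (l - k * ?d)) * (t ^ ?d) ^ k)"
    unfolding of_nat_sum sum_distrib_right
  proof (intro sum.cong refl)
    fix k assume "k \<in> A"
    then have "t ^ l = t ^ (l - k * ?d) * (t ^ ?d) ^ k"
      by (simp add: A_def power_mult[symmetric] mult.commute flip: power_add)
    then show "real (card (?W J (l - k * ?d))) * t ^ l = real (card (?W J (l - k * ?d))) * t ^ (l - k * ?d) * (t ^ ?d) ^ k"
      by simp
  qed
  also have "\<dots> \<le> (\<Sum>k\<in>A. ?P * (t ^ ?d) ^ k)"
    using assms(3) by (intro sum_mono mult_right_mono IH) auto
  also have "\<dots> \<le> (\<Sum>k<Suc l. ?P * (t ^ ?d) ^ k)"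
    using P assms(3) by (intro sum_mono2) (auto simp: A_def)
  also have "\<dots> = ?P * ((1 - (t ^ ?d) ^ Suc l) / (1 - t ^ ?d))"
    using tpow[of j] by (simp add: sum_distrib_left[symmetric] sum_gp_strict del: sum.lessThan_Suc power_Suc)
  also have "\<dots> \<le> ?P * (1 / (1 - t ^ ?d))"
    using P tpow[of j] assms(3) by (intro mult_left_mono divide_right_mono) auto
  also have "\<dots> = (\<Prod>j\<in>insert j J. 1 / (1 - t ^ dg j))"
    using insert.hyps by simp
  finally show ?case
    using finite_subset[OF sub finU] by blast
qed

text \<open>Termwise differentiation of the power series raises the exponent \<open>n\<close> by
  one.\<close>

lemma summable_poly_geometric:
  fixes t :: real
  assumes "\<bar>t\<bar> < 1"
  shows "summable (\<lambda>h. (real h + 1) ^ n * t ^ h)"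
  using assms
proof (induction n arbitrary: t)
  case 0
  then show ?case by (simp add: summable_geometric)
next
  case (Suc n)
  have "summable (\<lambda>h. real h ^ n * x ^ h)" if "norm x < 1" for x :: real
  proof -
    have "summable (\<lambda>h. x * ((real h + 1) ^ n * x ^ h))"
      using Suc.IH[of x] that by (intro summable_mult) simp
    then have "summable (\<lambda>h. real (Suc h) ^ n * x ^ Suc h)"
      by (simp add: algebra_simps)
    then show ?thesis
      by (subst (asm) summable_Suc_iff)
  qed
  then have "summable (\<lambda>h. diffs (\<lambda>h. real h ^ n) h * t ^ h)"
    using Suc.prems by (intro termdiff_converges[of t 1]) auto
  then show ?case
    by (simp add: diffs_def algebra_simps)
qed

text \<open>Spanning Lie elements are numbered by naturals that encode a pair of degree and index:
  the order of the naturals then sorts monomials, and the degree can be read off.\<close>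

definition key_deg :: "nat \<Rightarrow> nat" where
  "key_deg n = fst (prod_decode n)"

definition keys_upto :: "(nat \<Rightarrow> nat) \<Rightarrow> nat \<Rightarrow> nat set" where
  "keys_upto c l = {n. 1 \<le> key_deg n \<and> key_deg n \<le> l \<and> snd (prod_decode n) < c (key_deg n)}"

lemma keys_upto_eq: "keys_upto c l = prod_encode ` (SIGMA h:{1..l}. {..<c h})"
proof -
  have "n \<in> prod_encode ` (SIGMA h:{1..l}. {..<c h})" if "n \<in> keys_upto c l" for n
  proof (rule image_eqI[of _ _ "prod_decode n"])
    show "prod_decode n \<in> (SIGMA h:{1..l}. {..<c h})"
      using that by (cases "prod_decode n") (simp add: keys_upto_def key_deg_def)
  qed simp
  moreover have "prod_encode x \<in> keys_upto c l" if "x \<in> (SIGMA h:{1..l}. {..<c h})" for x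
    using that by (auto simp: keys_upto_def key_deg_def)
  ultimately show ?thesis by blast
qed

text \<open>The coefficient of t^l in the product over h \<ge> 1 of 1 / (1 - t^h)^(c h): the Hilbert
  series of a symmetric algebra with \<open>c h\<close> generators in degree
  \<open>h\<close>.\<close>

definition pbw_count :: "(nat \<Rightarrow> nat) \<Rightarrow> nat \<Rightarrow> nat" where
  "pbw_count c l = card (weighted_multisets key_deg (keys_upto c l) l)"

text \<open>The logarithm of the Euler product at \<open>t\<close> is at most the sum of the terms
  \<open>c h * t ^ h / (1 - t)\<close>. This converges for polynomially bounded \<open>c\<close>,
  with a bound independent of \<open>l\<close>.\<close>

lemma subexponential_pbw_count:
  assumes c: "\<And>h. c h \<le> C * (h + 1) ^ n"
  shows "subexponential (pbw_count c)"
  unfolding subexponential_def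
proof (intro allI impI)
  fix t :: real assume t: "0 < t \<and> t < 1"
  define T where "T = real C * suminf (\<lambda>h. (real h + 1) ^ n * t ^ h)"
  have summ: "summable (\<lambda>h. real C * ((real h + 1) ^ n * t ^ h))"
    using t by (intro summable_mult summable_poly_geometric) auto
  have "real (pbw_count c l) * t ^ l \<le> exp (T / (1 - t))" for l
  proof -
    have fin: "finite (keys_upto c l)"
      by (simp add: keys_upto_eq)
    have "real (pbw_count c l) * t ^ l \<le> (\<Prod>j\<in>keys_upto c l. 1 / (1 - t ^ key_deg j))"
      unfolding pbw_count_def using weighted_multisets_bound[OF fin, of key_deg t l] t
      by (auto simp: keys_upto_def)
    also have "\<dots> \<le> (\<Prod>j\<in>keys_upto c l. exp (t ^ key_deg j / (1 - t)))"
    proof (intro prod_mono conjI)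
      fix j assume "j \<in> keys_upto c l"
      then have "t ^ key_deg j \<le> t ^ 1"
        using t by (intro power_decreasing) (auto simp: keys_upto_def)
      then have x: "t ^ key_deg j \<le> t" "t ^ key_deg j > 0"
        using t by auto
      then show "0 \<le> 1 / (1 - t ^ key_deg j)"
        using t by simp
      have "1 / (1 - t ^ key_deg j) = 1 + t ^ key_deg j / (1 - t ^ key_deg j)"
        using x t by (simp add: field_simps)
      also have "\<dots> \<le> 1 + t ^ key_deg j / (1 - t)"
        using x t by (intro add_left_mono divide_left_mono) auto
      also have "\<dots> \<le> exp (t ^ key_deg j / (1 - t))"
        by (rule exp_ge_add_one_self)
      finally show "1 / (1 - t ^ key_deg j) \<le> exp (t ^ key_deg j / (1 - t))" .
    qed
    also have "\<dots> = exp ((\<Sum>j\<in>keys_upto c l. t ^ key_deg j) / (1 - t))"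
      using fin by (simp add: exp_sum sum_divide_distrib)
    also have "(\<Sum>j\<in>keys_upto c l. t ^ key_deg j) = (\<Sum>h\<in>{1..l}. real (c h) * t ^ h)"
    proof -
      have "(\<Sum>j\<in>keys_upto c l. t ^ key_deg j) = (\<Sum>x\<in>(SIGMA h:{1..l}. {..<c h}). t ^ fst x)"
        unfolding keys_upto_eq
        by (subst sum.reindex) (auto simp: key_deg_def inj_prod_encode)
      also have "\<dots> = (\<Sum>h\<in>{1..l}. \<Sum>k<c h. t ^ h)"
        by (subst sum.Sigma) (auto simp: case_prod_beta)
      finally show ?thesis by simp
    qed
    also have "(\<Sum>h\<in>{1..l}. real (c h) * t ^ h) \<le> T"
    proof -
      have "(\<Sum>h\<in>{1..l}. real (c h) * t ^ h) \<le> (\<Sum>h\<in>{1..l}. real C * ((real h + 1) ^ n * t ^ h))"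
      proof (intro sum_mono)
        fix h
        have "real (c h) \<le> real C * (real h + 1) ^ n"
          using of_nat_mono[OF c[of h], where ?'a = real] by (simp add: add.commute)
        then show "real (c h) * t ^ h \<le> real C * ((real h + 1) ^ n * t ^ h)"
          using t by (simp add: mult.assoc[symmetric] mult_right_mono)
      qed
      also have "\<dots> \<le> suminf (\<lambda>h. real C * ((real h + 1) ^ n * t ^ h))"
        using t by (intro sum_le_suminf summ) auto
      also have "\<dots> = T"
        unfolding T_def using t by (intro suminf_mult summable_poly_geometric) auto
      finally show ?thesis .
    qed
    finally show ?thesis
      using t by (simp add: divide_right_mono)
  qed
  then show "\<exists>K. \<forall>m. real (pbw_count c m) * t ^ m \<le> K"
    by blast
qed

section \<open>Straightening of products of Lie elements\<close>

section \<open>Ordered monomials in Lie elements\<close>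

context serre
begin

text \<open>By the Jacobi identity, \<open>ad\<close> of a bracket is the commutator of the two
  operators \<open>ad\<close>, so the left factor is dismantled letter by letter from the
  outside.\<close>

lemma ad_rnc_rnc:
  assumes "set u \<subseteq> I" "set v \<subseteq> I"
  shows "ad (rnc u) (rnc v) \<in> pvs.span {rnc w | w. set w \<subseteq> I \<and> length w = length u + length v}"
    (is "_ \<in> pvs.span (?W (length u + length v))")
  using assms
proof (induction u arbitrary: v rule: rnc.induct)
  case 1
  then show ?case by (simp add: ad_def pvs.span_zero)
next
  case (2 i)
  show ?case
  proof (cases "v = []")
    case True
    then show ?thesis by (simp add: ad_def pvs.span_zero)
  next
    case False
    then have *: "ad (rnc [i]) (rnc v) = rnc (i # v)"
      by (simp add: rnc_Cons)
    show ?thesis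
      unfolding * using 2 by (intro pvs.span_base CollectI exI[of _ "i # v"]) simp
  qed
next
  case (3 i j w)
  let ?x = "rnc (j # w)" and ?n = "length (i # j # w) + length v"
  have step: "ad (gen i) y \<in> pvs.span (?W (Suc n))" if "y \<in> pvs.span (?W n)" "n \<noteq> 0" for y n
  proof (rule klinear_span_subset[OF klinear_ad that(1)])
    fix z assume "z \<in> ?W n"
    then obtain u where u: "z = rnc u" "set u \<subseteq> I" "length u = n"
      by blast
    then have "ad (gen i) z = rnc (i # u)"
      using that(2) by (auto simp: rnc_Cons)
    then show "ad (gen i) z \<in> pvs.span (?W (Suc n))"
      using u 3 by (intro pvs.span_base CollectI exI[of _ "i # u"]) simp
  qed (rule pvs.subspace_span)
  have "ad (gen i) (ad ?x (rnc v)) \<in> pvs.span (?W (Suc (length (j # w) + length v)))"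
    using 3 by (intro step) auto
  moreover have "ad ?x (ad (gen i) (rnc v)) \<in> pvs.span (?W ?n)"
  proof (cases "v = []")
    case True
    then show ?thesis by (simp add: ad_def pvs.span_zero)
  next
    case False
    then have *: "ad (gen i) (rnc v) = rnc (i # v)"
      by (simp add: rnc_Cons)
    show ?thesis
      unfolding * using 3(1)[of "i # v"] 3(2,3) by simp
  qed
  moreover have *: "ad (rnc (i # j # w)) (rnc v) = ad (gen i) (ad ?x (rnc v)) - ad ?x (ad (gen i) (rnc v))"
    by (simp add: ad_def algebra_simps)
  ultimately show ?case
    unfolding * by (intro pvs.span_diff) simp_all
qed

end

text \<open>The family \<open>X\<close> spans each degree of the Lie algebra modulo
  \<open>N\<close>, possibly with redundancy. Its members are commutators \<open>rnc w\<close>, so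
  that brackets of members expand in the family again.\<close>

locale pbw = serre I a field_type
  for I :: "'i set" and a and field_type :: "'k::field_char_0 itself" +
  fixes X :: "nat \<Rightarrow> ('i free_monoid \<Rightarrow>\<^sub>0 'k)" and K :: "nat set"
  assumes X_lie: "n \<in> K \<Longrightarrow> \<exists>w. X n = rnc w \<and> set w \<subseteq> I \<and> length w = key_deg n"
    and X_span: "set w \<subseteq> I \<Longrightarrow> rnc w \<in> pvs.span (X ` {n \<in> K. key_deg n = length w} \<union> N)"
    and K_pos: "n \<in> K \<Longrightarrow> key_deg n \<ge> 1"
begin

definition pr :: "nat list \<Rightarrow> ('i free_monoid \<Rightarrow>\<^sub>0 'k)" where
  "pr ks = prod_list (map X ks)"

abbreviation wt :: "nat list \<Rightarrow> nat" where
  "wt ks \<equiv> sum_list (map key_deg ks)"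

text \<open>The strict bound makes \<open>mons (length ks)\<close> the space of error terms for a
  monomial \<open>pr ks\<close>: strictly shorter, of the same degree. For \<open>r = 0\<close> only
  \<open>N\<close> remains.\<close>

definition mons :: "nat \<Rightarrow> nat \<Rightarrow> ('i free_monoid \<Rightarrow>\<^sub>0 'k) set" where
  "mons r l = pvs.span (pr ` {ks. set ks \<subseteq> K \<and> length ks < r \<and> wt ks = l} \<union> N)"

definition sorted_mons :: "nat \<Rightarrow> ('i free_monoid \<Rightarrow>\<^sub>0 'k) set" where
  "sorted_mons l = pvs.span (pr ` {ks. set ks \<subseteq> K \<and> sorted ks \<and> wt ks = l} \<union> N)"

lemma subspace_mons: "pvs.subspace (mons r l)" and subspace_sorted_mons: "pvs.subspace (sorted_mons l)"
  by (simp_all add: mons_def sorted_mons_def pvs.subspace_span)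

lemma N_mons: "x \<in> N \<Longrightarrow> x \<in> mons r l"
  by (simp add: mons_def pvs.span_base)

lemma pr_mons: "set ks \<subseteq> K \<Longrightarrow> length ks < r \<Longrightarrow> pr ks \<in> mons r (wt ks)"
  unfolding mons_def by (rule pvs.span_base) auto

lemma mons_mono: "r \<le> r' \<Longrightarrow> mons r l \<subseteq> mons r' l"
  unfolding mons_def by (rule pvs.span_mono) auto

lemma mult_mons:
  assumes z: "z \<in> pvs.span (X ` {n \<in> K. key_deg n = h} \<union> N)" and y: "y \<in> mons r l"
  shows "z * y \<in> mons (Suc r) (h + l)"
proof (rule klinear_span_subset[OF klinear_mult_right z _ subspace_mons])
  fix x assume x: "x \<in> X ` {n \<in> K. key_deg n = h} \<union> N"
  show "x * y \<in> mons (Suc r) (h + l)"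
  proof (cases "x \<in> N")
    case True
    then show ?thesis
      by (intro N_mons ideal_of_mult_right)
  next
    case False
    then obtain n where n: "x = X n" "n \<in> K" "key_deg n = h"
      using x by blast
    show ?thesis
    proof (rule klinear_span_subset[OF klinear_mult_left y[unfolded mons_def] _ subspace_mons])
      fix v assume "v \<in> pr ` {ks. set ks \<subseteq> K \<and> length ks < r \<and> wt ks = l} \<union> N"
      then consider "v \<in> N" | ks where "v = pr ks" "set ks \<subseteq> K" "length ks < r" "wt ks = l"
        by blast
      then show "x * v \<in> mons (Suc r) (h + l)"
      proof cases
        case 1
        then show ?thesis by (intro N_mons ideal_of_mult_left)
      next
        case 2
        then show ?thesis
          using pr_mons[of "n # ks" "Suc r"] n by (simp add: pr_def)
      qed
    qed
  qed
qed

lemma X_mult_mons: "n \<in> K \<Longrightarrow> y \<in> mons r l \<Longrightarrow> X n * y \<in> mons (Suc r) (key_deg n + l)"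
  by (rule mult_mons[OF pvs.span_base]) blast+

text \<open>The difference is the bracket of two members times the remaining product, hence one
  factor shorter in the same degree.\<close>

lemma pr_swap:
  assumes "m \<in> K" "n \<in> K" "set ks \<subseteq> K"
  shows "pr (m # n # ks) - pr (n # m # ks) \<in> mons (length ks + 2) (key_deg m + key_deg n + wt ks)"
proof -
  obtain u v where uv: "X m = rnc u" "set u \<subseteq> I" "length u = key_deg m"
    "X n = rnc v" "set v \<subseteq> I" "length v = key_deg n"
    using X_lie assms(1,2) by metis
  have "ad (X m) (X n) \<in> pvs.span {rnc w | w. set w \<subseteq> I \<and> length w = key_deg m + key_deg n}"
    using ad_rnc_rnc[OF uv(2,5)] uv by simp
  moreover have "{rnc w | w. set w \<subseteq> I \<and> length w = key_deg m + key_deg n} \<subseteq>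
      pvs.span (X ` {k \<in> K. key_deg k = key_deg m + key_deg n} \<union> N)"
  proof safe
    fix w assume "set w \<subseteq> I" "length w = key_deg m + key_deg n"
    then show "rnc w \<in> pvs.span (X ` {k \<in> K. key_deg k = key_deg m + key_deg n} \<union> N)"
      using X_span[of w] by simp
  qed
  ultimately have "ad (X m) (X n) \<in> pvs.span (X ` {k \<in> K. key_deg k = key_deg m + key_deg n} \<union> N)"
    using pvs.span_minimal[OF _ pvs.subspace_span] by blast
  then have "ad (X m) (X n) * pr ks \<in> mons (Suc (Suc (length ks))) (key_deg m + key_deg n + wt ks)"
    by (rule mult_mons) (use assms(3) in \<open>auto intro: pr_mons\<close>)
  then show ?thesis
    by (simp add: pr_def ad_def algebra_simps)
qed

lemma pr_insort:
  assumes "x \<in> K" "set ks \<subseteq> K"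
  shows "pr (x # ks) - pr (insort x ks) \<in> mons (Suc (length ks)) (key_deg x + wt ks)"
  using assms(2)
proof (induction ks)
  case Nil
  then show ?case
    by (simp add: pvs.subspace_0[OF subspace_mons])
next
  case (Cons y ks)
  show ?case
  proof (cases "x \<le> y")
    case True
    then show ?thesis
      by (simp add: pvs.subspace_0[OF subspace_mons])
  next
    case False
    have "X y * (pr (x # ks) - pr (insort x ks)) \<in> mons (Suc (Suc (length ks))) (key_deg y + (key_deg x + wt ks))"
      using Cons by (intro X_mult_mons) auto
    moreover have "pr (x # y # ks) - pr (y # x # ks) \<in> mons (length ks + 2) (key_deg x + key_deg y + wt ks)"
      using Cons.prems assms(1) by (intro pr_swap) auto
    ultimately have "(pr (x # y # ks) - pr (y # x # ks)) + X y * (pr (x # ks) - pr (insort x ks))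
        \<in> mons (Suc (Suc (length ks))) (key_deg x + key_deg y + wt ks)"
      by (intro pvs.subspace_add[OF subspace_mons]) (simp_all add: add.assoc add.left_commute)
    moreover have "(pr (x # y # ks) - pr (y # x # ks)) + X y * (pr (x # ks) - pr (insort x ks)) =
        pr (x # y # ks) - pr (insort x (y # ks))"
      using False by (simp add: pr_def right_diff_distrib)
    ultimately show ?thesis
      by (simp add: add.assoc)
  qed
qed

lemma wt_sort: "wt (sort ks) = wt ks"
proof -
  have "wt xs = sum_mset (image_mset key_deg (mset xs))" for xs
    by (induction xs) simp_all
  then show ?thesis by simp
qed

lemma pr_sort:
  assumes "set ks \<subseteq> K"
  shows "pr ks - pr (sort ks) \<in> mons (length ks) (wt ks)"
  using assms
proof (induction ks)
  case Nil
  then show ?case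
    by (simp add: pvs.subspace_0[OF subspace_mons])
next
  case (Cons k ks)
  have "X k * (pr ks - pr (sort ks)) \<in> mons (Suc (length ks)) (key_deg k + wt ks)"
    using Cons by (intro X_mult_mons) auto
  moreover have "pr (k # sort ks) - pr (insort k (sort ks)) \<in> mons (Suc (length ks)) (key_deg k + wt ks)"
    using pr_insort[of k "sort ks"] Cons.prems by (simp add: wt_sort)
  ultimately have "X k * (pr ks - pr (sort ks)) + (pr (k # sort ks) - pr (insort k (sort ks)))
      \<in> mons (Suc (length ks)) (key_deg k + wt ks)"
    by (intro pvs.subspace_add[OF subspace_mons])
  then show ?case
    by (simp add: pr_def right_diff_distrib)
qed

text \<open>The spanning half of the Poincare-Birkhoff-Witt theorem: sorting costs only strictly
  shorter monomials, which the induction has already covered.\<close>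

lemma mons_sorted: "mons r l \<subseteq> sorted_mons l"
proof (induction r)
  case 0
  then show ?case
    unfolding mons_def sorted_mons_def by (intro pvs.span_mono) auto
next
  case (Suc r)
  show ?case
    unfolding mons_def[of "Suc r"]
  proof (rule pvs.span_minimal[OF _ subspace_sorted_mons], safe)
    fix ks assume ks: "set ks \<subseteq> K" "length ks < Suc r" "l = wt ks"
    have "pr ks - pr (sort ks) \<in> sorted_mons l"
      using pr_sort[OF ks(1)] mons_mono[of "length ks" r] ks(2,3) Suc by auto
    moreover have "pr (sort ks) \<in> sorted_mons l"
      unfolding sorted_mons_def using ks by (intro pvs.span_base) (auto simp: wt_sort)
    ultimately show "pr ks \<in> sorted_mons (wt ks)"
      using pvs.subspace_add[OF subspace_sorted_mons] ks(3) by fastforce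
  next
    fix x assume "x \<in> N"
    then show "x \<in> sorted_mons l"
      by (simp add: sorted_mons_def pvs.span_base)
  qed
qed

lemma wd_mons: "set w \<subseteq> I \<Longrightarrow> wd w \<in> mons (Suc (length w)) (length w)"
proof (induction w)
  case Nil
  then show ?case
    using pr_mons[of "[]" 1] by (simp add: pr_def)
next
  case (Cons i w)
  have "gen i \<in> pvs.span (X ` {n \<in> K. key_deg n = 1} \<union> N)"
    using X_span[of "[i]"] Cons.prems by simp
  from mult_mons[OF this Cons.IH] show ?case
    using Cons.prems by (simp add: wd_Cons)
qed

lemma wd_sorted_mons: "set w \<subseteq> I \<Longrightarrow> wd w \<in> sorted_mons (length w)"
  using wd_mons mons_sorted by blast

lemma sorted_mons_count:
  assumes c: "\<And>n. n \<in> K \<Longrightarrow> snd (prod_decode n) < c (key_deg n)"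
  shows "\<exists>Z. finite Z \<and> card Z \<le> pbw_count c l \<and> sorted_mons l \<subseteq> pvs.span (Z \<union> N)"
proof -
  let ?L = "{ks. set ks \<subseteq> K \<and> sorted ks \<and> wt ks = l}"
  have wt: "wt xs = sum_mset (image_mset key_deg (mset xs))" for xs
    by (induction xs) simp_all
  have inj: "inj_on mset ?L"
    by (rule inj_onI) (metis (mono_tags, lifting) mem_Collect_eq sorted_list_of_multiset_mset sorted_sort_id)
  have sub: "mset ` ?L \<subseteq> weighted_multisets key_deg (keys_upto c l) l"
  proof safe
    fix ks assume ks: "set ks \<subseteq> K" "l = wt ks"
    have "key_deg n \<le> wt ks" if "n \<in> set ks" for n
      using that by (induction ks) auto
    then show "mset ks \<in> weighted_multisets key_deg (keys_upto c (wt ks)) (wt ks)"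
      using ks K_pos c by (auto simp: weighted_multisets_def keys_upto_def wt)
  qed
  have "finite (keys_upto c l)"
    by (simp add: keys_upto_eq)
  then have fin: "finite (weighted_multisets key_deg (keys_upto c l) l)"
    using weighted_multisets_bound[of "keys_upto c l" key_deg "1 / 2" l] by (auto simp: keys_upto_def)
  have finL: "finite ?L"
    using inj_on_finite[OF inj sub fin] .
  have "card (pr ` ?L) \<le> card ?L"
    using finL by (rule card_image_le)
  also have "\<dots> \<le> pbw_count c l"
    unfolding pbw_count_def by (rule card_inj_on_le[OF inj sub fin])
  finally show ?thesis
    using finL by (intro exI[of _ "pr ` ?L"]) (simp add: sorted_mons_def)
qed

end

section \<open>The growth bound, expressed by words\<close>

context serre_affine
begin

definition growth :: "nat \<Rightarrow> nat" where
  "growth = pbw_count (\<lambda>h. (card I + 1) * (h + 1) ^ card I)"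

lemma subexponential_growth: "subexponential growth"
  unfolding growth_def by (rule subexponential_pbw_count) (rule order.refl)

theorem words_spanned:
  "\<exists>S\<subseteq>{w. set w \<subseteq> I \<and> length w = l}. finite S \<and> card S \<le> growth l \<and>
     wd ` {w. set w \<subseteq> I \<and> length w = l} \<subseteq> pvs.span (wd ` S \<union> N)"
proof -
  let ?W = "\<lambda>h. {rnc w | w. set w \<subseteq> I \<and> length w = h}"
  let ?c = "\<lambda>h. (card I + 1) * (h + 1) ^ card I"
  \<comment> \<open>The spanning Lie elements are selected among the commutators, as
    \<open>ad_rnc_rnc\<close> requires.\<close>
  have "\<exists>S. S \<subseteq> ?W h \<and> finite S \<and> card S \<le> ?c h \<and> ?W h \<subseteq> pvs.span (S \<union> N)" for h
  proof -
    obtain S where S: "finite S" "card S \<le> ?c h" "?W h \<subseteq> pvs.span (S \<union> N)"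
      using height_multiplicity_bound by blast
    then show ?thesis
      using pvs.spanning_subset_mod[OF S(1,3)] by (meson le_trans)
  qed
  from choice[OF allI, OF this]
  obtain S where "\<forall>h. S h \<subseteq> ?W h \<and> finite (S h) \<and> card (S h) \<le> ?c h \<and> ?W h \<subseteq> pvs.span (S h \<union> N)" ..
  then have S: "\<And>h. S h \<subseteq> ?W h" "\<And>h. finite (S h)" "\<And>h. card (S h) \<le> ?c h"
    "\<And>h. ?W h \<subseteq> pvs.span (S h \<union> N)"
    by simp_all
  have "\<exists>g. bij_betw g {0..<card (S h)} (S h)" for h
    using S(2) by (rule ex_bij_betw_nat_finite)
  then obtain g where g: "\<And>h. bij_betw (g h) {0..<card (S h)} (S h)"
    by metis
  define X where "X n = g (key_deg n) (snd (prod_decode n))" for n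
  define K where "K = {n. 1 \<le> key_deg n \<and> snd (prod_decode n) < card (S (key_deg n))}"
  have X: "X n \<in> S (key_deg n)" if "n \<in> K" for n
    using bij_betwE[OF g, of "key_deg n"] that by (auto simp: X_def K_def)
  interpret pbw I a field_type X K
  proof
    show "\<exists>w. X n = rnc w \<and> set w \<subseteq> I \<and> length w = key_deg n" if "n \<in> K" for n
      using X[OF that] S(1) by blast
    show "1 \<le> key_deg n" if "n \<in> K" for n
      using that by (simp add: K_def)
    show "rnc w \<in> pvs.span (X ` {n \<in> K. key_deg n = length w} \<union> N)" if w: "set w \<subseteq> I" for w
    proof (cases "w = []")
      case True
      then show ?thesis by (simp add: pvs.span_zero)
    next
      case False
      have "S (length w) \<subseteq> X ` {n \<in> K. key_deg n = length w}"
      proof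
        fix x assume "x \<in> S (length w)"
        then obtain k where k: "k < card (S (length w))" "x = g (length w) k"
          using bij_betw_imp_surj_on[OF g, of "length w"] by force
        then show "x \<in> X ` {n \<in> K. key_deg n = length w}"
          using False
          by (intro image_eqI[of _ _ "prod_encode (length w, k)"])
            (auto simp: X_def K_def key_deg_def Suc_le_eq)
      qed
      then show ?thesis
        using S(4)[of "length w"] w pvs.span_mono[OF Un_mono[OF _ subset_refl]] by blast
    qed
  qed
  obtain Z where Z: "finite Z" "card Z \<le> pbw_count ?c l" "sorted_mons l \<subseteq> pvs.span (Z \<union> N)"
    using sorted_mons_count[of ?c l] S(3) by (auto simp: K_def intro: less_le_trans)
  let ?V = "{w. set w \<subseteq> I \<and> length w = l}"
  have VZ: "wd ` ?V \<subseteq> pvs.span (Z \<union> N)"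
    using wd_sorted_mons Z(3) by blast
  \<comment> \<open>Back from ordered monomials to words, which can be carried to another
    coefficient field.\<close>
  obtain Z' where Z': "Z' \<subseteq> wd ` ?V" "finite Z'" "card Z' \<le> card Z" "wd ` ?V \<subseteq> pvs.span (Z' \<union> N)"
    using pvs.spanning_subset_mod[OF Z(1) VZ] by (elim exE conjE)
  obtain U where "U \<subseteq> ?V" "inj_on (wd :: _ \<Rightarrow> 'i free_monoid \<Rightarrow>\<^sub>0 'k) U" "Z' = wd ` U"
    using Z'(1)[unfolded subset_image_inj] by (elim exE conjE)
  then show ?thesis
    using Z' Z(2) by (intro exI[of _ U]) (simp add: growth_def card_image finite_image_iff)
qed

end

section \<open>The local ring at q = 1 and q-binomial coefficients\<close>

section \<open>Specialization at \<open>q = 1\<close>\<close>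

text \<open>Membership in the local ring at the point 1, with the value there. The polynomial
  variable is \<open>q_root\<close>, a root of q, so the point is q = 1. A relation avoids choosing
  fractions; uniqueness of the value enters through \<open>regular_at_1_0\<close>.\<close>

definition regular_at_1 :: "rat poly fract \<Rightarrow> rat \<Rightarrow> bool" where
  "regular_at_1 x c \<longleftrightarrow> (\<exists>p r. x = Fract p r \<and> poly r 1 \<noteq> 0 \<and> c = poly p 1 / poly r 1)"

lemma regular_at_1_0: "regular_at_1 0 c \<Longrightarrow> c = 0"
proof -
  assume "regular_at_1 0 c"
  then obtain p r where r: "Fract 0 1 = Fract p r" "poly r 1 \<noteq> 0" "c = poly p 1 / poly r 1"
    by (auto simp: regular_at_1_def Zero_fract_def)
  then have "r \<noteq> 0"
    by auto
  then show ?thesis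
    using r by (simp add: eq_fract)
qed

lemma regular_at_1_poly: "regular_at_1 (Fract p 1) (poly p 1)"
  unfolding regular_at_1_def by (intro exI[of _ p] exI[of _ 1]) simp

lemma regular_at_1_of_0: "regular_at_1 0 0" and regular_at_1_1: "regular_at_1 1 1"
  using regular_at_1_poly[of 0] regular_at_1_poly[of 1] by (simp_all add: Zero_fract_def One_fract_def)

lemma regular_at_1_add:
  assumes "regular_at_1 x b" "regular_at_1 y c"
  shows "regular_at_1 (x + y) (b + c)"
proof -
  obtain p r where x: "x = Fract p r" "poly r 1 \<noteq> 0" "b = poly p 1 / poly r 1"
    using assms(1) by (auto simp: regular_at_1_def)
  obtain p' r' where y: "y = Fract p' r'" "poly r' 1 \<noteq> 0" "c = poly p' 1 / poly r' 1"
    using assms(2) by (auto simp: regular_at_1_def)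
  have "r \<noteq> 0" "r' \<noteq> 0"
    using x(2) y(2) by auto
  then have "x + y = Fract (p * r' + p' * r) (r * r')"
    by (simp add: x(1) y(1))
  moreover have "b + c = poly (p * r' + p' * r) 1 / poly (r * r') 1"
    using x(2) y(2) by (simp add: x(3) y(3) field_simps)
  ultimately show ?thesis
    unfolding regular_at_1_def using x(2) y(2)
    by (intro exI[of _ "p * r' + p' * r"] exI[of _ "r * r'"]) simp
qed

lemma regular_at_1_mult:
  assumes "regular_at_1 x b" "regular_at_1 y c"
  shows "regular_at_1 (x * y) (b * c)"
proof -
  obtain p r where x: "x = Fract p r" "poly r 1 \<noteq> 0" "b = poly p 1 / poly r 1"
    using assms(1) by (auto simp: regular_at_1_def)
  obtain p' r' where y: "y = Fract p' r'" "poly r' 1 \<noteq> 0" "c = poly p' 1 / poly r' 1"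
    using assms(2) by (auto simp: regular_at_1_def)
  show ?thesis
    unfolding regular_at_1_def using x y
    by (intro exI[of _ "p * p'"] exI[of _ "r * r'"]) simp
qed

lemma regular_at_1_uminus: "regular_at_1 x b \<Longrightarrow> regular_at_1 (- x) (- b)"
  using regular_at_1_mult[OF regular_at_1_poly[of "- 1"], of x b]
  by (simp add: One_fract_def[symmetric] flip: minus_fract)

lemma regular_at_1_inverse:
  assumes "regular_at_1 x b" "b \<noteq> 0"
  shows "regular_at_1 (inverse x) (inverse b)"
proof -
  obtain p r where x: "x = Fract p r" "poly r 1 \<noteq> 0" "b = poly p 1 / poly r 1"
    using assms(1) by (auto simp: regular_at_1_def)
  then show ?thesis
    unfolding regular_at_1_def using assms(2)
    by (intro exI[of _ r] exI[of _ p]) auto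
qed

lemma regular_at_1_divide:
  "regular_at_1 x b \<Longrightarrow> regular_at_1 y c \<Longrightarrow> c \<noteq> 0 \<Longrightarrow> regular_at_1 (x / y) (b / c)"
  unfolding divide_inverse by (intro regular_at_1_mult regular_at_1_inverse)

lemma regular_at_1_power: "regular_at_1 x b \<Longrightarrow> regular_at_1 (x ^ n) (b ^ n)"
  by (induction n) (auto intro: regular_at_1_1 regular_at_1_mult)

lemma regular_at_1_sum:
  "(\<And>i. i \<in> A \<Longrightarrow> regular_at_1 (f i) (g i)) \<Longrightarrow> regular_at_1 (sum f A) (sum g A)"
  by (induction A rule: infinite_finite_induct)
    (auto intro: regular_at_1_of_0 regular_at_1_add)

lemma regular_at_1_prod:
  "(\<And>i. i \<in> A \<Longrightarrow> regular_at_1 (f i) (g i)) \<Longrightarrow> regular_at_1 (prod f A) (prod g A)"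
  by (induction A rule: infinite_finite_induct)
    (auto intro: regular_at_1_1 regular_at_1_mult)

lemma regular_at_1_q_root: "regular_at_1 q_root 1"
  using regular_at_1_poly[of "[:0, 1:]"] by (simp add: q_root_def)

lemma q_root_power: "q_root ^ n = Fract ([:0, 1:] ^ n) 1"
  by (induction n) (simp_all add: q_root_def One_fract_def)

lemma q_root_nz: "q_root \<noteq> 0"
  by (simp add: q_root_def Zero_fract_def eq_fract)

lemma q_root_power_neq_1:
  assumes "n > 0"
  shows "q_root ^ n \<noteq> 1"
proof
  assume "q_root ^ n = 1"
  then have "[:0, 1 :: rat:] ^ n = 1"
    by (simp add: q_root_power One_fract_def eq_fract)
  then have "degree ([:0, 1 :: rat:] ^ n) = 0"
    by simp
  then show False
    using assms by (simp add: degree_power_eq)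
qed

lemma Fract_power: "Fract (p ^ n) 1 = Fract p 1 ^ n" for p :: "rat poly"
proof (induction n)
  case (Suc n)
  have "Fract (p ^ Suc n) 1 = Fract p 1 * Fract (p ^ n) 1"
    by simp
  then show ?case
    by (simp only: Suc.IH power_Suc)
qed (simp add: One_fract_def)

text \<open>The local ring is a discrete valuation ring with uniformizer \<open>q_root - 1\<close>:
  the order of vanishing at 1 is split off from numerator and denominator.\<close>

lemma adic_decomposition:
  fixes x :: "rat poly fract"
  assumes "x \<noteq> 0"
  shows "\<exists>n :: int. \<exists>u c. x = (q_root - 1) powi n * u \<and> regular_at_1 u c \<and> c \<noteq> 0"
proof -
  let ?\<pi> = "[:- 1, 1 :: rat:]"
  have \<pi>: "q_root - 1 = Fract ?\<pi> 1"
    by (simp add: q_root_def One_fract_def one_pCons)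
  have \<pi>_nz: "q_root - 1 \<noteq> 0"
    using q_root_power_neq_1[of 1] by simp
  have \<pi>_pow: "Fract (?\<pi> ^ n) 1 = (q_root - 1) ^ n" for n
    unfolding \<pi> by (rule Fract_power)
  have poly: "\<exists>n v. Fract p 1 = (q_root - 1) ^ n * v \<and> (\<exists>c. regular_at_1 v c \<and> c \<noteq> 0)"
    if nz: "p \<noteq> 0" for p
  proof -
    obtain p' where p': "p = ?\<pi> ^ order 1 p * p'" "\<not> ?\<pi> dvd p'"
      using order_decomp[OF nz, of 1] by auto
    have "Fract p 1 = (q_root - 1) ^ order 1 p * Fract p' 1"
      by (subst p'(1)) (simp flip: \<pi>_pow)
    moreover have "poly p' 1 \<noteq> 0"
      using p'(2) by (simp add: poly_eq_0_iff_dvd)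
    ultimately show ?thesis
      using regular_at_1_poly by blast
  qed
  obtain p r where pr: "x = Fract p r" "r \<noteq> 0"
    by (cases x) auto
  then have "p \<noteq> 0"
    using assms by (auto simp: Zero_fract_def eq_fract)
  obtain m v c where v: "Fract p 1 = (q_root - 1) ^ m * v" "regular_at_1 v c" "c \<noteq> 0"
    using poly[OF \<open>p \<noteq> 0\<close>] by blast
  obtain n w b where w: "Fract r 1 = (q_root - 1) ^ n * w" "regular_at_1 w b" "b \<noteq> 0"
    using poly[OF pr(2)] by blast
  have "x = Fract p 1 / Fract r 1"
    using pr by simp
  also have "\<dots> = (q_root - 1) powi (int m - int n) * (v / w)"
    using \<pi>_nz by (simp add: v w power_int_diff)
  finally show ?thesis
    using regular_at_1_divide[OF v(2) w(2,3)] v(3) w(3)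
    by (intro exI[of _ "int m - int n"] exI[of _ "v / w"] exI[of _ "c / b"]) simp
qed

text \<open>Dividing by the smallest occurring power of the uniformizer removes all poles and leaves
  a nonzero value where the minimum is attained.\<close>

lemma ex_regular_multiple:
  fixes \<phi> :: "'w \<Rightarrow> rat poly fract"
  assumes "finite A" "w \<in> A" "\<phi> w \<noteq> 0"
  shows "\<exists>s c. (\<forall>w\<in>A. regular_at_1 (s * \<phi> w) (c w)) \<and> (\<exists>w\<in>A. c w \<noteq> 0)"
proof -
  let ?\<pi> = "q_root - 1"
  let ?B = "{w \<in> A. \<phi> w \<noteq> 0}"
  have "\<forall>w. \<exists>n u c. \<phi> w \<noteq> 0 \<longrightarrow> \<phi> w = ?\<pi> powi n * u \<and> regular_at_1 u c \<and> c \<noteq> 0"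
    using adic_decomposition by blast
  then obtain n u c where dec: "\<And>w. \<phi> w \<noteq> 0 \<Longrightarrow>
      \<phi> w = ?\<pi> powi n w * u w \<and> regular_at_1 (u w) (c w) \<and> c w \<noteq> 0"
    by metis
  have B: "finite ?B" "?B \<noteq> {}"
    using assms by auto
  have \<pi>: "?\<pi> \<noteq> 0"
    using q_root_power_neq_1[of 1] by simp
  define m where "m = Min (n ` ?B)"
  have "m \<in> n ` ?B"
    unfolding m_def using B by (intro Min_in) auto
  then obtain w0 where w0: "w0 \<in> ?B" "n w0 = m"
    by blast
  have m: "m \<le> n w" if "w \<in> ?B" for w
    using that B(1) by (simp add: m_def)
  \<comment> \<open>The power of 0 is the value of the remaining power of the uniformizer: 1 where
    the exponent is minimal, 0 elsewhere.\<close>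
  define c' where "c' w = (if \<phi> w = 0 then 0 else 0 ^ nat (n w - m) * c w)" for w
  have "regular_at_1 (?\<pi> powi (- m) * \<phi> w) (c' w)" if "w \<in> A" for w
  proof (cases "\<phi> w = 0")
    case True
    then show ?thesis
      by (simp add: c'_def regular_at_1_of_0)
  next
    case False
    then have "m \<le> n w"
      using m that by blast
    have "?\<pi> powi (- m) * \<phi> w = ?\<pi> powi (- m) * (?\<pi> powi n w * u w)"
      using dec[OF False] by simp
    also have "\<dots> = ?\<pi> powi (- m + n w) * u w"
      by (simp only: power_int_add[OF disjI1[OF \<pi>]] mult.assoc)
    also have "\<dots> = ?\<pi> ^ nat (n w - m) * u w"
      using \<open>m \<le> n w\<close> by (simp add: power_int_def)
    finally have *: "?\<pi> powi (- m) * \<phi> w = ?\<pi> ^ nat (n w - m) * u w" .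
    have "regular_at_1 ?\<pi> 0"
      using regular_at_1_add[OF regular_at_1_q_root regular_at_1_uminus[OF regular_at_1_1]] by simp
    then show ?thesis
      unfolding * c'_def using dec[OF False] False
      by (auto intro: regular_at_1_mult regular_at_1_power)
  qed
  moreover have "c' w0 \<noteq> 0"
    using w0 dec[of w0] by (simp add: c'_def)
  ultimately show ?thesis
    using w0(1) by (intro exI[of _ "?\<pi> powi (- m)"] exI[of _ c']) blast
qed

text \<open>A product of denominators shows that the least common denominator exists. Positivity
  makes \<open>q_sub I d i\<close> a positive power of \<open>q_root\<close>, hence different from
  its inverse.\<close>

lemma scaled_d_pos:
  assumes "finite I" "i \<in> I" "d i > 0"
  shows "scaled_d I d i > 0"
proof -
  let ?P = "\<lambda>n. n > 0 \<and> (\<forall>i\<in>I. of_nat n * d i \<in> \<int>)"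
  have "\<exists>n. ?P n"
    using assms(1)
  proof (induction I rule: finite_induct)
    case empty
    then show ?case by (intro exI[of _ 1]) simp
  next
    case (insert i I)
    then obtain n where n: "n > 0" "\<forall>i\<in>I. of_nat n * d i \<in> \<int>"
      by blast
    obtain p r where r: "quotient_of (d i) = (p, r)"
      by fastforce
    have "r > 0"
      using quotient_of_denom_pos[OF r] .
    have "d i = of_int p / of_int r"
      by (rule quotient_of_div[OF r])
    then have "of_nat (n * nat r) * d i = of_int (int n * p)"
      using \<open>r > 0\<close> by simp
    moreover have "of_nat (n * nat r) * d j \<in> \<int>" if "j \<in> I" for j
    proof -
      have "of_nat (n * nat r) * d j = of_nat (nat r) * (of_nat n * d j)"
        by simp
      also have "\<dots> \<in> \<int>"
        using Ints_mult[OF Ints_of_nat n(2)[rule_format, OF that]] .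
      finally show ?thesis .
    qed
    ultimately have "?case \<longleftrightarrow> True"
      using n(1) \<open>r > 0\<close> by (intro iffI TrueI exI[of _ "n * nat r"]) (auto simp del: of_nat_mult)
    then show ?case by simp
  qed
  then have "?P (common_denom I d)"
    unfolding common_denom_def by (rule LeastI_ex)
  then have cd: "common_denom I d > 0" "of_nat (common_denom I d) * d i \<in> \<int>"
    using assms(2) by auto
  obtain z where z: "of_nat (common_denom I d) * d i = of_int z"
    using cd(2) by (rule Ints_cases)
  have "of_nat (common_denom I d) * d i > 0"
    using cd(1) assms(3) by (intro mult_pos_pos) auto
  then have "z > 0"
    by (simp add: z)
  then show ?thesis
    by (simp add: scaled_d_def z)
qed

text \<open>A recursion without the denominator \<open>v - inverse v\<close>, which vanishes at q =
  1.\<close>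

lemma q_int_Suc:
  assumes "v \<noteq> 0" "v - inverse v \<noteq> 0"
  shows "q_int v (Suc n) = v ^ n + inverse v * q_int v n"
  using assms unfolding q_int_def power_int_minus power_int_of_nat by (simp add: field_simps)

lemma regular_at_1_q_int:
  assumes "v \<noteq> 0" "v - inverse v \<noteq> 0" "regular_at_1 v 1"
  shows "regular_at_1 (q_int v n) (of_nat n)"
proof (induction n)
  case 0
  then show ?case by (simp add: q_int_def regular_at_1_of_0)
next
  case (Suc n)
  have "regular_at_1 (v ^ n + inverse v * q_int v n) (1 ^ n + inverse 1 * of_nat n)"
    by (intro regular_at_1_add regular_at_1_power regular_at_1_mult regular_at_1_inverse assms Suc) simp
  then show ?case
    by (simp add: q_int_Suc[OF assms(1,2)])
qed

lemma regular_at_1_q_binomial: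
  assumes "v \<noteq> 0" "v - inverse v \<noteq> 0" "regular_at_1 v 1" "k \<le> n"
  shows "regular_at_1 (q_binomial v n k) (of_nat (n choose k))"
proof -
  note reg = regular_at_1_q_int[OF assms(1-3)]
  have fact: "(\<Prod>j=1..k. of_nat j :: rat) = fact k"
    by (simp add: fact_prod)
  have "regular_at_1 (q_binomial v n k) ((\<Prod>j<k. of_nat (n - j)) / (\<Prod>j=1..k. of_nat j))"
    unfolding q_binomial_def
    by (intro regular_at_1_divide regular_at_1_prod reg) (simp add: fact)
  also have "(\<Prod>j<k. of_nat (n - j)) / (\<Prod>j=1..k. of_nat j :: rat) = of_nat (n choose k)"
  proof -
    have *: "(\<Prod>i = 0..<k. of_nat (k - i) :: rat) = fact k"
      unfolding fact_prod_rev of_nat_prod ..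
    show ?thesis
      by (simp only: binomial_altdef_of_nat[OF assms(4)] prod_dividef * fact lessThan_atLeast0)
  qed
  finally show ?thesis .
qed

text \<open>Left and right multiplication by \<open>x\<close> commute, so this is the binomial
  theorem. It shows the classical Serre element to be, up to sign, the q-Serre element at q =
  1.\<close>

lemma ad_pow_expand:
  fixes x y :: "'w::monoid_add \<Rightarrow>\<^sub>0 'k::field"
  shows "(ad x ^^ n) y = pscale ((- 1) ^ n)
    (\<Sum>k=0..n. pscale ((- 1) ^ k * of_nat (n choose k)) (x ^ k * y * x ^ (n - k)))"
proof (induction n)
  case 0
  then show ?case by simp
next
  case (Suc n)
  let ?s = "\<lambda>n. \<Sum>k=0..n. pscale ((- 1) ^ k * of_nat (n choose k)) (x ^ k * y * x ^ (n - k))"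
  let ?t = "\<lambda>c k. pscale ((- 1) ^ k * of_nat c) (x ^ k * y * x ^ (Suc n - k))"
  have R: "?s n * x = (\<Sum>k=0..Suc n. ?t (n choose k) k)"
  proof -
    have "?s n * x = (\<Sum>k=0..n. ?t (n choose k) k)"
      unfolding sum_distrib_right
    proof (intro sum.cong refl)
      fix k assume "k \<in> {0..n}"
      then have "x ^ (n - k) * x = x ^ (Suc n - k)"
        by (simp add: Suc_diff_le power_commutes)
      then show "pscale ((- 1) ^ k * of_nat (n choose k)) (x ^ k * y * x ^ (n - k)) * x = ?t (n choose k) k"
        by (simp only: pscale_mult_left mult.assoc)
    qed
    then show ?thesis
      by (simp add: binomial_eq_0)
  qed
  have L: "x * ?s n = - (\<Sum>k=0..Suc n. ?t (if k = 0 then 0 else n choose (k - 1)) k)"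
  proof -
    have "x * ?s n = (\<Sum>k=0..n. - ?t (n choose k) (Suc k))"
      unfolding sum_distrib_left
    proof (intro sum.cong refl)
      fix k
      have "x * (x ^ k * y * x ^ (n - k)) = x ^ Suc k * y * x ^ (Suc n - Suc k)"
        by (simp add: mult.assoc)
      moreover have "(- 1) ^ k * of_nat (n choose k) = - ((- 1) ^ Suc k * of_nat (n choose k) :: 'k)"
        by simp
      ultimately show "x * pscale ((- 1) ^ k * of_nat (n choose k)) (x ^ k * y * x ^ (n - k)) =
          - ?t (n choose k) (Suc k)"
        by (simp only: pscale_mult_right pvs.scale_minus_left mult_minus_right)
    qed
    also have "\<dots> = - (\<Sum>k=0..n. ?t (n choose k) (Suc k))"
      by (rule sum_negf)
    also have "(\<Sum>k=0..n. ?t (n choose k) (Suc k)) = (\<Sum>k=0..Suc n. ?t (if k = 0 then 0 else n choose (k - 1)) k)"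
      by (simp only: sum.atLeast0_atMost_Suc_shift) simp
    finally show ?thesis .
  qed
  have "?s n * x - x * ?s n = (\<Sum>k=0..Suc n. ?t (n choose k) k + ?t (if k = 0 then 0 else n choose (k - 1)) k)"
    unfolding R L sum.distrib by simp
  also have "\<dots> = ?s (Suc n)"
  proof (intro sum.cong refl)
    fix k
    have "Suc n choose k = (n choose k) + (if k = 0 then 0 else n choose (k - 1))"
      by (cases k) (simp_all add: add.commute)
    then show "?t (n choose k) k + ?t (if k = 0 then 0 else n choose (k - 1)) k = ?t (Suc n choose k) k"
      by (simp only: of_nat_add distrib_left pvs.scale_left_distrib)
  qed
  finally have *: "?s (Suc n) = - ad x (?s n)"
    by (simp only: ad_def minus_diff_eq)
  have "(ad x ^^ Suc n) y = pscale ((- 1) ^ n) (ad x (?s n))"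
    by (simp only: funpow.simps o_apply Suc.IH klinear_scale[OF klinear_ad])
  then show ?case
    unfolding * by simp
qed

lemma gen_power: "gen i ^ k = wd (replicate k i)"
  by (induction k) (simp_all add: wd_Cons)

definition q_serre_rel :: "'i set \<Rightarrow> ('i \<Rightarrow> 'i \<Rightarrow> int) \<Rightarrow> ('i \<Rightarrow> rat) \<Rightarrow> ('i free_monoid \<Rightarrow>\<^sub>0 rat poly fract) set" where
  "q_serre_rel I a d = {q_serre (q_sub I d i) (nat (1 - a i j)) (gen i) (gen j) | i j. i \<in> I \<and> j \<in> I \<and> i \<noteq> j}"

text \<open>
  Words spanning the Serre algebra over \<open>\<rat>\<close> also span its quantum version: a functional that
  vanishes on them and on the \<open>q\<close>-Serre relations can be scaled so that it has no pole and is
  nonzero at \<open>q = 1\<close>, and its value there is a functional on the classical algebra.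
\<close>

lemma q_words_spanned:
  assumes I: "finite I" and d: "\<And>i. i \<in> I \<Longrightarrow> d i > 0"
    and S: "S \<subseteq> {w. set w \<subseteq> I \<and> length w = l}"
    and span: "wd ` {w. set w \<subseteq> I \<and> length w = l} \<subseteq>
      pvs.span (wd ` S \<union> (ideal_of (serre_rel I a) :: ('i free_monoid \<Rightarrow>\<^sub>0 rat) set))"
  shows "wd ` {w. set w \<subseteq> I \<and> length w = l} \<subseteq> pvs.span (wd ` S \<union> ideal_of (q_serre_rel I a d))"
proof safe
  let ?A = "{w. set w \<subseteq> I \<and> length w = l}"
  let ?V = "wd ` S \<union> ideal_of (q_serre_rel I a d)"
  fix w0 assume w0: "set w0 \<subseteq> I" "l = length w0"
  show "wd w0 \<in> pvs.span ?V"
  proof (rule ccontr)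
    assume "wd w0 \<notin> pvs.span ?V"
    then obtain \<phi> where \<phi>: "Vector_Spaces.linear pscale (*) \<phi>" "\<And>v. v \<in> ?V \<Longrightarrow> \<phi> v = 0" "\<phi> (wd w0) = 1"
      using pvs.ex_separating_functional by blast
    interpret \<phi>: Vector_Spaces.linear pscale "(*)" \<phi>
      by (rule \<phi>(1))
    have A: "finite ?A"
      using finite_lists_length_eq[OF I, of l] by simp
    have "\<exists>s c. (\<forall>w\<in>?A. regular_at_1 (s * \<phi> (wd w)) (c w)) \<and> (\<exists>w\<in>?A. c w \<noteq> 0)"
      using w0 \<phi>(3) by (intro ex_regular_multiple[OF A, of w0]) auto
    then obtain s c w1 where reg: "\<And>w. w \<in> ?A \<Longrightarrow> regular_at_1 (s * \<phi> (wd w)) (c w)"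
      and w1: "w1 \<in> ?A" "c w1 \<noteq> 0"
      by blast
    \<comment> \<open>The scalars are modelled as functions on \<open>()\<close>, so that the lemmas
      on \<open>klinear\<close> apply to this functional. It is 0 on words outside
      \<open>?A\<close>.\<close>
    define \<psi> where "\<psi> = lin_ext (\<lambda>w. if w \<in> ?A then Poly_Mapping.single () (c w) else 0)"
    have \<psi>: "klinear \<psi>"
      unfolding \<psi>_def by (rule klinear_lin_ext)
    have zero: "\<psi> x \<in> {0}" if "x \<in> wd ` S \<union> ideal_of (serre_rel I a)" for x
      using that
    proof
      assume "x \<in> wd ` S"
      then obtain w where w: "x = wd w" "w \<in> S"
        by blast
      have "w \<in> ?A"
        using w(2) S by blast
      moreover have "c w = 0"
        using reg[OF \<open>w \<in> ?A\<close>] \<phi>(2)[of "wd w"] w(2) regular_at_1_0 by simp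
      ultimately show ?thesis
        by (simp add: w \<psi>_def)
    next
      assume "x \<in> ideal_of (serre_rel I a)"
      then show ?thesis
        unfolding ideal_of_def
      proof (rule klinear_span_subset[OF \<psi>], safe)
        fix u r v assume "(r :: 'i free_monoid \<Rightarrow>\<^sub>0 rat) \<in> serre_rel I a"
        then obtain i j where ij: "i \<in> I" "j \<in> I" "i \<noteq> j"
          and r: "r = (ad (gen i) ^^ nat (1 - a i j)) (gen j)"
          unfolding serre_rel_def by blast
        define n where "n = nat (1 - a i j)"
        define \<omega> where "\<omega> k = u @ replicate k i @ [j] @ replicate (n - k) i @ v" for k
        have wd_\<omega>: "wd u * (gen i ^ k * gen j * gen i ^ (n - k)) * wd v = wd (\<omega> k)" for k
          by (simp only: \<omega>_def gen_power gen_eq_wd[of j] wd_append mult.assoc)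
        have "wd u * r * wd v = pscale ((- 1) ^ n)
            (\<Sum>k=0..n. pscale ((- 1) ^ k * of_nat (n choose k)) (wd (\<omega> k)))"
          by (simp only: r ad_pow_expand flip: n_def)
            (simp only: pscale_mult_left pscale_mult_right sum_distrib_left sum_distrib_right wd_\<omega>)
        then have \<psi>_eq: "\<psi> (wd u * r * wd v) = pscale ((- 1) ^ n)
            (\<Sum>k=0..n. pscale ((- 1) ^ k * of_nat (n choose k)) (\<psi> (wd (\<omega> k))))"
          by (simp only: klinear_scale[OF \<psi>] klinear_sum[OF \<psi>])
        \<comment> \<open>All terms of one relation have the same length and, beyond
          \<open>u\<close> and \<open>v\<close>, only letters of \<open>I\<close>; hence they lie in
          \<open>?A\<close> together or not at all.\<close>
        have len: "length (\<omega> k) = length u + n + 1 + length v" "set (\<omega> k) \<subseteq> I \<longleftrightarrow> set u \<subseteq> I \<and> set v \<subseteq> I"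
          if "k \<le> n" for k
          using that ij by (auto simp: \<omega>_def)
        show "\<psi> (wd u * r * wd v) = 0"
        proof (cases "set u \<subseteq> I \<and> set v \<subseteq> I \<and> length u + n + 1 + length v = l")
          case False
          then have "\<psi> (wd (\<omega> k)) = 0" if "k \<le> n" for k
            using len[OF that] by (auto simp: \<psi>_def)
          then show ?thesis
            by (simp add: \<psi>_eq)
        next
          case True
          then have \<omega>A: "\<omega> k \<in> ?A" if "k \<le> n" for k
            using len[OF that] by simp
          define q where "q = q_sub I d i"
          define m where "m = nat (scaled_d I d i)"
          have m: "m > 0"
            using scaled_d_pos[of I i d] I ij(1) d by (simp add: m_def)
          have q_eq: "q = q_root ^ m"
            using m by (simp add: q_def q_sub_def m_def power_int_def)
          have q: "q \<noteq> 0" "regular_at_1 q 1"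
            using q_root_nz regular_at_1_power[OF regular_at_1_q_root, of m] by (simp_all add: q_eq)
          have "q - inverse q \<noteq> 0"
          proof
            assume "q - inverse q = 0"
            then have "q * q = 1"
              using q(1) by (simp add: field_simps)
            then have "q_root ^ (m + m) = 1"
              by (simp add: q_eq power_add)
            then show False
              using q_root_power_neq_1[of "m + m"] m by simp
          qed
          note binom = regular_at_1_q_binomial[OF q(1) this q(2)]
          have "q_serre q n (gen i) (gen j) \<in> q_serre_rel I a d"
            unfolding q_serre_rel_def q_def n_def using ij by blast
          then have "wd u * q_serre q n (gen i) (gen j) * wd v \<in> ideal_of (q_serre_rel I a d)"
            by (intro ideal_of_mult_left ideal_of_mult_right ideal_of_base)
          then have "\<phi> (wd u * q_serre q n (gen i) (gen j) * wd v) = 0"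
            using \<phi>(2) by blast
          moreover have "wd u * q_serre q n (gen i) (gen j) * wd v =
              (\<Sum>k=0..n. pscale ((- 1) ^ k * q_binomial q n k) (wd (\<omega> k)))"
            unfolding q_serre_def
            by (simp only: pscale_mult_left pscale_mult_right sum_distrib_left sum_distrib_right wd_\<omega>)
          ultimately have "(\<Sum>k=0..n. (- 1) ^ k * q_binomial q n k * \<phi> (wd (\<omega> k))) = 0"
            by (simp add: \<phi>.sum \<phi>.scale)
          \<comment> \<open>After scaling by \<open>s\<close> all terms are regular, and the value
            of this identity at q = 1 is the classical relation for \<open>c\<close>.\<close>
          then have "0 = s * (\<Sum>k=0..n. (- 1) ^ k * q_binomial q n k * \<phi> (wd (\<omega> k)))"
            by simp
          also have "\<dots> = (\<Sum>k=0..n. (- 1) ^ k * q_binomial q n k * (s * \<phi> (wd (\<omega> k))))"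
            unfolding sum_distrib_left by (intro sum.cong refl) (simp only: ac_simps)
          finally have eq: "0 = (\<Sum>k=0..n. (- 1) ^ k * q_binomial q n k * (s * \<phi> (wd (\<omega> k))))" .
          have "regular_at_1 (\<Sum>k=0..n. (- 1) ^ k * q_binomial q n k * (s * \<phi> (wd (\<omega> k))))
              (\<Sum>k=0..n. (- 1) ^ k * of_nat (n choose k) * c (\<omega> k))"
            using \<omega>A
            by (intro regular_at_1_sum regular_at_1_mult regular_at_1_power regular_at_1_uminus
                regular_at_1_1 binom reg) auto
          then have *: "(\<Sum>k=0..n. (- 1) ^ k * of_nat (n choose k) * c (\<omega> k)) = 0"
            unfolding eq[symmetric] by (rule regular_at_1_0)
          have "(\<Sum>k=0..n. pscale ((- 1) ^ k * of_nat (n choose k)) (\<psi> (wd (\<omega> k)))) =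
              (\<Sum>k=0..n. Poly_Mapping.single () ((- 1) ^ k * of_nat (n choose k) * c (\<omega> k)))"
            using \<omega>A by (intro sum.cong refl) (simp add: \<psi>_def)
          also have "\<dots> = Poly_Mapping.single () (\<Sum>k=0..n. (- 1) ^ k * of_nat (n choose k) * c (\<omega> k))"
            by (rule poly_mapping_eqI) (simp add: lookup_sum lookup_single when_def)
          finally show ?thesis
            by (simp add: \<psi>_eq *)
        qed
      qed (rule pvs.subspace_single_0)
    qed
    have "wd w1 \<in> pvs.span (wd ` S \<union> (ideal_of (serre_rel I a) :: ('i free_monoid \<Rightarrow>\<^sub>0 rat) set))"
      using span w1(1) by blast
    then have "\<psi> (wd w1) \<in> {0}"
      by (rule klinear_span_subset[OF \<psi> _ zero pvs.subspace_single_0])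
    then have "Poly_Mapping.single () (c w1) = 0"
      using w1(1) by (simp add: \<psi>_def)
    then have "Poly_Mapping.lookup (Poly_Mapping.single () (c w1)) () = 0"
      by simp
    then show False
      using w1(2) by simp
  qed
qed

section \<open>Ordered products of lowering, Cartan and raising generators\<close>

section \<open>Triangular decomposition\<close>

lemma subexponential_mult:
  assumes "subexponential r" "subexponential s"
  shows "subexponential (\<lambda>m. r m * s m)"
  unfolding subexponential_def
proof (intro allI impI)
  fix t :: real assume t: "0 < t \<and> t < 1"
  \<comment> \<open>Splitting \<open>t\<close> evenly leaves each of the two sequences a parameter
    below 1.\<close>
  define u where "u = sqrt t"
  have u: "0 < u" "u < 1" "t = u * u"
    using t by (auto simp: u_def)
  obtain K L where K: "\<And>m. real (r m) * u ^ m \<le> K" and L: "\<And>m. real (s m) * u ^ m \<le> L"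
    using assms u unfolding subexponential_def by metis
  have "real (r m * s m) * t ^ m \<le> K * L" for m
  proof -
    have "0 \<le> real (r m) * u ^ m" "0 \<le> real (s m) * u ^ m"
      using u by auto
    then have "(real (r m) * u ^ m) * (real (s m) * u ^ m) \<le> K * L"
      using K[of m] L[of m] by (intro mult_mono) auto
    then show ?thesis
      by (simp add: u(3) power_mult_distrib mult.assoc mult.left_commute)
  qed
  then show "\<exists>K. \<forall>m. real (r m * s m) * t ^ m \<le> K"
    by blast
qed

lemma subexponential_poly: "subexponential (\<lambda>m. (m + 1) ^ n)"
  unfolding subexponential_def
proof (intro allI impI)
  fix t :: real assume t: "0 < t \<and> t < 1"
  then have "(\<lambda>m. (real m + 1) ^ n * t ^ m) \<longlonglongrightarrow> 0"
    by (intro summable_LIMSEQ_zero summable_poly_geometric) simp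
  then have "Bseq (\<lambda>m. (real m + 1) ^ n * t ^ m)"
    by (intro convergent_imp_Bseq convergentI)
  then obtain K where K: "\<And>m. norm ((real m + 1) ^ n * t ^ m) \<le> K"
    by (auto simp: Bseq_def)
  have "real ((m + 1) ^ n) * t ^ m \<le> K" for m
    using K[of m] by (simp add: add.commute)
  then show "\<exists>K. \<forall>m. real ((m + 1) ^ n) * t ^ m \<le> K"
    by blast
qed

text \<open>The sum is at most \<open>m + 1\<close> times the maximum. The maximum is attained at
  some \<open>l \<le> m\<close>, and \<open>t ^ m \<le> t ^ l\<close>.\<close>

lemma subexponential_partial_sums:
  assumes "subexponential s"
  shows "subexponential (\<lambda>m. \<Sum>l\<le>m. s l)"
proof -
  define b where "b m = Max (s ` {..m})" for m
  have b: "s l \<le> b m" if "l \<le> m" for l m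
    using that by (simp add: b_def)
  have "subexponential b"
    unfolding subexponential_def
  proof (intro allI impI)
    fix t :: real assume t: "0 < t \<and> t < 1"
    then obtain K where K: "\<And>m. real (s m) * t ^ m \<le> K"
      using assms unfolding subexponential_def by metis
    have "real (b m) * t ^ m \<le> K" for m
    proof -
      have "b m \<in> s ` {..m}"
        unfolding b_def by (rule Max_in) auto
      then obtain l where l: "l \<le> m" "b m = s l"
        by auto
      then have "real (b m) * t ^ m \<le> real (s l) * t ^ l"
        using t by (simp add: mult_left_mono power_decreasing)
      then show ?thesis
        using K[of l] by simp
    qed
    then show "\<exists>K. \<forall>m. real (b m) * t ^ m \<le> K"
      by blast
  qed
  then have "subexponential (\<lambda>m. (m + 1) ^ 1 * b m)"
    by (intro subexponential_mult subexponential_poly)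
  moreover have "(\<Sum>l\<le>m. s l) \<le> (m + 1) ^ 1 * b m" for m
    using sum_bounded_above[of "{..m}" s "b m"] b by simp
  ultimately show ?thesis
    unfolding subexponential_def
    by (meson dual_order.trans less_imp_le mult_right_mono of_nat_mono zero_le_power)
qed

text \<open>\<open>C\<close> and \<open>N\<close> stand for the algebra \<open>C / N\<close>: a
  subalgebra of the free algebra and a two-sided ideal of it.\<close>

locale algebra_mod =
  fixes C N :: "('g free_monoid \<Rightarrow>\<^sub>0 'k::field) set"
  assumes subspace_C: "pvs.subspace C" and subspace_N: "pvs.subspace N" and N_C: "N \<subseteq> C"
    and C_1: "1 \<in> C" and C_mult: "x \<in> C \<Longrightarrow> y \<in> C \<Longrightarrow> x * y \<in> C"
    and N_left: "x \<in> N \<Longrightarrow> y \<in> C \<Longrightarrow> y * x \<in> N"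
    and N_right: "x \<in> N \<Longrightarrow> y \<in> C \<Longrightarrow> x * y \<in> N"
begin

lemma prod_list_C: "set xs \<subseteq> C \<Longrightarrow> prod_list xs \<in> C"
  by (induction xs) (auto simp: C_1 C_mult)

definition filt :: "('g free_monoid \<Rightarrow>\<^sub>0 'k) set \<Rightarrow> nat \<Rightarrow> ('g free_monoid \<Rightarrow>\<^sub>0 'k) set" where
  "filt X m = pvs.span (prod_list ` {xs. set xs \<subseteq> X \<and> length xs \<le> m} \<union> N)"

lemma subspace_filt: "pvs.subspace (filt X m)"
  by (simp add: filt_def pvs.subspace_span)

lemma filt_mono: "m \<le> n \<Longrightarrow> filt X m \<subseteq> filt X n"
  unfolding filt_def by (rule pvs.span_mono) auto

lemma N_filt: "N \<subseteq> filt X m"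
  unfolding filt_def using pvs.span_superset by blast

lemma prod_list_filt: "set xs \<subseteq> X \<Longrightarrow> length xs \<le> m \<Longrightarrow> prod_list xs \<in> filt X m"
  unfolding filt_def by (rule pvs.span_base) auto

lemma one_filt: "1 \<in> filt X m"
  using prod_list_filt[of "[]"] by simp

lemma filt_C: "X \<subseteq> C \<Longrightarrow> filt X m \<subseteq> C"
  unfolding filt_def using N_C by (intro pvs.span_minimal subspace_C) (auto intro: prod_list_C)

lemma filt_mult:
  assumes X: "X \<subseteq> C" and x: "x \<in> filt X m" and y: "y \<in> filt X n"
  shows "x * y \<in> filt X (m + n)"
proof (rule klinear_span_subset[OF klinear_mult_right x[unfolded filt_def] _ subspace_filt])
  fix z assume z: "z \<in> prod_list ` {xs. set xs \<subseteq> X \<and> length xs \<le> m} \<union> N"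
  show "z * y \<in> filt X (m + n)"
  proof (cases "z \<in> N")
    case True
    then show ?thesis
      using N_right N_filt filt_C[OF X] y by blast
  next
    case False
    then obtain xs where xs: "z = prod_list xs" "set xs \<subseteq> X" "length xs \<le> m"
      using z by blast
    show ?thesis
    proof (rule klinear_span_subset[OF klinear_mult_left y[unfolded filt_def] _ subspace_filt])
      fix v assume "v \<in> prod_list ` {xs. set xs \<subseteq> X \<and> length xs \<le> n} \<union> N"
      then consider "v \<in> N" | ys where "v = prod_list ys" "set ys \<subseteq> X" "length ys \<le> n"
        by blast
      then show "z * v \<in> filt X (m + n)"
      proof cases
        case 1
        have "z \<in> C"
          unfolding xs(1) using xs(2) X by (intro prod_list_C) auto
        then show ?thesis
          using 1 N_left N_filt by blast
      next
        case 2
        then show ?thesis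
          using prod_list_filt[of "xs @ ys"] xs by simp
      qed
    qed
  qed
qed

lemma Union_filt_subspace: "pvs.subspace (\<Union>m. filt X m)"
proof (rule pvs.subspaceI)
  show "0 \<in> (\<Union>m. filt X m)"
    using pvs.subspace_0[OF subspace_filt] by blast
next
  fix x y assume "x \<in> (\<Union>m. filt X m)" "y \<in> (\<Union>m. filt X m)"
  then obtain m n where "x \<in> filt X m" "y \<in> filt X n"
    by blast
  then have "x \<in> filt X (max m n)" "y \<in> filt X (max m n)"
    using filt_mono[of m "max m n"] filt_mono[of n "max m n"] by auto
  then show "x + y \<in> (\<Union>m. filt X m)"
    using pvs.subspace_add[OF subspace_filt] by blast
next
  fix c x assume "x \<in> (\<Union>m. filt X m)"
  then show "pscale c x \<in> (\<Union>m. filt X m)"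
    using pvs.subspace_scale[OF subspace_filt] by blast
qed

lemma Union_filt_mult:
  "X \<subseteq> C \<Longrightarrow> x \<in> (\<Union>m. filt X m) \<Longrightarrow> y \<in> (\<Union>m. filt X m) \<Longrightarrow> x * y \<in> (\<Union>m. filt X m)"
  by (elim UN_E) (rule UN_I[OF UNIV_I], rule filt_mult)

end

text \<open>The two scalars in \<open>hf\<close> and \<open>eh\<close> cover both applications:
  \<open>c' = 0\<close> for q-commutation with the group-like elements, \<open>c = 1\<close> for
  brackets with the Cartan subalgebra. \<open>Hs\<close> is finite but large enough to express the
  commutators in \<open>ef\<close>.\<close>

locale triangular = algebra_mod C N
  for C N :: "('g free_monoid \<Rightarrow>\<^sub>0 'k::field) set" +
  fixes I :: "'i set" and Hs :: "'h set"
    and e f :: "'i \<Rightarrow> ('g free_monoid \<Rightarrow>\<^sub>0 'k)" and h :: "'h \<Rightarrow> ('g free_monoid \<Rightarrow>\<^sub>0 'k)"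
  assumes finite_Hs: "finite Hs"
    and e_C: "i \<in> I \<Longrightarrow> e i \<in> C" and f_C: "i \<in> I \<Longrightarrow> f i \<in> C" and h_C: "b \<in> Hs \<Longrightarrow> h b \<in> C"
    and ef: "i \<in> I \<Longrightarrow> j \<in> I \<Longrightarrow> e i * f j - f j * e i \<in> pvs.span (h ` Hs \<union> N)"
    and hf: "b \<in> Hs \<Longrightarrow> i \<in> I \<Longrightarrow>
      \<exists>c c'. h b * f i - pscale c (f i * h b) - pscale c' (f i) \<in> N"
    and eh: "b \<in> Hs \<Longrightarrow> i \<in> I \<Longrightarrow>
      \<exists>c c'. e i * h b - pscale c (h b * e i) - pscale c' (e i) \<in> N"
    and hh: "b \<in> Hs \<Longrightarrow> b' \<in> Hs \<Longrightarrow> h b * h b' - h b' * h b \<in> N"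
begin

definition pl :: "('j \<Rightarrow> ('g free_monoid \<Rightarrow>\<^sub>0 'k)) \<Rightarrow> 'j list \<Rightarrow> ('g free_monoid \<Rightarrow>\<^sub>0 'k)" where
  "pl g xs = prod_list (map g xs)"

lemma pl_simps [simp]: "pl g [] = 1" "pl g (x # xs) = g x * pl g xs"
  by (simp_all add: pl_def)

lemma pl_C: "set u \<subseteq> I \<Longrightarrow> pl e u \<in> C" "set u \<subseteq> I \<Longrightarrow> pl f u \<in> C" "set v \<subseteq> Hs \<Longrightarrow> pl h v \<in> C"
  unfolding pl_def by (rule prod_list_C; auto simp: e_C f_C h_C)+

definition mon :: "'i list \<Rightarrow> 'h list \<Rightarrow> 'i list \<Rightarrow> ('g free_monoid \<Rightarrow>\<^sub>0 'k)" where
  "mon u v w = pl f u * (pl h v * pl e w)"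

text \<open>Monomials in the order \<open>f\<close>, \<open>h\<close>, \<open>e\<close>, filtered by
  total length. The commutation rules never increase the length, so this filtration contains
  \<open>filt\<close>.\<close>

definition tri :: "nat \<Rightarrow> ('g free_monoid \<Rightarrow>\<^sub>0 'k) set" where
  "tri m = pvs.span ({mon u v w | u v w. set u \<subseteq> I \<and> set v \<subseteq> Hs \<and> set w \<subseteq> I \<and>
     length u + length v + length w \<le> m} \<union> N)"

lemma subspace_tri: "pvs.subspace (tri m)"
  by (simp add: tri_def pvs.subspace_span)

lemma N_tri: "x \<in> N \<Longrightarrow> x \<in> tri m"
  by (simp add: tri_def pvs.span_base)

lemma mon_tri:
  "set u \<subseteq> I \<Longrightarrow> set v \<subseteq> Hs \<Longrightarrow> set w \<subseteq> I \<Longrightarrow> length u + length v + length w \<le> m \<Longrightarrow> mon u v w \<in> tri m"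
  unfolding tri_def by (rule pvs.span_base) blast

lemma mon_C: "set u \<subseteq> I \<Longrightarrow> set v \<subseteq> Hs \<Longrightarrow> set w \<subseteq> I \<Longrightarrow> mon u v w \<in> C"
  unfolding mon_def by (intro C_mult pl_C)

lemma tri_mono: "m \<le> n \<Longrightarrow> tri m \<subseteq> tri n"
  unfolding tri_def by (rule pvs.span_mono) fastforce

lemma tri_left:
  assumes "x \<in> C" and y: "y \<in> tri m"
    and "\<And>u v w. set u \<subseteq> I \<Longrightarrow> set v \<subseteq> Hs \<Longrightarrow> set w \<subseteq> I \<Longrightarrow> length u + length v + length w \<le> m \<Longrightarrow>
      x * mon u v w \<in> tri n"
  shows "x * y \<in> tri n"
  by (rule klinear_span_subset[OF klinear_mult_left y[unfolded tri_def] _ subspace_tri])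
    (use assms N_left N_tri in blast)

lemma f_tri:
  assumes "i \<in> I" "y \<in> tri m"
  shows "f i * y \<in> tri (Suc m)"
proof (rule tri_left[OF f_C assms(2)])
  fix u v w assume "set u \<subseteq> I" "set v \<subseteq> Hs" "set w \<subseteq> I" "length u + length v + length w \<le> m"
  then show "f i * mon u v w \<in> tri (Suc m)"
    using mon_tri[of "i # u" v w] assms(1) by (simp add: mon_def mult.assoc)
qed (rule assms(1))

text \<open>Induction on the \<open>f\<close>-part: moving \<open>h b\<close> past one
  \<open>f i\<close> gives a scaled swap and a term without \<open>h b\<close>.\<close>

lemma h_mon:
  assumes b: "b \<in> Hs" and "set u \<subseteq> I" "set v \<subseteq> Hs" "set w \<subseteq> I"
  shows "h b * mon u v w \<in> tri (Suc (length u + length v + length w))"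
  using assms(2)
proof (induction u)
  case Nil
  then show ?case
    using mon_tri[of "[]" "b # v" w] assms by (simp add: mon_def mult.assoc)
next
  case (Cons i u)
  let ?r = "mon u v w" and ?m = "length (i # u) + length v + length w"
  have i: "i \<in> I" and u: "set u \<subseteq> I"
    using Cons.prems by auto
  obtain c c' where c: "h b * f i - pscale c (f i * h b) - pscale c' (f i) \<in> N"
    using hf[OF b i] by blast
  have "(h b * f i - pscale c (f i * h b) - pscale c' (f i)) * ?r \<in> tri (Suc ?m)"
    using u assms by (intro N_tri N_right[OF c] mon_C)
  moreover have "pscale c (f i * (h b * ?r)) \<in> tri (Suc ?m)"
    using f_tri[OF i Cons.IH[OF u]] by (intro pvs.subspace_scale[OF subspace_tri]) simp
  moreover have "pscale c' (f i * ?r) \<in> tri (Suc ?m)"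
    using f_tri[OF i mon_tri[OF u assms(3,4) order.refl]] tri_mono[of ?m "Suc ?m"]
    by (intro pvs.subspace_scale[OF subspace_tri]) auto
  ultimately have "(h b * f i - pscale c (f i * h b) - pscale c' (f i)) * ?r +
      pscale c (f i * (h b * ?r)) + pscale c' (f i * ?r) \<in> tri (Suc ?m)"
    by (intro pvs.subspace_add[OF subspace_tri])
  also have "(h b * f i - pscale c (f i * h b) - pscale c' (f i)) * ?r +
      pscale c (f i * (h b * ?r)) + pscale c' (f i * ?r) = h b * mon (i # u) v w"
    by (simp add: mon_def left_diff_distrib pscale_mult_left mult.assoc)
  finally show ?case .
qed

lemma h_tri:
  assumes "b \<in> Hs" "y \<in> tri m"
  shows "h b * y \<in> tri (Suc m)"
proof (rule tri_left[OF h_C assms(2)])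
  fix u v w assume *: "set u \<subseteq> I" "set v \<subseteq> Hs" "set w \<subseteq> I" "length u + length v + length w \<le> m"
  show "h b * mon u v w \<in> tri (Suc m)"
    using h_mon[OF assms(1) *(1-3)] tri_mono[of "Suc (length u + length v + length w)" "Suc m"] *(4) by auto
qed (rule assms(1))

lemma span_h_tri:
  assumes x: "x \<in> pvs.span (h ` Hs \<union> N)" and y: "y \<in> tri m" "y \<in> C"
  shows "x * y \<in> tri (Suc m)"
proof (rule klinear_span_subset[OF klinear_mult_right x _ subspace_tri])
  fix z assume "z \<in> h ` Hs \<union> N"
  then show "z * y \<in> tri (Suc m)"
    using h_tri y N_right N_tri by blast
qed

text \<open>\<open>e i\<close> first passes the \<open>f\<close>-part, each commutator being a
  combination of single \<open>h b\<close>, and then the \<open>h\<close>-part by the inner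
  induction.\<close>

lemma e_mon:
  assumes i: "i \<in> I" and u: "set u \<subseteq> I" and v: "set v \<subseteq> Hs" and w: "set w \<subseteq> I"
  shows "e i * mon u v w \<in> tri (Suc (length u + length v + length w))"
  using u
proof (induction u)
  case Nil
  show ?case
    using v
  proof (induction v)
    case Nil
    then show ?case
      using mon_tri[of "[]" "[]" "i # w"] i w by (simp add: mon_def)
  next
    case (Cons b v)
    let ?r = "mon [] v w" and ?m = "length ([] :: 'i list) + length (b # v) + length w"
    have b: "b \<in> Hs" and v: "set v \<subseteq> Hs"
      using Cons.prems by auto
    obtain c c' where c: "e i * h b - pscale c (h b * e i) - pscale c' (e i) \<in> N"
      using eh[OF b i] by blast
    have "(e i * h b - pscale c (h b * e i) - pscale c' (e i)) * ?r \<in> tri (Suc ?m)"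
      using v w by (intro N_tri N_right[OF c] mon_C) auto
    moreover have "pscale c (h b * (e i * ?r)) \<in> tri (Suc ?m)"
      using h_tri[OF b Cons.IH[OF v]] by (intro pvs.subspace_scale[OF subspace_tri]) simp
    moreover have "pscale c' (e i * ?r) \<in> tri (Suc ?m)"
      using Cons.IH[OF v] tri_mono[of ?m "Suc ?m"]
      by (intro pvs.subspace_scale[OF subspace_tri]) auto
    ultimately have "(e i * h b - pscale c (h b * e i) - pscale c' (e i)) * ?r +
        pscale c (h b * (e i * ?r)) + pscale c' (e i * ?r) \<in> tri (Suc ?m)"
      by (intro pvs.subspace_add[OF subspace_tri])
    also have "(e i * h b - pscale c (h b * e i) - pscale c' (e i)) * ?r +
        pscale c (h b * (e i * ?r)) + pscale c' (e i * ?r) = e i * mon [] (b # v) w"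
      by (simp add: mon_def left_diff_distrib pscale_mult_left mult.assoc)
    finally show ?case .
  qed
next
  case (Cons j u)
  let ?r = "mon u v w" and ?m = "length (j # u) + length v + length w"
  have j: "j \<in> I" and u: "set u \<subseteq> I"
    using Cons.prems by auto
  have "(e i * f j - f j * e i) * ?r \<in> tri (Suc (length u + length v + length w))"
    using u v w by (intro span_h_tri ef i j mon_tri mon_C order.refl)
  then have "(e i * f j - f j * e i) * ?r \<in> tri (Suc ?m)"
    using tri_mono[of ?m "Suc ?m"] by auto
  moreover have "f j * (e i * ?r) \<in> tri (Suc ?m)"
    using f_tri[OF j Cons.IH[OF u]] by simp
  ultimately have "(e i * f j - f j * e i) * ?r + f j * (e i * ?r) \<in> tri (Suc ?m)"
    by (rule pvs.subspace_add[OF subspace_tri])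
  also have "(e i * f j - f j * e i) * ?r + f j * (e i * ?r) = e i * mon (j # u) v w"
    by (simp add: mon_def left_diff_distrib mult.assoc)
  finally show ?case .
qed

lemma e_tri:
  assumes "i \<in> I" "y \<in> tri m"
  shows "e i * y \<in> tri (Suc m)"
proof (rule tri_left[OF e_C assms(2)])
  fix u v w assume *: "set u \<subseteq> I" "set v \<subseteq> Hs" "set w \<subseteq> I" "length u + length v + length w \<le> m"
  show "e i * mon u v w \<in> tri (Suc m)"
    using e_mon[OF assms(1) *(1-3)] tri_mono[of "Suc (length u + length v + length w)" "Suc m"] *(4) by auto
qed (rule assms(1))

definition gens :: "('g free_monoid \<Rightarrow>\<^sub>0 'k) set" where
  "gens = e ` I \<union> f ` I \<union> h ` Hs"

lemma gens_C: "gens \<subseteq> C"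
  by (auto simp: gens_def e_C f_C h_C)

lemma filt_tri: "filt gens m \<subseteq> tri m"
  unfolding filt_def
proof (rule pvs.span_minimal[OF _ subspace_tri], safe)
  fix xs assume xs: "set xs \<subseteq> gens" "length xs \<le> m"
  have "prod_list xs \<in> tri (length xs)"
    using xs(1)
  proof (induction xs)
    case Nil
    then show ?case
      using mon_tri[of "[]" "[]" "[]" 0] by (simp add: mon_def)
  next
    case (Cons x xs)
    then show ?case
      using e_tri f_tri h_tri by (auto simp: gens_def)
  qed
  then show "prod_list xs \<in> tri m"
    using tri_mono[OF xs(2)] by blast
qed (rule N_tri)

text \<open>Commutativity modulo \<open>N\<close> leaves only the multiset of Cartan factors, so
  their contribution to the growth is polynomial.\<close>

lemma pl_h_mset:
  assumes "set v \<subseteq> Hs" "mset v = mset v'"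
  shows "pl h v - pl h v' \<in> N"
  using assms
proof (induction v arbitrary: v')
  case Nil
  then show ?case
    using pvs.subspace_0[OF subspace_N] by simp
next
  case (Cons b v)
  have "b \<in> set v'"
    using Cons.prems(2) by (metis list.set_intros(1) mset_eq_setD)
  then obtain x y where v': "v' = x @ b # y"
    by (meson split_list)
  have b: "b \<in> Hs" and v: "set v \<subseteq> Hs"
    using Cons.prems(1) by auto
  have xy: "mset v = mset (x @ y)"
    using Cons.prems(2) v' by simp
  then have sets: "set x \<subseteq> Hs" "set y \<subseteq> Hs"
    using v by (metis Un_subset_iff mset_eq_setD set_append)+
  have "h b * pl h x * pl h y - pl h x * h b * pl h y \<in> N"
    using sets(1)
  proof (induction x)
    case Nil
    then show ?case
      using pvs.subspace_0[OF subspace_N] by simp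
  next
    case (Cons a x)
    have a: "a \<in> Hs" "set x \<subseteq> Hs"
      using Cons.prems by auto
    have "(h b * h a - h a * h b) * (pl h x * pl h y) \<in> N"
      using a sets by (intro N_right hh b C_mult pl_C)
    moreover have "h a * (h b * pl h x * pl h y - pl h x * h b * pl h y) \<in> N"
      using a by (intro N_left Cons.IH h_C)
    ultimately have "(h b * h a - h a * h b) * (pl h x * pl h y) +
        h a * (h b * pl h x * pl h y - pl h x * h b * pl h y) \<in> N"
      by (rule pvs.subspace_add[OF subspace_N])
    then show ?case
      by (simp add: algebra_simps)
  qed
  moreover have "h b * (pl h v - pl h (x @ y)) \<in> N"
    using Cons.IH[OF v xy] b by (intro N_left h_C)
  ultimately have "h b * (pl h v - pl h (x @ y)) + (h b * pl h x * pl h y - pl h x * h b * pl h y) \<in> N"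
    by (intro pvs.subspace_add[OF subspace_N])
  then show ?case
    by (simp add: v' pl_def algebra_simps)
qed

text \<open>An ordered monomial is linear in each of its three parts, so each part can be replaced
  by its own spanning set; the counts multiply.\<close>

theorem filt_growth:
  assumes s: "subexponential s"
    and e_words: "\<And>l. \<exists>S\<subseteq>{w. set w \<subseteq> I \<and> length w = l}. finite S \<and> card S \<le> s l \<and>
      pl e ` {w. set w \<subseteq> I \<and> length w = l} \<subseteq> pvs.span (pl e ` S \<union> N)"
    and f_words: "\<And>l. \<exists>S\<subseteq>{w. set w \<subseteq> I \<and> length w = l}. finite S \<and> card S \<le> s l \<and>
      pl f ` {w. set w \<subseteq> I \<and> length w = l} \<subseteq> pvs.span (pl f ` S \<union> N)"
  shows "\<exists>r. subexponential r \<and>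
    (\<forall>m. \<exists>Z. finite Z \<and> card Z \<le> r m \<and> filt gens m \<subseteq> pvs.span (Z \<union> N))"
proof -
  let ?W = "\<lambda>l. {w. set w \<subseteq> I \<and> length w = l}"
  from choice[OF allI, OF e_words]
  obtain Se where Se: "\<forall>l. Se l \<subseteq> ?W l \<and> finite (Se l) \<and> card (Se l) \<le> s l \<and>
      pl e ` ?W l \<subseteq> pvs.span (pl e ` Se l \<union> N)" ..
  from choice[OF allI, OF f_words]
  obtain Sf where Sf: "\<forall>l. Sf l \<subseteq> ?W l \<and> finite (Sf l) \<and> card (Sf l) \<le> s l \<and>
      pl f ` ?W l \<subseteq> pvs.span (pl f ` Sf l \<union> N)" ..
  let ?M = "\<lambda>k. {\<beta>. set_mset \<beta> \<subseteq> Hs \<and> size \<beta> = k}"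
  \<comment> \<open>One chosen ordering for each multiset of Cartan generators.\<close>
  define lst where "lst = (\<lambda>\<beta> :: 'h multiset. SOME v. mset v = \<beta>)"
  have lst: "mset (lst \<beta>) = \<beta>" for \<beta>
    unfolding lst_def by (rule someI_ex) (rule ex_mset)
  define A where "A m = (\<Union>l\<le>m. Sf l)" for m
  define B where "B m = (\<Union>k\<le>m. ?M k)" for m
  define E where "E m = (\<Union>l\<le>m. Se l)" for m
  define Z where "Z m = (\<lambda>(u, \<beta>, w). mon u (lst \<beta>) w) ` (A m \<times> B m \<times> E m)" for m
  define r where "r m = (\<Sum>l\<le>m. s l) * ((\<Sum>k\<le>m. (k + 1) ^ card Hs) * (\<Sum>l\<le>m. s l))" for m
  have fin: "finite (A m)" "finite (B m)" "finite (E m)" for m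
    using Se Sf finite_multisets_of_size(1)[OF finite_Hs] by (simp_all add: A_def B_def E_def)
  have "card (Z m) \<le> r m" for m
  proof -
    have "card (A m) \<le> (\<Sum>l\<le>m. s l)"
      unfolding A_def using Sf by (intro order.trans[OF card_UN_le] sum_mono) auto
    moreover have "card (B m) \<le> (\<Sum>k\<le>m. (k + 1) ^ card Hs)"
      unfolding B_def
      by (intro order.trans[OF card_UN_le] sum_mono finite_multisets_of_size(2)[OF finite_Hs]) simp
    moreover have "card (E m) \<le> (\<Sum>l\<le>m. s l)"
      unfolding E_def using Se by (intro order.trans[OF card_UN_le] sum_mono) auto
    ultimately have "card (A m) * (card (B m) * card (E m)) \<le> r m"
      unfolding r_def by (intro mult_mono) auto
    moreover have "card (Z m) \<le> card (A m \<times> B m \<times> E m)"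
      unfolding Z_def using fin by (intro card_image_le) auto
    ultimately show ?thesis
      by (simp add: card_cartesian_product)
  qed
  moreover have "finite (Z m)" for m
    unfolding Z_def using fin by blast
  moreover have "filt gens m \<subseteq> pvs.span (Z m \<union> N)" for m
  proof -
    have "mon u v w \<in> pvs.span (Z m \<union> N)"
      if uvw: "set u \<subseteq> I" "set v \<subseteq> Hs" "set w \<subseteq> I" "length u + length v + length w \<le> m" for u v w
    proof -
      have sub: "pvs.subspace (pvs.span (Z m \<union> N))"
        by (rule pvs.subspace_span)
      have N: "x \<in> pvs.span (Z m \<union> N)" if "x \<in> N" for x
        using that by (simp add: pvs.span_base)
      have u: "pl f u \<in> pvs.span (pl f ` Sf (length u) \<union> N)"
        using Sf uvw(1) by blast
      have w: "pl e w \<in> pvs.span (pl e ` Se (length w) \<union> N)"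
        using Se uvw(3) by blast
      show ?thesis
        unfolding mon_def
      proof (rule klinear_span_subset[OF klinear_mult_right u _ sub])
        fix x assume x: "x \<in> pl f ` Sf (length u) \<union> N"
        show "x * (pl h v * pl e w) \<in> pvs.span (Z m \<union> N)"
        proof (cases "x \<in> N")
          case True
          then show ?thesis
            using uvw by (intro N N_right C_mult pl_C)
        next
          case False
          then obtain u' where u': "x = pl f u'" "u' \<in> Sf (length u)"
            using x by blast
          have "length u \<le> m"
            using uvw(4) by simp
          then have u'A: "u' \<in> A m" "set u' \<subseteq> I"
            unfolding A_def using u'(2) Sf by blast+
          show ?thesis
          proof (rule klinear_span_subset[OF klinear_compose[OF klinear_mult_left klinear_mult_left] w _ sub])
            fix z assume z: "z \<in> pl e ` Se (length w) \<union> N"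
            show "x * (pl h v * z) \<in> pvs.span (Z m \<union> N)"
            proof (cases "z \<in> N")
              case True
              then show ?thesis
                unfolding u'(1) using uvw u'A by (intro N N_left pl_C)
            next
              case False
              then obtain w' where w': "z = pl e w'" "w' \<in> Se (length w)"
                using z by blast
              have "length w \<le> m"
                using uvw(4) by simp
              then have w'E: "w' \<in> E m" "set w' \<subseteq> I"
                unfolding E_def using w'(2) Se by blast+
              let ?v = "lst (mset v)"
              have "mset v \<in> B m"
                using uvw by (auto simp: B_def)
              then have "mon u' ?v w' \<in> pvs.span (Z m \<union> N)"
                unfolding Z_def using u'A w'E by (intro pvs.span_base) force
              moreover have "x * ((pl h v - pl h ?v) * z) \<in> pvs.span (Z m \<union> N)"
                unfolding u'(1) w'(1) using uvw u'A w'E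
                by (intro N[OF N_left[OF N_right[OF pl_h_mset]]] pl_C) (simp_all add: lst)
              ultimately have "x * ((pl h v - pl h ?v) * z) + mon u' ?v w' \<in> pvs.span (Z m \<union> N)"
                by (intro pvs.span_add)
              then show ?thesis
                by (simp add: mon_def u'(1) w'(1) algebra_simps)
            qed
          qed
        qed
      qed
    qed
    then have "tri m \<subseteq> pvs.span (Z m \<union> N)"
      unfolding tri_def by (intro pvs.span_minimal pvs.subspace_span) (auto intro: pvs.span_base)
    then show ?thesis
      using filt_tri by blast
  qed
  moreover have "subexponential r"
    unfolding r_def
    by (intro subexponential_mult subexponential_partial_sums subexponential_poly s)
  ultimately show ?thesis by blast
qed

end

section \<open>Transfer of word bounds along homomorphisms\<close>

section \<open>Homomorphisms out of the free algebra\<close>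

definition eval_words :: "('i \<Rightarrow> ('g free_monoid \<Rightarrow>\<^sub>0 'k)) \<Rightarrow> ('i free_monoid \<Rightarrow>\<^sub>0 'k::field) \<Rightarrow> ('g free_monoid \<Rightarrow>\<^sub>0 'k)" where
  "eval_words e = lin_ext (\<lambda>w. prod_list (map e w))"

lemma klinear_eval: "klinear (eval_words e)"
  by (simp add: eval_words_def klinear_lin_ext)

lemma eval_wd: "eval_words e (wd w) = prod_list (map e w)"
  by (simp add: eval_words_def)

lemma eval_gen [simp]: "eval_words e (gen i) = e i"
  by (simp add: gen_eq_wd eval_wd)

lemma eval_mult: "eval_words e (x * y) = eval_words e x * eval_words e y"
proof -
  have wd: "eval_words e (wd u * y) = eval_words e (wd u) * eval_words e y" for u
    by (rule klinear_eqI[OF klinear_compose[OF klinear_eval klinear_mult_left]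
          klinear_compose[OF klinear_mult_left klinear_eval]])
      (simp add: eval_wd flip: wd_append)
  show ?thesis
    by (rule klinear_eqI[OF klinear_compose[OF klinear_eval klinear_mult_right]
          klinear_compose[OF klinear_mult_right klinear_eval]]) (rule wd)
qed

lemma eval_1 [simp]: "eval_words e 1 = 1"
  using eval_wd[of e "[]"] by simp

lemma eval_power: "eval_words e (x ^ n) = eval_words e x ^ n"
  by (induction n) (simp_all add: eval_mult)

lemma eval_ad_pow: "eval_words e ((ad x ^^ n) y) = (ad (eval_words e x) ^^ n) (eval_words e y)"
  by (induction n) (simp_all add: ad_def eval_mult klinear_diff[OF klinear_eval])

lemma eval_q_serre: "eval_words e (q_serre v n x y) = q_serre v n (eval_words e x) (eval_words e y)"
  unfolding q_serre_def
  by (simp only: klinear_sum[OF klinear_eval] klinear_scale[OF klinear_eval] eval_mult eval_power)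

text \<open>A homomorphism that sends the relations into \<open>N\<close> carries spanning sets of
  words to spanning sets modulo \<open>N\<close>.\<close>

lemma (in algebra_mod) eval_words_spanned:
  assumes e: "\<And>i. i \<in> I \<Longrightarrow> e i \<in> C"
    and R: "\<And>r. r \<in> R \<Longrightarrow> eval_words (\<lambda>i. if i \<in> I then e i else 0) r \<in> N"
    and S: "S \<subseteq> {w. set w \<subseteq> I \<and> length w = l}"
    and span: "wd ` {w. set w \<subseteq> I \<and> length w = l} \<subseteq> pvs.span (wd ` S \<union> ideal_of R)"
  shows "(\<lambda>w. prod_list (map e w)) ` {w. set w \<subseteq> I \<and> length w = l} \<subseteq>
    pvs.span ((\<lambda>w. prod_list (map e w)) ` S \<union> N)"
proof safe
  \<comment> \<open>Letters outside \<open>I\<close> go to 0, which keeps the image of the free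
    algebra on the whole type inside \<open>C\<close>.\<close>
  let ?e = "\<lambda>i. if i \<in> I then e i else 0"
  let ?E = "eval_words ?e"
  have E_wd: "?E (wd w) = prod_list (map e w)" if "set w \<subseteq> I" for w
  proof -
    have "map ?e w = map e w"
      using that by (intro map_cong) auto
    then show ?thesis
      by (simp only: eval_wd)
  qed
  have E_C: "?E (wd u) \<in> C" for u
    unfolding eval_wd using e pvs.subspace_0[OF subspace_C] by (intro prod_list_C) auto
  have E_N: "?E x \<in> N" if "x \<in> ideal_of R" for x
    using that unfolding ideal_of_def
  proof (rule klinear_span_subset[OF klinear_eval _ _ subspace_N], safe)
    fix u r v assume "r \<in> R"
    then show "?E (wd u * r * wd v) \<in> N"
      unfolding eval_mult by (intro N_left N_right R E_C)
  qed
  fix w assume w: "set w \<subseteq> I" "l = length w"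
  have "wd w \<in> pvs.span (wd ` S \<union> ideal_of R)"
    using span w by blast
  then have "?E (wd w) \<in> pvs.span ((\<lambda>w. prod_list (map e w)) ` S \<union> N)"
  proof (rule klinear_span_subset[OF klinear_eval _ _ pvs.subspace_span])
    fix y assume "y \<in> wd ` S \<union> ideal_of R"
    then consider "y \<in> ideal_of R" | s where "s \<in> S" "y = wd s"
      by blast
    then show "?E y \<in> pvs.span ((\<lambda>w. prod_list (map e w)) ` S \<union> N)"
    proof cases
      case 1
      then show ?thesis
        using E_N by (intro pvs.span_base) blast
    next
      case 2
      then have "?E y = prod_list (map e s)"
        using S by (auto simp: E_wd)
      then show ?thesis
        using 2(1) by (intro pvs.span_base) blast
    qed
  qed
  then show "prod_list (map e w) \<in> pvs.span ((\<lambda>w. prod_list (map e w)) ` S \<union> N)"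
    by (simp only: E_wd[OF w(1)])
qed

section \<open>Algebra structure on subalgebras and on quotients by two-sided ideals\<close>

section \<open>Subalgebras and quotients\<close>

lemma assoc_algebraD:
  assumes "assoc_algebra k A"
  shows "vectorspace k A" "ring A"
    and "c \<in> carrier k \<Longrightarrow> x \<in> carrier A \<Longrightarrow> y \<in> carrier A \<Longrightarrow>
      (c \<odot>\<^bsub>A\<^esub> x) \<otimes>\<^bsub>A\<^esub> y = c \<odot>\<^bsub>A\<^esub> (x \<otimes>\<^bsub>A\<^esub> y)"
    and "c \<in> carrier k \<Longrightarrow> x \<in> carrier A \<Longrightarrow> y \<in> carrier A \<Longrightarrow>
      x \<otimes>\<^bsub>A\<^esub> (c \<odot>\<^bsub>A\<^esub> y) = c \<odot>\<^bsub>A\<^esub> (x \<otimes>\<^bsub>A\<^esub> y)"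
  using assms unfolding assoc_algebra_def by auto

lemma assoc_algebra_subalgebra:
  assumes A: "assoc_algebra k A" and B: "unital_subalgebra k B A"
  shows "assoc_algebra k (A\<lparr>carrier := B\<rparr>)"
proof -
  interpret V: vectorspace k A
    by (rule assoc_algebraD[OF A])
  interpret R: ring A
    by (rule assoc_algebraD[OF A])
  have sub: "subring B A" and smult: "\<And>c x. c \<in> carrier k \<Longrightarrow> x \<in> B \<Longrightarrow> c \<odot>\<^bsub>A\<^esub> x \<in> B"
    using B by (auto simp: unital_subalgebra_def)
  have "submodule k B A"
    using subringE[OF sub] smult V.module.module_axioms by unfold_locales auto
  then have "VectorSpace.subspace k B A"
    using V.vectorspace_axioms by (simp add: VectorSpace.subspace_def)
  then have "vectorspace k (A\<lparr>carrier := B\<rparr>)"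
    by (rule V.subspace_is_vs)
  moreover have "ring (A\<lparr>carrier := B\<rparr>)"
    by (rule R.subring_is_ring[OF sub])
  ultimately show ?thesis
    by (simp add: assoc_algebra_def assoc_algebraD(3,4)[OF A] subsetD[OF subringE(1)[OF sub]])
qed

lemma alg_quot_simps:
  "carrier (alg_quot A J) = a_rcosets\<^bsub>A\<^esub> J" "zero (alg_quot A J) = J"
  "one (alg_quot A J) = J +>\<^bsub>A\<^esub> \<one>\<^bsub>A\<^esub>"
  by (simp_all add: alg_quot_def FactRing_def)

lemma alg_quot_carrier: "carrier (alg_quot A J) = (\<lambda>x. J +>\<^bsub>A\<^esub> x) ` carrier A"
  by (auto simp: alg_quot_simps A_RCOSETS_def')

context
  fixes k :: "('k, 'm) ring_scheme" and A :: "('k, 'a, 'n) module_scheme" and J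
  assumes A: "assoc_algebra k A" and J: "ideal J A"
begin

interpretation I: ideal J A
  by (rule J)

interpretation V: vectorspace k A
  by (rule assoc_algebraD[OF A])

lemma alg_quot_add: "x \<in> carrier A \<Longrightarrow> y \<in> carrier A \<Longrightarrow>
    (J +>\<^bsub>A\<^esub> x) \<oplus>\<^bsub>alg_quot A J\<^esub> (J +>\<^bsub>A\<^esub> y) = J +>\<^bsub>A\<^esub> (x \<oplus>\<^bsub>A\<^esub> y)"
  by (simp add: alg_quot_def FactRing_def I.a_rcos_sum)

lemma alg_quot_mult: "x \<in> carrier A \<Longrightarrow> y \<in> carrier A \<Longrightarrow>
    (J +>\<^bsub>A\<^esub> x) \<otimes>\<^bsub>alg_quot A J\<^esub> (J +>\<^bsub>A\<^esub> y) = J +>\<^bsub>A\<^esub> (x \<otimes>\<^bsub>A\<^esub> y)"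
  by (simp add: alg_quot_def FactRing_def I.rcoset_mult_add)

text \<open>A scalar acts as multiplication by that multiple of the unit.\<close>

lemma ideal_smult:
  assumes "c \<in> carrier k" "x \<in> J"
  shows "c \<odot>\<^bsub>A\<^esub> x \<in> J"
proof -
  have x: "x \<in> carrier A"
    using assms(2) by (rule I.a_Hcarr)
  have "(c \<odot>\<^bsub>A\<^esub> \<one>\<^bsub>A\<^esub>) \<otimes>\<^bsub>A\<^esub> x \<in> J"
    using assms by (intro I.I_l_closed V.smult_closed) auto
  then show ?thesis
    using assoc_algebraD(3)[OF A assms(1) I.one_closed x] x by simp
qed

text \<open>Independence of representatives: by stability of \<open>J\<close> under scalars, all
  cosets in the union that defines the scalar multiplication coincide.\<close>

lemma alg_quot_smult:
  assumes c: "c \<in> carrier k" and x: "x \<in> carrier A"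
  shows "c \<odot>\<^bsub>alg_quot A J\<^esub> (J +>\<^bsub>A\<^esub> x) = J +>\<^bsub>A\<^esub> (c \<odot>\<^bsub>A\<^esub> x)"
proof -
  have "J +>\<^bsub>A\<^esub> (c \<odot>\<^bsub>A\<^esub> y) = J +>\<^bsub>A\<^esub> (c \<odot>\<^bsub>A\<^esub> x)" if y: "y \<in> J +>\<^bsub>A\<^esub> x" for y
  proof -
    obtain j where j: "j \<in> J" "y = j \<oplus>\<^bsub>A\<^esub> x"
      using y by (auto simp: a_r_coset_def r_coset_def)
    have jA: "j \<in> carrier A"
      using j(1) by (rule I.a_Hcarr)
    have "c \<odot>\<^bsub>A\<^esub> y = c \<odot>\<^bsub>A\<^esub> j \<oplus>\<^bsub>A\<^esub> c \<odot>\<^bsub>A\<^esub> x"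
      using c x jA by (simp add: j(2) V.smult_r_distr)
    then have "c \<odot>\<^bsub>A\<^esub> y \<in> J +>\<^bsub>A\<^esub> (c \<odot>\<^bsub>A\<^esub> x)"
      using ideal_smult[OF c j(1)] by (auto simp: a_r_coset_def r_coset_def)
    then show ?thesis
      using c x by (intro I.a_repr_independence[symmetric] I.a_subgroup) auto
  qed
  moreover have "J +>\<^bsub>A\<^esub> x \<noteq> {}"
    using I.a_rcos_self[OF x] by (rule ex_in_conv[THEN iffD1, OF exI])
  ultimately have "(\<Union>y\<in>J +>\<^bsub>A\<^esub> x. J +>\<^bsub>A\<^esub> (c \<odot>\<^bsub>A\<^esub> y)) = J +>\<^bsub>A\<^esub> (c \<odot>\<^bsub>A\<^esub> x)"
    by (intro SUP_eq_const)
  then show ?thesis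
    by (simp only: alg_quot_def module.simps)
qed

lemma ring_alg_quot: "ring (alg_quot A J)"
proof -
  have eq: "carrier (alg_quot A J) = carrier (A Quot J)" "mult (alg_quot A J) = mult (A Quot J)"
    "one (alg_quot A J) = one (A Quot J)" "zero (alg_quot A J) = zero (A Quot J)"
    "add (alg_quot A J) = add (A Quot J)"
    by (simp_all add: alg_quot_def)
  interpret Q: ring "A Quot J"
    by (rule I.quotient_is_ring)
  have "abelian_group (alg_quot A J)"
  proof (rule abelian_groupI, unfold eq)
    fix x assume "x \<in> carrier (A Quot J)"
    then show "\<exists>y\<in>carrier (A Quot J). y \<oplus>\<^bsub>A Quot J\<^esub> x = \<zero>\<^bsub>A Quot J\<^esub>"
      using Q.l_neg Q.a_inv_closed by (intro bexI)
  qed ((rule Q.a_closed Q.zero_closed Q.a_assoc Q.a_comm Q.l_zero; assumption)+)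
  moreover have "Group.monoid (alg_quot A J)"
    by (rule monoidI, unfold eq)
      (rule Q.m_closed Q.one_closed Q.m_assoc Q.l_one Q.r_one; assumption)+
  ultimately show ?thesis
    by (rule ringI, unfold eq) (rule Q.l_distr Q.r_distr; assumption)+
qed

lemma assoc_algebra_alg_quot: "assoc_algebra k (alg_quot A J)"
proof -
  interpret Q: ring "alg_quot A J"
    by (rule ring_alg_quot)
  note [simp] = alg_quot_add alg_quot_mult alg_quot_smult
  have "module k (alg_quot A J)"
  proof (intro moduleI V.module.R.is_cring Q.abelian_group_axioms)
    fix c x assume "c \<in> carrier k" "x \<in> carrier (alg_quot A J)"
    then show "c \<odot>\<^bsub>alg_quot A J\<^esub> x \<in> carrier (alg_quot A J)"
      by (auto simp: alg_quot_carrier)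
  next
    fix b c x assume "b \<in> carrier k" "c \<in> carrier k" "x \<in> carrier (alg_quot A J)"
    then show "(b \<oplus>\<^bsub>k\<^esub> c) \<odot>\<^bsub>alg_quot A J\<^esub> x = b \<odot>\<^bsub>alg_quot A J\<^esub> x \<oplus>\<^bsub>alg_quot A J\<^esub> c \<odot>\<^bsub>alg_quot A J\<^esub> x"
      "(b \<otimes>\<^bsub>k\<^esub> c) \<odot>\<^bsub>alg_quot A J\<^esub> x = b \<odot>\<^bsub>alg_quot A J\<^esub> (c \<odot>\<^bsub>alg_quot A J\<^esub> x)"
      by (auto simp: alg_quot_carrier V.smult_l_distr V.smult_assoc1)
  next
    fix c x y assume "c \<in> carrier k" "x \<in> carrier (alg_quot A J)" "y \<in> carrier (alg_quot A J)"
    then show "c \<odot>\<^bsub>alg_quot A J\<^esub> (x \<oplus>\<^bsub>alg_quot A J\<^esub> y) = c \<odot>\<^bsub>alg_quot A J\<^esub> x \<oplus>\<^bsub>alg_quot A J\<^esub> c \<odot>\<^bsub>alg_quot A J\<^esub> y"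
      by (auto simp: alg_quot_carrier V.smult_r_distr)
  next
    fix x assume "x \<in> carrier (alg_quot A J)"
    then show "\<one>\<^bsub>k\<^esub> \<odot>\<^bsub>alg_quot A J\<^esub> x = x"
      by (auto simp: alg_quot_carrier)
  qed
  then have "vectorspace k (alg_quot A J)"
    using V.field.field_axioms by (simp add: vectorspace_def)
  moreover have "(c \<odot>\<^bsub>alg_quot A J\<^esub> x) \<otimes>\<^bsub>alg_quot A J\<^esub> y = c \<odot>\<^bsub>alg_quot A J\<^esub> (x \<otimes>\<^bsub>alg_quot A J\<^esub> y)"
    "x \<otimes>\<^bsub>alg_quot A J\<^esub> (c \<odot>\<^bsub>alg_quot A J\<^esub> y) = c \<odot>\<^bsub>alg_quot A J\<^esub> (x \<otimes>\<^bsub>alg_quot A J\<^esub> y)"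
    if "c \<in> carrier k" "x \<in> carrier (alg_quot A J)" "y \<in> carrier (alg_quot A J)" for c x y
    using that by (auto simp: alg_quot_carrier assoc_algebraD(3,4)[OF A])
  ultimately show ?thesis
    using ring_alg_quot by (simp add: assoc_algebra_def)
qed

lemma alg_quot_zero: "x \<in> J \<Longrightarrow> J +>\<^bsub>A\<^esub> x = \<zero>\<^bsub>alg_quot A J\<^esub>"
  unfolding alg_quot_simps
  by (rule I.a_coset_join2[OF I.a_Hcarr I.a_subgroup])

end

lemma integral_domain_alg_quot:
  assumes "assoc_algebra k A" "completely_prime J A"
  shows "integral_domain (alg_quot A J)"
proof -
  have J: "ideal J A" and dom: "integral_domain (A Quot J)"
    using assms(2) by (auto simp: completely_prime_def)
  show ?thesis
    using dom ring_alg_quot[OF assms(1) J] by (simp add: integral_domain_def alg_quot_def)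
qed

section \<open>Doubling of dimensions when the Ore condition fails\<close>

section \<open>Tempered domains are Ore domains\<close>

context vectorspace
begin

lemma lincomb_hom_image:
  assumes "finite S" "S \<subseteq> carrier V" "inj_on \<phi> S" "a \<in> \<phi> ` S \<rightarrow> carrier K"
    and closed: "\<And>x. x \<in> carrier V \<Longrightarrow> \<phi> x \<in> carrier V"
    and add: "\<And>x y. x \<in> carrier V \<Longrightarrow> y \<in> carrier V \<Longrightarrow> \<phi> (x \<oplus>\<^bsub>V\<^esub> y) = \<phi> x \<oplus>\<^bsub>V\<^esub> \<phi> y"
    and smult: "\<And>c x. c \<in> carrier K \<Longrightarrow> x \<in> carrier V \<Longrightarrow> \<phi> (c \<odot>\<^bsub>V\<^esub> x) = c \<odot>\<^bsub>V\<^esub> \<phi> x"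
  shows "lincomb a (\<phi> ` S) = \<phi> (lincomb (a \<circ> \<phi>) S)"
  using assms(1-4)
proof (induction S rule: finite_induct)
  case empty
  have "\<phi> \<zero>\<^bsub>V\<^esub> \<oplus>\<^bsub>V\<^esub> \<phi> \<zero>\<^bsub>V\<^esub> = \<phi> \<zero>\<^bsub>V\<^esub>"
    using add[of "\<zero>\<^bsub>V\<^esub>" "\<zero>\<^bsub>V\<^esub>"] by simp
  then have "\<phi> \<zero>\<^bsub>V\<^esub> = \<zero>\<^bsub>V\<^esub>"
    using closed[of "\<zero>\<^bsub>V\<^esub>"] by (metis M.add.l_cancel_one M.zero_closed)
  then show ?case
    by (simp add: lincomb_def)
next
  case (insert x S)
  have S: "S \<subseteq> carrier V" "x \<in> carrier V" and a: "\<And>y. y \<in> insert x S \<Longrightarrow> a (\<phi> y) \<in> carrier K"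
    using insert.prems by auto
  have \<phi>x: "\<phi> x \<notin> \<phi> ` S"
    using insert.hyps(2) insert.prems(2) by auto
  have image: "lincomb a (\<phi> ` insert x S) = a (\<phi> x) \<odot>\<^bsub>V\<^esub> \<phi> x \<oplus>\<^bsub>V\<^esub> lincomb a (\<phi> ` S)"
    unfolding lincomb_def image_insert
    by (rule M.finsum_insert) (use insert.hyps \<phi>x S a closed in auto)
  have IH: "lincomb a (\<phi> ` S) = \<phi> (lincomb (a \<circ> \<phi>) S)"
    using insert.prems by (intro insert.IH) auto
  have insert: "lincomb (a \<circ> \<phi>) (insert x S) = (a \<circ> \<phi>) x \<odot>\<^bsub>V\<^esub> x \<oplus>\<^bsub>V\<^esub> lincomb (a \<circ> \<phi>) S"
    unfolding lincomb_def by (rule M.finsum_insert) (use insert.hyps S a in auto)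
  have "lincomb (a \<circ> \<phi>) S \<in> carrier V"
    using S a by (intro lincomb_closed) auto
  then show ?case
    unfolding image insert IH using S a by (simp add: add smult)
qed

text \<open>\<open>indep\<close> says that the map from pairs (x, y) to \<phi> x + \<psi> y is
  injective, so the images of a basis of \<open>W\<close> under both maps are jointly independent.
  Abstract \<phi> and \<psi> serve left and right multiplication alike.\<close>

lemma dim_double:
  assumes W: "subspace K W V" "vectorspace.fin_dim K (vs W)"
    and W': "subspace K W' V" "vectorspace.fin_dim K (vs W')"
    and \<phi>: "\<And>x. x \<in> carrier V \<Longrightarrow> \<phi> x \<in> carrier V"
      "\<And>x y. x \<in> carrier V \<Longrightarrow> y \<in> carrier V \<Longrightarrow> \<phi> (x \<oplus>\<^bsub>V\<^esub> y) = \<phi> x \<oplus>\<^bsub>V\<^esub> \<phi> y"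
      "\<And>c x. c \<in> carrier K \<Longrightarrow> x \<in> carrier V \<Longrightarrow> \<phi> (c \<odot>\<^bsub>V\<^esub> x) = c \<odot>\<^bsub>V\<^esub> \<phi> x"
      "\<And>x. x \<in> W \<Longrightarrow> \<phi> x \<in> W'"
    and \<psi>: "\<And>x. x \<in> carrier V \<Longrightarrow> \<psi> x \<in> carrier V"
      "\<And>x y. x \<in> carrier V \<Longrightarrow> y \<in> carrier V \<Longrightarrow> \<psi> (x \<oplus>\<^bsub>V\<^esub> y) = \<psi> x \<oplus>\<^bsub>V\<^esub> \<psi> y"
      "\<And>c x. c \<in> carrier K \<Longrightarrow> x \<in> carrier V \<Longrightarrow> \<psi> (c \<odot>\<^bsub>V\<^esub> x) = c \<odot>\<^bsub>V\<^esub> \<psi> x"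
      "\<And>x. x \<in> W \<Longrightarrow> \<psi> x \<in> W'"
    and indep: "\<And>x y. x \<in> carrier V \<Longrightarrow> y \<in> carrier V \<Longrightarrow> \<phi> x \<oplus>\<^bsub>V\<^esub> \<psi> y = \<zero>\<^bsub>V\<^esub> \<Longrightarrow>
      x = \<zero>\<^bsub>V\<^esub> \<and> y = \<zero>\<^bsub>V\<^esub>"
  shows "2 * vectorspace.dim K (vs W) \<le> vectorspace.dim K (vs W')"
proof -
  interpret W: vectorspace K "vs W"
    by (rule subspace_is_vs[OF W(1)])
  interpret W': vectorspace K "vs W'"
    by (rule subspace_is_vs[OF W'(1)])
  have sub: "submodule K W V" "submodule K W' V"
    using W(1) W'(1) by simp_all
  have WV: "W \<subseteq> carrier V"
    using sub(1) by (rule submodule.subset)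
  obtain \<beta> where \<beta>: "finite \<beta>" "W.basis \<beta>"
    using W.finite_basis_exists[OF W(2)] by blast
  then have \<beta>W: "\<beta> \<subseteq> W" and \<beta>_indep: "lin_indpt \<beta>"
    unfolding W.basis_def using span_li_not_depend(2)[OF _ sub(1)] by auto
  have \<beta>V: "\<beta> \<subseteq> carrier V"
    using \<beta>W WV by blast
  have hom0: "\<phi> \<zero>\<^bsub>V\<^esub> = \<zero>\<^bsub>V\<^esub>" "\<psi> \<zero>\<^bsub>V\<^esub> = \<zero>\<^bsub>V\<^esub>"
    using \<phi>(1,2)[of "\<zero>\<^bsub>V\<^esub>"] \<psi>(1,2)[of "\<zero>\<^bsub>V\<^esub>"] by (metis M.add.l_cancel_one M.zero_closed M.r_zero)+
  have nz: "x = \<zero>\<^bsub>V\<^esub>" if "x \<in> carrier V" "\<phi> x = \<zero>\<^bsub>V\<^esub> \<or> \<psi> x = \<zero>\<^bsub>V\<^esub>" for x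
    using that indep[of x "\<zero>\<^bsub>V\<^esub>"] indep[of "\<zero>\<^bsub>V\<^esub>" x] hom0 by auto
  have neg: "(\<ominus>\<^bsub>K\<^esub> \<one>\<^bsub>K\<^esub>) \<odot>\<^bsub>V\<^esub> z = \<ominus>\<^bsub>V\<^esub> z" if "z \<in> carrier V" for z
    using that by (simp add: smult_l_minus)
  have hom_neg: "\<phi> (\<ominus>\<^bsub>V\<^esub> y) = \<ominus>\<^bsub>V\<^esub> \<phi> y" "\<psi> (\<ominus>\<^bsub>V\<^esub> y) = \<ominus>\<^bsub>V\<^esub> \<psi> y" if y: "y \<in> carrier V" for y
    using \<phi>(3)[of "\<ominus>\<^bsub>K\<^esub> \<one>\<^bsub>K\<^esub>" y] \<psi>(3)[of "\<ominus>\<^bsub>K\<^esub> \<one>\<^bsub>K\<^esub>" y]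
    by (simp_all add: y \<phi>(1)[OF y] \<psi>(1)[OF y] neg)
  have diff: "x = y"
    if x: "x \<in> carrier V" and y: "y \<in> carrier V" and eq: "\<phi> x = \<phi> y \<or> \<psi> x = \<psi> y" for x y
  proof -
    have xy: "x \<oplus>\<^bsub>V\<^esub> \<ominus>\<^bsub>V\<^esub> y \<in> carrier V"
      using x y by simp
    have "\<phi> (x \<oplus>\<^bsub>V\<^esub> \<ominus>\<^bsub>V\<^esub> y) = \<phi> x \<oplus>\<^bsub>V\<^esub> \<ominus>\<^bsub>V\<^esub> \<phi> y"
      "\<psi> (x \<oplus>\<^bsub>V\<^esub> \<ominus>\<^bsub>V\<^esub> y) = \<psi> x \<oplus>\<^bsub>V\<^esub> \<ominus>\<^bsub>V\<^esub> \<psi> y"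
      using x y by (simp_all add: \<phi>(2) \<psi>(2) hom_neg)
    then have "\<phi> (x \<oplus>\<^bsub>V\<^esub> \<ominus>\<^bsub>V\<^esub> y) = \<zero>\<^bsub>V\<^esub> \<or> \<psi> (x \<oplus>\<^bsub>V\<^esub> \<ominus>\<^bsub>V\<^esub> y) = \<zero>\<^bsub>V\<^esub>"
      using eq \<phi>(1)[OF y] \<psi>(1)[OF y] M.r_neg by auto
    then have "x \<ominus>\<^bsub>V\<^esub> y = \<zero>\<^bsub>V\<^esub>"
      using nz[OF xy] by (simp add: M.minus_eq)
    then show ?thesis
      using x y by simp
  qed
  have inj: "inj_on \<phi> \<beta>" "inj_on \<psi> \<beta>"
    using diff \<beta>V by (auto intro!: inj_onI)
  have zero_notin: "\<zero>\<^bsub>V\<^esub> \<notin> \<beta>"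
    by (rule vs_zero_lin_dep[OF \<beta>V \<beta>_indep])
  have disj: "\<phi> ` \<beta> \<inter> \<psi> ` \<beta> = {}"
  proof (rule ccontr)
    assume "\<phi> ` \<beta> \<inter> \<psi> ` \<beta> \<noteq> {}"
    then obtain x y where xy: "x \<in> \<beta>" "y \<in> \<beta>" "\<phi> x = \<psi> y"
      by auto
    then have V: "x \<in> carrier V" "y \<in> carrier V"
      using \<beta>V by auto
    have "\<phi> x \<oplus>\<^bsub>V\<^esub> \<psi> (\<ominus>\<^bsub>V\<^esub> y) = \<zero>\<^bsub>V\<^esub>"
      using V \<psi>(1) xy(3) by (simp add: hom_neg M.r_neg)
    then have "x = \<zero>\<^bsub>V\<^esub>"
      using indep[of x "\<ominus>\<^bsub>V\<^esub> y"] V by simp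
    then show False
      using xy(1) zero_notin by simp
  qed
  let ?A = "\<phi> ` \<beta> \<union> \<psi> ` \<beta>"
  have A: "finite ?A" "?A \<subseteq> carrier V" "?A \<subseteq> W'"
    using \<beta>(1) \<phi>(1,4) \<psi>(1,4) \<beta>V \<beta>W by auto
  have "lin_indpt ?A"
  proof (rule finite_lin_indpt2[OF A(1,2)])
    fix a assume a: "a \<in> ?A \<rightarrow> carrier K" "lincomb a ?A = \<zero>\<^bsub>V\<^esub>"
    have a': "a \<circ> \<phi> \<in> \<beta> \<rightarrow> carrier K" "a \<circ> \<psi> \<in> \<beta> \<rightarrow> carrier K"
      using a(1) by auto
    have closed: "a v \<odot>\<^bsub>V\<^esub> v \<in> carrier V" if v: "v \<in> ?A" for v
      using funcset_mem[OF a(1) v] subsetD[OF A(2) v] by (rule smult_closed)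
    have "lincomb a ?A = lincomb a (\<phi> ` \<beta>) \<oplus>\<^bsub>V\<^esub> lincomb a (\<psi> ` \<beta>)"
      unfolding lincomb_def using \<beta>(1) disj
      by (intro M.finsum_Un_disjoint Pi_I closed) simp_all
    also have "lincomb a (\<phi> ` \<beta>) = \<phi> (lincomb (a \<circ> \<phi>) \<beta>)"
      using a(1) by (intro lincomb_hom_image \<beta>(1) \<beta>V inj \<phi>) auto
    also have "lincomb a (\<psi> ` \<beta>) = \<psi> (lincomb (a \<circ> \<psi>) \<beta>)"
      using a(1) by (intro lincomb_hom_image \<beta>(1) \<beta>V inj \<psi>) auto
    finally have "\<phi> (lincomb (a \<circ> \<phi>) \<beta>) \<oplus>\<^bsub>V\<^esub> \<psi> (lincomb (a \<circ> \<psi>) \<beta>) = \<zero>\<^bsub>V\<^esub>"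
      using a(2) by (simp only:)
    then have "lincomb (a \<circ> \<phi>) \<beta> = \<zero>\<^bsub>V\<^esub> \<and> lincomb (a \<circ> \<psi>) \<beta> = \<zero>\<^bsub>V\<^esub>"
      by (intro indep lincomb_closed a' \<beta>V)
    then have "a \<circ> \<phi> \<in> \<beta> \<rightarrow> {\<zero>\<^bsub>K\<^esub>}" "a \<circ> \<psi> \<in> \<beta> \<rightarrow> {\<zero>\<^bsub>K\<^esub>}"
      using not_lindepD[OF \<beta>_indep \<beta>(1) order.refl] a' by simp_all
    then have "\<forall>v\<in>\<beta>. (a \<circ> \<phi>) v = \<zero>\<^bsub>K\<^esub>" "\<forall>v\<in>\<beta>. (a \<circ> \<psi>) v = \<zero>\<^bsub>K\<^esub>"
      by blast+
    then show "\<forall>v\<in>?A. a v = \<zero>\<^bsub>K\<^esub>"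
      by auto
  qed
  then have "W'.lin_indpt ?A"
    using span_li_not_depend(2)[OF A(3) sub(2)] by simp
  then have "card ?A \<le> W'.dim"
    using W'.li_le_dim(2)[OF W'(2)] A(3) by simp
  moreover have "card ?A = 2 * card \<beta>"
    using card_Un_disjoint[OF _ _ disj] \<beta>(1) inj by (simp add: card_image)
  moreover have "W.dim = card \<beta>"
    by (rule W.dim_basis[OF \<beta>])
  ultimately show ?thesis
    by simp
qed

end

lemma tempered_no_doubling:
  assumes F: "algebra_filtration k A F" and dom: "integral_domain A" and vs: "vectorspace k A"
    and fin: "\<And>m. vectorspace.fin_dim k (A\<lparr>carrier := F m\<rparr>)"
    and lim: "limsup (\<lambda>m. ereal (root m (real (vectorspace.dim k (A\<lparr>carrier := F m\<rparr>))))) \<le> 1"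
    and r: "r > 0"
    and double: "\<And>m. 2 * vectorspace.dim k (A\<lparr>carrier := F m\<rparr>) \<le> vectorspace.dim k (A\<lparr>carrier := F (m + r)\<rparr>)"
  shows False
proof -
  interpret V: vectorspace k A
    by (rule vs)
  let ?dim = "\<lambda>m. vectorspace.dim k (A\<lparr>carrier := F m\<rparr>)"
  \<comment> \<open>\<open>F 0\<close> contains 1, which differs from 0; this starts the
    doubling.\<close>
  have "?dim 0 \<noteq> 0"
  proof
    assume 0: "?dim 0 = 0"
    have "VectorSpace.subspace k (F 0) A"
      using F by (simp add: algebra_filtration_def)
    then interpret W: vectorspace k "A\<lparr>carrier := F 0\<rparr>"
      by (rule V.subspace_is_vs)
    obtain \<beta> where "finite \<beta>" "W.basis \<beta>"
      using W.finite_basis_exists[OF fin] by blast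
    moreover from this have "\<beta> = {}"
      using W.dim_basis 0 by auto
    ultimately have "F 0 = {\<zero>\<^bsub>A\<^esub>}"
      using W.span_empty by (simp add: W.basis_def)
    then show False
      using F dom by (auto simp: algebra_filtration_def integral_domain_def)
  qed
  then have dims: "2 ^ n \<le> ?dim (n * r)" for n
  proof (induction n)
    case (Suc n)
    then have "2 * 2 ^ n \<le> 2 * ?dim (n * r)"
      by simp
    also have "\<dots> \<le> ?dim (n * r + r)"
      by (rule double)
    finally show ?case
      by (simp add: add.commute)
  qed simp
  \<comment> \<open>Along the multiples of \<open>r\<close> the roots of the dimensions are at least
    \<open>root r 2\<close>, a number that separates them from the assumed limit superior.\<close>
  have "1 < ereal (root r 2)"
    using r by (simp add: one_ereal_def)
  then have "limsup (\<lambda>m. ereal (root m (real (?dim m)))) < ereal (root r 2)"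
    by (rule le_less_trans[OF lim])
  then have "\<forall>\<^sub>F m in sequentially. ereal (root m (real (?dim m))) < ereal (root r 2)"
    by (rule Limsup_lessD)
  then obtain M where M: "\<And>m. m \<ge> M \<Longrightarrow> root m (real (?dim m)) < root r 2"
    by (auto simp: eventually_sequentially)
  define n where "n = Suc M"
  have "M \<le> n * 1"
    by (simp add: n_def)
  also have "\<dots> \<le> n * r"
    using r by (intro mult_left_mono) auto
  finally have n: "n > 0" "n * r \<ge> M"
    by (simp_all add: n_def)
  have "root r 2 = root r (root n (2 ^ n))"
    using n(1) by (simp add: real_root_power_cancel)
  also have "\<dots> = root (n * r) (2 ^ n)"
    by (simp only: mult.commute[of n r] real_root_mult_exp)
  also have "\<dots> \<le> root (n * r) (real (?dim (n * r)))"
  proof (intro real_root_le_mono)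
    show "2 ^ n \<le> real (?dim (n * r))"
      using of_nat_mono[OF dims[of n], where ?'a = real] by simp
  qed (use n r in simp)
  finally show False
    using M[OF n(2)] by simp
qed

theorem tempered_imp_ore:
  assumes "tempered_domain k A"
  shows "ore_domain A"
proof -
  have A: "assoc_algebra k A" and dom: "integral_domain A"
    using assms by (auto simp: tempered_domain_def)
  obtain F where F: "algebra_filtration k A F"
    and fin: "\<And>m. vectorspace.fin_dim k (A\<lparr>carrier := F m\<rparr>)"
    and lim: "limsup (\<lambda>m. ereal (root m (real (vectorspace.dim k (A\<lparr>carrier := F m\<rparr>))))) \<le> 1"
    using assms unfolding tempered_domain_def by blast
  interpret R: ring A
    by (rule assoc_algebraD[OF A])
  interpret V: vectorspace k A
    by (rule assoc_algebraD[OF A])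
  have sub: "VectorSpace.subspace k (F m) A" and Suc: "F m \<subseteq> F (Suc m)" and un: "(\<Union>m. F m) = carrier A"
    and mult: "\<And>m n x y. x \<in> F m \<Longrightarrow> y \<in> F n \<Longrightarrow> x \<otimes>\<^bsub>A\<^esub> y \<in> F (m + n)" for m
    using F by (auto simp: algebra_filtration_def)
  have nozd: "x = \<zero>\<^bsub>A\<^esub> \<or> y = \<zero>\<^bsub>A\<^esub>" if "x \<otimes>\<^bsub>A\<^esub> y = \<zero>\<^bsub>A\<^esub>" "x \<in> carrier A" "y \<in> carrier A" for x y
    using dom that by (auto simp: integral_domain_def)
  have mono: "F m \<subseteq> F n" if "m \<le> n" for m n
    using Suc that by (rule lift_Suc_mono_le)
  \<comment> \<open>The common degree is made positive, since it becomes the step of the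
    doubling.\<close>
  have ex: "\<exists>r>0. a \<in> F r \<and> b \<in> F r" if ab: "a \<in> carrier A" "b \<in> carrier A" for a b
  proof -
    obtain m n where "a \<in> F m" "b \<in> F n"
      using ab un by blast
    then show ?thesis
      using mono[OF le_SucI[OF max.cobounded1[of m n]]] mono[OF le_SucI[OF max.cobounded2[of n m]]]
      by (intro exI[of _ "Suc (max m n)"]) auto
  qed
  \<comment> \<open>If the two left ideals meet in 0, an equation \<open>x a + y b = 0\<close> makes
    both products vanish, and then \<open>x\<close> and \<open>y\<close>, since there are no zero
    divisors.\<close>
  have contra: "False" if ab: "a \<in> carrier A" "b \<in> carrier A" "a \<noteq> \<zero>\<^bsub>A\<^esub>" "b \<noteq> \<zero>\<^bsub>A\<^esub>"
    and *: "\<And>x y. x \<in> carrier A \<Longrightarrow> y \<in> carrier A \<Longrightarrow> x \<otimes>\<^bsub>A\<^esub> a = y \<otimes>\<^bsub>A\<^esub> b \<Longrightarrow> x \<otimes>\<^bsub>A\<^esub> a = \<zero>\<^bsub>A\<^esub>" for a b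
  proof -
    obtain r where r: "r > 0" "a \<in> F r" "b \<in> F r"
      using ex[OF ab(1,2)] by blast
    show False
    proof (rule tempered_no_doubling[OF F dom V.vectorspace_axioms fin lim r(1)])
      fix m
      show "2 * vectorspace.dim k (A\<lparr>carrier := F m\<rparr>) \<le> vectorspace.dim k (A\<lparr>carrier := F (m + r)\<rparr>)"
      proof (rule V.dim_double[OF sub fin sub fin, where \<phi> = "\<lambda>x. x \<otimes>\<^bsub>A\<^esub> a" and \<psi> = "\<lambda>x. x \<otimes>\<^bsub>A\<^esub> b"])
        fix x y assume xy: "x \<in> carrier A" "y \<in> carrier A" "x \<otimes>\<^bsub>A\<^esub> a \<oplus>\<^bsub>A\<^esub> y \<otimes>\<^bsub>A\<^esub> b = \<zero>\<^bsub>A\<^esub>"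
        then have eq: "x \<otimes>\<^bsub>A\<^esub> a = (\<ominus>\<^bsub>A\<^esub> y) \<otimes>\<^bsub>A\<^esub> b"
          using ab R.l_minus R.minus_equality[OF xy(3)] by simp
        then have xa: "x \<otimes>\<^bsub>A\<^esub> a = \<zero>\<^bsub>A\<^esub>"
          using * xy by blast
        then have "y \<otimes>\<^bsub>A\<^esub> b = \<zero>\<^bsub>A\<^esub>"
          using xy ab by simp
        then show "x = \<zero>\<^bsub>A\<^esub> \<and> y = \<zero>\<^bsub>A\<^esub>"
          using nozd[OF xa] nozd[of y b] xy ab by auto
      qed (use ab r mult assoc_algebraD(3)[OF A] R.l_distr in auto)
    qed
  qed
  have left: "left_ore_domain A"
    unfolding left_ore_domain_def
  proof (intro conjI dom ballI notI)
    fix a b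
    assume a: "a \<in> carrier A - {\<zero>\<^bsub>A\<^esub>}" and b: "b \<in> carrier A - {\<zero>\<^bsub>A\<^esub>}"
      and eq: "{x \<otimes>\<^bsub>A\<^esub> a |x. x \<in> carrier A} \<inter> {x \<otimes>\<^bsub>A\<^esub> b |x. x \<in> carrier A} = {\<zero>\<^bsub>A\<^esub>}"
    have "x \<otimes>\<^bsub>A\<^esub> a = \<zero>\<^bsub>A\<^esub>" if "x \<in> carrier A" "y \<in> carrier A" "x \<otimes>\<^bsub>A\<^esub> a = y \<otimes>\<^bsub>A\<^esub> b" for x y
    proof -
      have "x \<otimes>\<^bsub>A\<^esub> a \<in> {x \<otimes>\<^bsub>A\<^esub> a |x. x \<in> carrier A} \<inter> {x \<otimes>\<^bsub>A\<^esub> b |x. x \<in> carrier A}"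
        using that by blast
      then show ?thesis
        unfolding eq by simp
    qed
    then show False
      using a b contra[of a b] by simp
  qed
  have contra: "False" if ab: "a \<in> carrier A" "b \<in> carrier A" "a \<noteq> \<zero>\<^bsub>A\<^esub>" "b \<noteq> \<zero>\<^bsub>A\<^esub>"
    and *: "\<And>x y. x \<in> carrier A \<Longrightarrow> y \<in> carrier A \<Longrightarrow> a \<otimes>\<^bsub>A\<^esub> x = b \<otimes>\<^bsub>A\<^esub> y \<Longrightarrow> a \<otimes>\<^bsub>A\<^esub> x = \<zero>\<^bsub>A\<^esub>" for a b
  proof -
    obtain r where r: "r > 0" "a \<in> F r" "b \<in> F r"
      using ex[OF ab(1,2)] by blast
    show False
    proof (rule tempered_no_doubling[OF F dom V.vectorspace_axioms fin lim r(1)])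
      fix m
      show "2 * vectorspace.dim k (A\<lparr>carrier := F m\<rparr>) \<le> vectorspace.dim k (A\<lparr>carrier := F (m + r)\<rparr>)"
      proof (rule V.dim_double[OF sub fin sub fin, where \<phi> = "\<lambda>x. a \<otimes>\<^bsub>A\<^esub> x" and \<psi> = "\<lambda>x. b \<otimes>\<^bsub>A\<^esub> x"])
        fix x y assume xy: "x \<in> carrier A" "y \<in> carrier A" "a \<otimes>\<^bsub>A\<^esub> x \<oplus>\<^bsub>A\<^esub> b \<otimes>\<^bsub>A\<^esub> y = \<zero>\<^bsub>A\<^esub>"
        then have eq: "a \<otimes>\<^bsub>A\<^esub> x = b \<otimes>\<^bsub>A\<^esub> (\<ominus>\<^bsub>A\<^esub> y)"
          using ab R.r_minus R.minus_equality[OF xy(3)] by simp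
        then have ax: "a \<otimes>\<^bsub>A\<^esub> x = \<zero>\<^bsub>A\<^esub>"
          using * xy by blast
        then have "b \<otimes>\<^bsub>A\<^esub> y = \<zero>\<^bsub>A\<^esub>"
          using xy ab by simp
        then show "x = \<zero>\<^bsub>A\<^esub> \<and> y = \<zero>\<^bsub>A\<^esub>"
          using nozd[OF ax] nozd[of b y] xy ab by auto
      qed (use ab r mult assoc_algebraD(4)[OF A] R.r_distr in \<open>auto simp: add.commute[of _ r]\<close>)
    qed
  qed
  have right: "right_ore_domain A"
    unfolding right_ore_domain_def
  proof (intro conjI dom ballI notI)
    fix a b
    assume a: "a \<in> carrier A - {\<zero>\<^bsub>A\<^esub>}" and b: "b \<in> carrier A - {\<zero>\<^bsub>A\<^esub>}"
      and eq: "{a \<otimes>\<^bsub>A\<^esub> x |x. x \<in> carrier A} \<inter> {b \<otimes>\<^bsub>A\<^esub> x |x. x \<in> carrier A} = {\<zero>\<^bsub>A\<^esub>}"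
    have "a \<otimes>\<^bsub>A\<^esub> x = \<zero>\<^bsub>A\<^esub>" if "x \<in> carrier A" "y \<in> carrier A" "a \<otimes>\<^bsub>A\<^esub> x = b \<otimes>\<^bsub>A\<^esub> y" for x y
    proof -
      have "a \<otimes>\<^bsub>A\<^esub> x \<in> {a \<otimes>\<^bsub>A\<^esub> x |x. x \<in> carrier A} \<inter> {b \<otimes>\<^bsub>A\<^esub> x |x. x \<in> carrier A}"
        using that by blast
      then show ?thesis
        unfolding eq by simp
    qed
    then show False
      using a b contra[of a b] by simp
  qed
  show ?thesis
    using left right by (simp add: ore_domain_def)
qed

section \<open>Growth bounds for subquotients\<close>

section \<open>Temperedness from a filtration of the free algebra\<close>

lemma limsup_root_le_1:
  assumes r: "subexponential r" and d: "\<And>m. d m \<le> r m"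
  shows "limsup (\<lambda>m. ereal (root m (real (d m)))) \<le> 1"
proof (rule dense_ge)
  fix y :: ereal assume "1 < y"
  then obtain z where z: "1 < ereal z" "ereal z < y"
    using ereal_dense2 by blast
  \<comment> \<open>Of the two factors \<open>u ^ m\<close> in \<open>z ^ m\<close>, one bounds
    \<open>r m\<close> up to the constant \<open>K\<close>, and the other absorbs \<open>K\<close>
    for large \<open>m\<close>.\<close>
  define u where "u = sqrt z"
  have u: "u > 1" "u * u = z"
    using z(1) by (simp_all add: u_def one_ereal_def)
  obtain K where K: "\<And>m. real (r m) * (1 / u) ^ m \<le> K"
    using r[unfolded subexponential_def, rule_format, of "1 / u"] u(1) by auto
  obtain n where n: "K < u ^ n"
    using real_arch_pow[OF u(1)] by blast
  have "root m (real (d m)) \<le> z" if m: "m \<ge> Suc n" for m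
  proof -
    have "real (d m) \<le> real (r m)"
      using d by simp
    also have "real (r m) = real (r m) * (1 / u) ^ m * u ^ m"
      using u(1) by (simp add: power_one_over)
    also have "\<dots> \<le> K * u ^ m"
      using K u(1) by (intro mult_right_mono) auto
    also have "\<dots> \<le> u ^ m * u ^ m"
    proof (intro mult_right_mono)
      have "u ^ n \<le> u ^ m"
        using u(1) m by (intro power_increasing) auto
      then show "K \<le> u ^ m"
        using n by simp
    qed (use u in auto)
    also have "\<dots> = z ^ m"
      by (simp flip: u(2) power_mult_distrib)
    finally have "root m (real (d m)) \<le> root m (z ^ m)"
      using m by (intro real_root_le_mono) auto
    also have "\<dots> = z"
      using m u by (intro real_root_power_cancel) auto
    finally show ?thesis .
  qed
  then have "\<forall>\<^sub>F m in sequentially. ereal (root m (real (d m))) \<le> ereal z"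
    unfolding eventually_sequentially by (intro exI[of _ "Suc n"]) simp
  then have "limsup (\<lambda>m. ereal (root m (real (d m)))) \<le> ereal z"
    by (rule Limsup_bounded)
  then show "limsup (\<lambda>m. ereal (root m (real (d m)))) \<le> y"
    using z(2) by simp
qed

lemma (in vector_space) spanning_subset_mod_subspace:
  assumes "finite Z" "subspace V" "V \<subseteq> span (Z \<union> N)"
  obtains Z' where "Z' \<subseteq> V" "finite Z'" "card Z' \<le> card Z" "V \<subseteq> span (Z' \<union> N)"
  using spanning_subset_mod[OF assms(1,3)] by blast

text \<open>\<open>Q\<close> is a subquotient of the ambient algebra: \<open>D\<close> will be the
  preimage of a subalgebra and \<rho> the projection. Intersecting \<open>D\<close> with the ambient
  filtration keeps the bound \<open>r\<close>, even if \<open>D\<close> has no finite generating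
  set.\<close>

lemma tempered_domain_of_filtration:
  fixes Q :: "('k::field, 'q, 'n) module_scheme"
    and \<rho> :: "('w::monoid_add \<Rightarrow>\<^sub>0 'k) \<Rightarrow> 'q"
  assumes Q: "assoc_algebra class_ring Q" "integral_domain Q"
    and D: "pvs.subspace D" "1 \<in> D" "\<And>x y. x \<in> D \<Longrightarrow> y \<in> D \<Longrightarrow> x * y \<in> D" "N \<subseteq> D"
    and onto: "\<rho> ` D = carrier Q"
    and add: "\<And>x y. x \<in> D \<Longrightarrow> y \<in> D \<Longrightarrow> \<rho> (x + y) = \<rho> x \<oplus>\<^bsub>Q\<^esub> \<rho> y"
    and smult: "\<And>c x. x \<in> D \<Longrightarrow> \<rho> (pscale c x) = c \<odot>\<^bsub>Q\<^esub> \<rho> x"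
    and mult: "\<And>x y. x \<in> D \<Longrightarrow> y \<in> D \<Longrightarrow> \<rho> (x * y) = \<rho> x \<otimes>\<^bsub>Q\<^esub> \<rho> y"
    and one: "\<rho> 1 = \<one>\<^bsub>Q\<^esub>" and null: "\<And>x. x \<in> N \<Longrightarrow> \<rho> x = \<zero>\<^bsub>Q\<^esub>"
    and P: "\<And>m. pvs.subspace (P m)" "\<And>m. P m \<subseteq> P (Suc m)" "1 \<in> P 0" "\<And>m. N \<subseteq> P m"
      "\<And>m n x y. x \<in> P m \<Longrightarrow> y \<in> P n \<Longrightarrow> x * y \<in> P (m + n)" "D \<subseteq> (\<Union>m. P m)"
    and r: "subexponential r"
    and Z: "\<And>m. \<exists>Z. finite Z \<and> card Z \<le> r m \<and> P m \<subseteq> pvs.span (Z \<union> N)"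
  shows "tempered_domain class_ring Q"
proof -
  interpret R: ring Q
    by (rule assoc_algebraD[OF Q(1)])
  interpret V: vectorspace "class_ring :: 'k ring" Q
    by (rule assoc_algebraD[OF Q(1)])
  define F where "F m = \<rho> ` (D \<inter> P m)" for m
  have DP: "pvs.subspace (D \<inter> P m)" for m
    using D(1) P(1) by (rule pvs.subspace_inter)
  have zero: "\<rho> 0 = \<zero>\<^bsub>Q\<^esub>"
  proof -
    have 0: "0 \<in> D"
      using D(1) by (rule pvs.subspace_0)
    then have "\<rho> 0 \<oplus>\<^bsub>Q\<^esub> \<rho> 0 = \<rho> 0" "\<rho> 0 \<in> carrier Q"
      using add[of 0 0] onto by auto
    then show ?thesis
      using R.add.l_cancel_one[of "\<rho> 0" "\<rho> 0"] by simp
  qed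
  have sub: "VectorSpace.subspace class_ring (F m) Q" for m
    unfolding VectorSpace.subspace_def
  proof (intro conjI V.vectorspace_axioms submodule.intro V.module.module_axioms)
    show "F m \<subseteq> carrier Q"
      using onto by (auto simp: F_def)
    show "\<zero>\<^bsub>Q\<^esub> \<in> F m"
      unfolding F_def zero[symmetric] using pvs.subspace_0[OF DP] by (rule imageI)
    show "v \<oplus>\<^bsub>Q\<^esub> w \<in> F m" if vw: "v \<in> F m" "w \<in> F m" for v w
    proof -
      obtain x where x: "v = \<rho> x" "x \<in> D \<inter> P m"
        using vw(1) unfolding F_def by (rule imageE)
      obtain y where y: "w = \<rho> y" "y \<in> D \<inter> P m"
        using vw(2) unfolding F_def by (rule imageE)
      note xy = x(1) y(1) x(2) y(2)
      then have "v \<oplus>\<^bsub>Q\<^esub> w = \<rho> (x + y)"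
        using add by simp
      then show ?thesis
        unfolding F_def using pvs.subspace_add[OF DP xy(3,4)] by simp
    qed
    show "c \<odot>\<^bsub>Q\<^esub> v \<in> F m" if v: "v \<in> F m" for c v
    proof -
      obtain x where x: "v = \<rho> x" "x \<in> D \<inter> P m"
        using v unfolding F_def by (rule imageE)
      then have "c \<odot>\<^bsub>Q\<^esub> v = \<rho> (pscale c x)"
        using smult by simp
      then show ?thesis
        unfolding F_def using pvs.subspace_scale[OF DP x(2)] by simp
    qed
  qed
  have filtration: "algebra_filtration class_ring Q F"
    unfolding algebra_filtration_def
  proof (intro conjI allI ballI sub)
    show "F m \<subseteq> F (Suc m)" for m
      using P(2) by (auto simp: F_def)
    show "(\<Union>m. F m) = carrier Q"
      using P(6) unfolding onto[symmetric] F_def by blast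
    show "\<one>\<^bsub>Q\<^esub> \<in> F 0"
      using D(2) P(3) one unfolding F_def by (metis IntI imageI)
    show "x \<otimes>\<^bsub>Q\<^esub> y \<in> F (m + n)" if xy: "x \<in> F m" "y \<in> F n" for m n x y
    proof -
      obtain u where u: "x = \<rho> u" "u \<in> D \<inter> P m"
        using xy(1) unfolding F_def by (rule imageE)
      obtain v where v: "y = \<rho> v" "v \<in> D \<inter> P n"
        using xy(2) unfolding F_def by (rule imageE)
      from u v have "x \<otimes>\<^bsub>Q\<^esub> y = \<rho> (u * v)" "u * v \<in> D \<inter> P (m + n)"
        using mult D(3) P(5) by simp_all
      then show ?thesis
        unfolding F_def by simp
    qed
  qed
  have dim: "vectorspace.fin_dim class_ring (Q\<lparr>carrier := F m\<rparr>) \<and>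
      vectorspace.dim class_ring (Q\<lparr>carrier := F m\<rparr>) \<le> r m" for m
  proof -
    interpret W: vectorspace "class_ring :: 'k ring" "Q\<lparr>carrier := F m\<rparr>"
      by (rule V.subspace_is_vs[OF sub])
    obtain Z0 where Z0: "finite Z0" "card Z0 \<le> r m" "P m \<subseteq> pvs.span (Z0 \<union> N)"
      using Z by blast
    then have "D \<inter> P m \<subseteq> pvs.span (Z0 \<union> N)"
      by blast
    \<comment> \<open>The spanning set is moved into \<open>D \<inter> P m\<close>, because \<rho>
      is linear only on \<open>D\<close>.\<close>
    then obtain Z' where Z': "Z' \<subseteq> D \<inter> P m" "finite Z'" "card Z' \<le> card Z0" "D \<inter> P m \<subseteq> pvs.span (Z' \<union> N)"
      by (rule pvs.spanning_subset_mod_subspace[OF Z0(1) DP])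
    let ?S = "\<rho> ` Z'"
    have S: "?S \<subseteq> carrier (Q\<lparr>carrier := F m\<rparr>)"
      using Z'(1) by (auto simp: F_def)
    have span: "submodule class_ring (W.span ?S) (Q\<lparr>carrier := F m\<rparr>)"
      by (rule W.span_is_submodule[OF S])
    have "x \<in> D \<inter> P m \<and> \<rho> x \<in> W.span ?S" if "x \<in> pvs.span (Z' \<union> N)" for x
      using that
    proof (induction rule: pvs.span_induct_alt)
      case base
      then show ?case
        using pvs.subspace_0[OF DP] submodule.zero_closed[OF span] zero by simp
    next
      case (step c y z)
      have y: "y \<in> D \<inter> P m"
        using step(1) Z'(1) D(4) P(4) by blast
      have "\<rho> y \<in> W.span ?S"
      proof (cases "y \<in> N")
        case True
        then show ?thesis
          using submodule.zero_closed[OF span] null by simp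
      next
        case False
        then have "\<rho> y \<in> ?S"
          using step(1) by blast
        then show ?thesis
          by (rule W.span_mem[OF S])
      qed
      then have "c \<odot>\<^bsub>Q\<^esub> \<rho> y \<in> W.span ?S"
        using submodule.smult_closed[OF span, of c "\<rho> y"] by simp
      then have "c \<odot>\<^bsub>Q\<^esub> \<rho> y \<oplus>\<^bsub>Q\<^esub> \<rho> z \<in> W.span ?S"
        using submodule.m_closed[OF span, of "c \<odot>\<^bsub>Q\<^esub> \<rho> y" "\<rho> z"] step(2) by simp
      moreover have "pscale c y \<in> D \<inter> P m"
        using pvs.subspace_scale[OF DP y] .
      ultimately show ?case
        using step(2) y pvs.subspace_add[OF DP, of "pscale c y" m z] add smult by simp
    qed
    then have "F m \<subseteq> W.span ?S"
      unfolding F_def using Z'(4) by blast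
    then have gen: "W.gen_set ?S"
      using W.span_is_subset2[OF S] by auto
    have fin: "finite ?S"
      using Z'(2) by simp
    have "W.fin_dim"
      unfolding W.fin_dim_def using fin S gen by blast
    moreover have "W.dim \<le> card ?S"
      by (rule W.gen_ge_dim[OF fin S gen])
    moreover have "card ?S \<le> r m"
      using card_image_le[OF Z'(2), of \<rho>] Z'(3) Z0(2) by linarith
    ultimately show ?thesis
      by simp
  qed
  have "limsup (\<lambda>m. ereal (root m (real (vectorspace.dim class_ring (Q\<lparr>carrier := F m\<rparr>))))) \<le> 1"
    by (rule limsup_root_le_1[OF r]) (use dim in blast)
  then show ?thesis
    unfolding tempered_domain_def using Q filtration dim by blast
qed

section \<open>Subquotients of algebras given by generators and relations\<close>

section \<open>Presented algebras\<close>

lemma free_algebra_simps: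
  "carrier (free_algebra G) = {f. \<forall>w\<in>Poly_Mapping.keys f. set (letters w) \<subseteq> G}"
  "mult (free_algebra G) = (*)" "one (free_algebra G) = 1" "zero (free_algebra G) = 0"
  "add (free_algebra G) = (+)" "smult (free_algebra G) = pscale"
  by (simp_all add: free_algebra_def)

lemma pscale_free_algebra: "x \<in> carrier (free_algebra G) \<Longrightarrow> pscale c x \<in> carrier (free_algebra G)"
  by (auto simp: free_algebra_simps in_keys_iff lookup_pscale)

lemma assoc_algebra_free:
  "assoc_algebra class_ring (free_algebra G :: ('k::field, 'g free_monoid \<Rightarrow>\<^sub>0 'k) module)"
proof -
  let ?A = "free_algebra G :: ('k, 'g free_monoid \<Rightarrow>\<^sub>0 'k) module"
  interpret R: ring ?A
    by (rule ring_free_algebra)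
  have "module class_ring ?A"
  proof (intro moduleI class_cring.cring_axioms R.abelian_group_axioms)
    show "a \<odot>\<^bsub>?A\<^esub> x \<in> carrier ?A" if "x \<in> carrier ?A" for a x
      using pscale_free_algebra[OF that] by (simp add: free_algebra_simps(6))
  qed (simp_all add: free_algebra_simps pvs.scale_left_distrib pvs.scale_right_distrib)
  then have "vectorspace class_ring ?A"
    using class_field by (simp add: vectorspace_def)
  then show ?thesis
    using ring_free_algebra
    by (simp add: assoc_algebra_def free_algebra_simps pscale_mult_left pscale_mult_right)
qed

lemma subspace_free_algebra: "pvs.subspace (carrier (free_algebra G))"
proof -
  interpret R: ring "free_algebra G"
    by (rule ring_free_algebra)
  show ?thesis
    using R.zero_closed R.a_closed pscale_free_algebra
    by (intro pvs.subspaceI) (simp_all add: free_algebra_simps(4,5))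
qed

lemma wd_free_algebra: "wd w \<in> carrier (free_algebra G) \<longleftrightarrow> set w \<subseteq> G"
  by (simp add: free_algebra_simps wd_def)

lemma algebra_mod_genideal:
  assumes "R \<subseteq> carrier (free_algebra G)"
  shows "algebra_mod (carrier (free_algebra G)) (genideal (free_algebra G) R)"
proof -
  let ?A = "free_algebra G" and ?N = "genideal (free_algebra G) R"
  interpret A: ring ?A
    by (rule ring_free_algebra)
  have N: "ideal ?N ?A"
    by (rule A.genideal_ideal[OF assms])
  then interpret N: ideal ?N ?A .
  show ?thesis
  proof (unfold_locales, goal_cases)
    case 1
    show ?case by (rule subspace_free_algebra)
  next
    case 2
    show ?case
    proof (rule pvs.subspaceI)
      show "0 \<in> ?N"
        using N.zero_closed by (simp add: free_algebra_simps(4))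
      show "x + y \<in> ?N" if "x \<in> ?N" "y \<in> ?N" for x y
        using N.a_closed[OF that] by (simp add: free_algebra_simps(5))
      show "pscale c x \<in> ?N" if "x \<in> ?N" for c x
        using ideal_smult[OF assoc_algebra_free N _ that, of c] by (simp add: free_algebra_simps(6))
    qed
  next
    case 3
    show ?case by (rule N.a_subset)
  next
    case 4
    show ?case using A.one_closed by (simp add: free_algebra_simps(3))
  next
    case (5 x y)
    then show ?case using A.m_closed[of x y] by (simp add: free_algebra_simps(2))
  next
    case (6 x y)
    then show ?case using N.I_l_closed[of x y] by (simp add: free_algebra_simps(2))
  next
    case (7 x y)
    then show ?case using N.I_r_closed[of x y] by (simp add: free_algebra_simps(2))
  qed
qed

lemma (in algebra_mod) generated:
  assumes C: "C = carrier (free_algebra G)" and X: "X \<subseteq> C"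
    and gen: "\<And>g. g \<in> G \<Longrightarrow> gen g \<in> (\<Union>m. filt X m)"
  shows "C \<subseteq> (\<Union>m. filt X m)"
proof
  fix x assume "x \<in> C"
  then have sets: "set w \<subseteq> G" if "Word w \<in> Poly_Mapping.keys x" for w
    using bspec[OF _ that, of "\<lambda>w. set (letters w) \<subseteq> G"] by (simp add: C free_algebra_simps)
  have words: "wd w \<in> (\<Union>m. filt X m)" if "set w \<subseteq> G" for w
    using that
  proof (induction w)
    case Nil
    then show ?case
      using one_filt by auto
  next
    case (Cons g w)
    then show ?case
      unfolding wd_Cons by (intro Union_filt_mult X gen) auto
  qed
  have "wd ` {w. Word w \<in> Poly_Mapping.keys x} \<subseteq> (\<Union>m. filt X m)"
  proof (rule image_subsetI)
    fix w assume "w \<in> {w. Word w \<in> Poly_Mapping.keys x}"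
    then show "wd w \<in> (\<Union>m. filt X m)"
      by (intro words sets) simp
  qed
  then have "pvs.span (wd ` {w. Word w \<in> Poly_Mapping.keys x}) \<subseteq> (\<Union>m. filt X m)"
    by (rule pvs.span_minimal[OF _ Union_filt_subspace])
  then show "x \<in> (\<Union>m. filt X m)"
    using span_wd by (rule subsetD)
qed

text \<open>The filtration comes from a set \<open>X\<close> separate from the presenting generators
  \<open>G\<close>: those form an infinite set as soon as the lattice is nonzero, while
  \<open>X\<close> will be finite and only has to reach each of them in some degree.\<close>

theorem presented_algebra_tempered:
  fixes G :: "'g set" and R :: "('g free_monoid \<Rightarrow>\<^sub>0 'k::field) set"
  defines "C \<equiv> carrier (free_algebra G)" and "N \<equiv> genideal (free_algebra G) R"
    and "U \<equiv> presented_algebra G R"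
  assumes R: "R \<subseteq> C" and X: "X \<subseteq> C"
    and gen: "\<And>g. g \<in> G \<Longrightarrow> gen g \<in> (\<Union>m. algebra_mod.filt N X m)"
    and r: "subexponential r"
    and Z: "\<And>m. \<exists>Z. finite Z \<and> card Z \<le> r m \<and> algebra_mod.filt N X m \<subseteq> pvs.span (Z \<union> N)"
    and B: "unital_subalgebra class_ring B U" and J: "completely_prime J (U\<lparr>carrier := B\<rparr>)"
  shows "tempered_domain class_ring (alg_quot (U\<lparr>carrier := B\<rparr>) J) \<and>
    ore_domain (alg_quot (U\<lparr>carrier := B\<rparr>) J)"
proof -
  let ?A = "free_algebra G :: ('k, 'g free_monoid \<Rightarrow>\<^sub>0 'k) module"
  interpret algebra_mod C N
    unfolding C_def N_def by (rule algebra_mod_genideal[OF R[unfolded C_def]])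
  interpret A: ring ?A
    by (rule ring_free_algebra)
  note A = assoc_algebra_free[of G]
  have N: "ideal N ?A"
    unfolding N_def using R by (intro A.genideal_ideal) (simp add: C_def)
  have U_eq: "U = alg_quot ?A N"
    by (simp add: U_def presented_algebra_def N_def)
  have U: "assoc_algebra class_ring U"
    unfolding U_eq by (rule assoc_algebra_alg_quot[OF A N])
  let ?B = "U\<lparr>carrier := B\<rparr>"
  have UB: "assoc_algebra class_ring ?B"
    by (rule assoc_algebra_subalgebra[OF U B])
  have JB: "ideal J ?B"
    using J by (simp add: completely_prime_def)
  let ?Q = "alg_quot ?B J"
  have Q: "assoc_algebra class_ring ?Q" "integral_domain ?Q"
    by (rule assoc_algebra_alg_quot[OF UB JB]) (rule integral_domain_alg_quot[OF UB J])
  have sub: "subring B U" and B_smult: "\<And>c x. x \<in> B \<Longrightarrow> c \<odot>\<^bsub>U\<^esub> x \<in> B"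
    using B by (auto simp: unital_subalgebra_def)
  note Bring = subringE[OF sub]
  define \<pi> where "\<pi> x = N +>\<^bsub>?A\<^esub> x" for x
  have \<pi>_add: "\<pi> (x + y) = \<pi> x \<oplus>\<^bsub>U\<^esub> \<pi> y" and \<pi>_mult: "\<pi> (x * y) = \<pi> x \<otimes>\<^bsub>U\<^esub> \<pi> y"
    if "x \<in> C" "y \<in> C" for x y
    using alg_quot_add[OF A N, of x y] alg_quot_mult[OF A N, of x y] that
    by (simp_all add: \<pi>_def U_eq C_def free_algebra_simps(2,5))
  have \<pi>_smult: "\<pi> (pscale c x) = c \<odot>\<^bsub>U\<^esub> \<pi> x" if "x \<in> C" for x c
    using alg_quot_smult[OF A N, of c x] that by (simp add: \<pi>_def U_eq C_def free_algebra_simps(6))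
  have \<pi>_1: "\<pi> 1 = \<one>\<^bsub>U\<^esub>"
    by (simp add: \<pi>_def U_eq alg_quot_simps free_algebra_simps(3))
  have \<pi>_N: "\<pi> x = \<zero>\<^bsub>U\<^esub>" if "x \<in> N" for x
    using alg_quot_zero[OF A N that] by (simp add: \<pi>_def U_eq)
  have \<pi>_onto: "carrier U = \<pi> ` C"
    by (simp add: U_eq alg_quot_carrier \<pi>_def C_def)
  \<comment> \<open>The preimage of \<open>B\<close> in the free algebra; \<rho> is the composite
    projection from it to \<open>B / J\<close>.\<close>
  define D where "D = {x \<in> C. \<pi> x \<in> B}"
  define \<rho> where "\<rho> x = J +>\<^bsub>?B\<^esub> \<pi> x" for x
  have N_D: "N \<subseteq> D"
    using N_C \<pi>_N Bring(2) by (auto simp: D_def)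
  have "tempered_domain class_ring ?Q"
  proof (rule tempered_domain_of_filtration[OF Q, where D = D and N = N and \<rho> = \<rho> and P = "filt X" and r = r])
    show "pvs.subspace D"
    proof (rule pvs.subspaceI)
      show "0 \<in> D"
        using N_D pvs.subspace_0[OF subspace_N] by blast
      show "x + y \<in> D" if "x \<in> D" "y \<in> D" for x y
        using that Bring(7) pvs.subspace_add[OF subspace_C] by (simp add: D_def \<pi>_add)
      show "pscale c x \<in> D" if "x \<in> D" for c x
        using that B_smult pvs.subspace_scale[OF subspace_C] by (simp add: D_def \<pi>_smult)
    qed
    show "1 \<in> D"
      using C_1 Bring(3) by (simp add: D_def \<pi>_1)
    show "x * y \<in> D" if "x \<in> D" "y \<in> D" for x y
      using that C_mult Bring(6) by (simp add: D_def \<pi>_mult)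
    show "N \<subseteq> D"
      by (rule N_D)
    show "\<rho> ` D = carrier ?Q"
    proof -
      have "\<pi> ` D = B"
        using Bring(1) unfolding \<pi>_onto D_def by blast
      then show ?thesis
        unfolding alg_quot_carrier \<rho>_def by (simp flip: image_image)
    qed
    show "\<rho> (x + y) = \<rho> x \<oplus>\<^bsub>?Q\<^esub> \<rho> y" if "x \<in> D" "y \<in> D" for x y
      using that alg_quot_add[OF UB JB, of "\<pi> x" "\<pi> y"] by (simp add: \<rho>_def D_def \<pi>_add)
    show "\<rho> (x * y) = \<rho> x \<otimes>\<^bsub>?Q\<^esub> \<rho> y" if "x \<in> D" "y \<in> D" for x y
      using that alg_quot_mult[OF UB JB, of "\<pi> x" "\<pi> y"] by (simp add: \<rho>_def D_def \<pi>_mult)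
    show "\<rho> (pscale c x) = c \<odot>\<^bsub>?Q\<^esub> \<rho> x" if "x \<in> D" for c x
      using that alg_quot_smult[OF UB JB, of c "\<pi> x"] by (simp add: \<rho>_def D_def \<pi>_smult)
    show "\<rho> 1 = \<one>\<^bsub>?Q\<^esub>"
      by (simp add: \<rho>_def \<pi>_1 alg_quot_simps)
    show "\<rho> x = \<zero>\<^bsub>?Q\<^esub>" if "x \<in> N" for x
    proof -
      have "\<zero>\<^bsub>?B\<^esub> \<in> J"
        using additive_subgroup.zero_closed[OF ideal.axioms(1)[OF JB]] .
      then show ?thesis
        using alg_quot_zero[OF UB JB] \<pi>_N[OF that] by (simp add: \<rho>_def)
    qed
    show "D \<subseteq> (\<Union>m. filt X m)"
      using generated[OF C_def[THEN meta_eq_to_obj_eq] X gen] by (auto simp: D_def)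
  qed (simp_all add: subspace_filt filt_mono one_filt N_filt filt_mult[OF X] r Z)
  then show ?thesis
    using tempered_imp_ore by blast
qed

section \<open>Finite generation and triangular relations in the quantum case\<close>

section \<open>The quantized enveloping algebra\<close>

text \<open>This reduces statements about the whole lattice to a finite set of generators.\<close>

lemma additive_subgroup_eq_UNIV:
  fixes S B :: "'y::ab_group_add set"
  assumes span: "Modules.module.span int_scale B = UNIV" and "B \<subseteq> S" and "0 \<in> S"
    and add: "\<And>x y. x \<in> S \<Longrightarrow> y \<in> S \<Longrightarrow> x + y \<in> S" and neg: "\<And>x. x \<in> S \<Longrightarrow> - x \<in> S"
  shows "y \<in> S"
proof -
  have pow: "((+) x ^^ n) 0 \<in> S" if "x \<in> S" for x n
    using that by (induction n) (auto simp: assms(3) add)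
  have "y \<in> Modules.module.span int_scale B"
    by (simp add: span)
  then show ?thesis
  proof (induction rule: module.span_induct_alt[OF module_int_scale, consumes 1, case_names base step])
    case base
    then show ?case by (rule assms(3))
  next
    case (step c x y)
    have "int_scale c x \<in> S"
      using pow[of x] step(1) assms(2) neg by (auto simp: int_scale_def)
    then show ?case
      using step add by blast
  qed
qed

lemma gen_free_algebra: "gen g \<in> carrier (free_algebra G) \<longleftrightarrow> g \<in> G"
  using wd_free_algebra[of "[g]" G] by (simp add: gen_eq_wd)

context algebra_mod
begin

lemma C_add: "x \<in> C \<Longrightarrow> y \<in> C \<Longrightarrow> x + y \<in> C" and C_diff: "x \<in> C \<Longrightarrow> y \<in> C \<Longrightarrow> x - y \<in> C"
  and C_scale: "x \<in> C \<Longrightarrow> pscale c x \<in> C" and C_0: "0 \<in> C"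
  and N_add: "x \<in> N \<Longrightarrow> y \<in> N \<Longrightarrow> x + y \<in> N" and N_diff: "x \<in> N \<Longrightarrow> y \<in> N \<Longrightarrow> x - y \<in> N"
  and N_scale: "x \<in> N \<Longrightarrow> pscale c x \<in> N" and N_0: "0 \<in> N"
  by (simp_all add: subspace_C subspace_N pvs.subspace_add pvs.subspace_diff pvs.subspace_scale pvs.subspace_0)

lemma filt_congruent: "x \<in> (\<Union>m. filt X m) \<Longrightarrow> y - x \<in> N \<Longrightarrow> y \<in> (\<Union>m. filt X m)"
proof -
  assume x: "x \<in> (\<Union>m. filt X m)" and "y - x \<in> N"
  then have "y - x \<in> (\<Union>m. filt X m)"
    using N_filt by blast
  then show ?thesis
    using pvs.subspace_add[OF Union_filt_subspace x] by fastforce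
qed

lemma gen_filt: "x \<in> X \<Longrightarrow> x \<in> (\<Union>m. filt X m)"
  using prod_list_filt[of "[x]" X 1] by auto

end

lemma free_algebra_closed:
  shows "x \<in> carrier (free_algebra G) \<Longrightarrow> y \<in> carrier (free_algebra G) \<Longrightarrow> x + y \<in> carrier (free_algebra G)"
    and "x \<in> carrier (free_algebra G) \<Longrightarrow> y \<in> carrier (free_algebra G) \<Longrightarrow> x - y \<in> carrier (free_algebra G)"
    and "x \<in> carrier (free_algebra G) \<Longrightarrow> y \<in> carrier (free_algebra G) \<Longrightarrow> x * y \<in> carrier (free_algebra G)"
    and "x \<in> carrier (free_algebra G) \<Longrightarrow> pscale c x \<in> carrier (free_algebra G)"
    and "1 \<in> carrier (free_algebra G)" and "0 \<in> carrier (free_algebra G)"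
proof -
  \<comment> \<open>The empty set of relations gives access to the closure lemmas of
    \<open>algebra_mod\<close>.\<close>
  interpret algebra_mod "carrier (free_algebra G)" "genideal (free_algebra G) {}"
    by (rule algebra_mod_genideal) simp
  show "x \<in> carrier (free_algebra G) \<Longrightarrow> y \<in> carrier (free_algebra G) \<Longrightarrow> x + y \<in> carrier (free_algebra G)"
    "x \<in> carrier (free_algebra G) \<Longrightarrow> y \<in> carrier (free_algebra G) \<Longrightarrow> x - y \<in> carrier (free_algebra G)"
    "x \<in> carrier (free_algebra G) \<Longrightarrow> y \<in> carrier (free_algebra G) \<Longrightarrow> x * y \<in> carrier (free_algebra G)"
    "x \<in> carrier (free_algebra G) \<Longrightarrow> pscale c x \<in> carrier (free_algebra G)"
    "1 \<in> carrier (free_algebra G)" "0 \<in> carrier (free_algebra G)"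
    by (rule C_add C_diff C_mult C_scale C_1 C_0; assumption)+
qed

lemma free_algebra_power: "x \<in> carrier (free_algebra G) \<Longrightarrow> x ^ n \<in> carrier (free_algebra G)"
  by (induction n) (auto intro: free_algebra_closed)

lemma q_serre_closed:
  "x \<in> carrier (free_algebra G) \<Longrightarrow> y \<in> carrier (free_algebra G) \<Longrightarrow> q_serre v n x y \<in> carrier (free_algebra G)"
  unfolding q_serre_def
  by (intro pvs.subspace_sum[OF subspace_free_algebra] free_algebra_closed free_algebra_power)

lemma q_relations_closed: "q_relations I a d p \<alpha>v \<alpha> \<subseteq> carrier (free_algebra (q_generators I))"
  unfolding q_relations_def Let_def
  by (auto intro!: free_algebra_closed q_serre_closed simp: gen_free_algebra q_generators_def)

theorem quantized_enveloping_algebra_tempered: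
  fixes I :: "'i set" and a d and p :: "'y::ab_group_add \<Rightarrow> 'x::ab_group_add \<Rightarrow> int"
    and \<alpha>v \<alpha>
  defines "U \<equiv> quantized_enveloping_algebra I a d p \<alpha>v \<alpha>"
  assumes I: "gcm I a" "symmetrized_by I a d" "finite_type I a \<or> affine_type I a"
    and Y: "fg_free TYPE('y)"
    and B: "unital_subalgebra class_ring B U" and J: "completely_prime J (U\<lparr>carrier := B\<rparr>)"
  shows "tempered_domain class_ring (alg_quot (U\<lparr>carrier := B\<rparr>) J) \<and>
    ore_domain (alg_quot (U\<lparr>carrier := B\<rparr>) J)"
proof -
  interpret S: serre_affine I a "TYPE(rat)" d
    by unfold_locales (rule I)+
  let ?G = "q_generators I :: ('i, 'y) q_gen set" and ?R = "q_relations I a d p \<alpha>v \<alpha>"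
  define C where "C = (carrier (free_algebra ?G) :: (('i, 'y) q_gen free_monoid \<Rightarrow>\<^sub>0 rat poly fract) set)"
  define N where "N = genideal (free_algebra ?G) ?R"
  interpret algebra_mod C N
    unfolding C_def N_def by (rule algebra_mod_genideal[OF q_relations_closed])
  interpret A: ring "free_algebra ?G :: (rat poly fract, _) module"
    by (rule ring_free_algebra)
  define e f :: "'i \<Rightarrow> (('i, 'y) q_gen free_monoid \<Rightarrow>\<^sub>0 rat poly fract)"
    where "e = (\<lambda>i. gen (QE i))" and "f = (\<lambda>i. gen (QF i))"
  define K :: "'y \<Rightarrow> (('i, 'y) q_gen free_monoid \<Rightarrow>\<^sub>0 rat poly fract)" where "K = (\<lambda>y. gen (QK y))"
  define \<kappa> where "\<kappa> = (\<lambda>i. int_scale (scaled_d I d i) (\<alpha>v i))"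
  have rel: "r \<in> N" if "r \<in> ?R" for r
    using A.genideal_self[OF q_relations_closed] that unfolding N_def by blast
  have K_0: "K 0 - 1 \<in> N"
    unfolding K_def by (rule rel) (simp add: q_relations_def Let_def)
  have K_add: "K (y + z) - K y * K z \<in> N" for y z
    unfolding K_def by (rule rel) (unfold q_relations_def Let_def, blast)
  have K_e: "K y * e i * K (- y) - pscale (q_root powi p y (\<alpha> i)) (e i) \<in> N" if "i \<in> I" for y i
    unfolding K_def e_def by (rule rel) (unfold q_relations_def Let_def, use that in blast)
  have K_f: "K y * f i * K (- y) - pscale (q_root powi - p y (\<alpha> i)) (f i) \<in> N" if "i \<in> I" for y i
    unfolding K_def f_def by (rule rel) (unfold q_relations_def Let_def, use that in blast)
  have e_f: "e i * f j - f j * e i - (if i = j then pscale (inverse (q_sub I d i - inverse (q_sub I d i)))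
      (K (\<kappa> i) - K (- \<kappa> i)) else 0) \<in> N" if "i \<in> I" "j \<in> I" for i j
    unfolding K_def f_def e_def \<kappa>_def by (rule rel) (unfold q_relations_def Let_def, use that in blast)
  have serre_e: "q_serre (q_sub I d i) (nat (1 - a i j)) (e i) (e j) \<in> N"
    if "i \<in> I" "j \<in> I" "i \<noteq> j" for i j
    unfolding e_def by (rule rel) (unfold q_relations_def Let_def, use that in blast)
  have serre_f: "q_serre (q_sub I d i) (nat (1 - a i j)) (f i) (f j) \<in> N"
    if "i \<in> I" "j \<in> I" "i \<noteq> j" for i j
    unfolding f_def by (rule rel) (unfold q_relations_def Let_def, use that in blast)
  have e_C: "e i \<in> C" and f_C: "f i \<in> C" if "i \<in> I" for i
    using that by (simp_all add: C_def e_def f_def gen_free_algebra q_generators_def)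
  have K_C: "K y \<in> C" for y
    by (simp add: C_def K_def gen_free_algebra q_generators_def)
  have K_inv: "K (- y) * K y - 1 \<in> N" for y
    using N_diff[OF K_0 K_add[of "- y" y]] by simp
  \<comment> \<open>The presentation describes conjugation by \<open>K y\<close>; multiplication by
    \<open>K y\<close> on the right turns this into q-commutation.\<close>
  have comm: "K y * x - pscale c (x * K y) \<in> N"
    if x: "x \<in> C" and c: "K y * x * K (- y) - pscale c x \<in> N" for x y c
  proof -
    have "(K y * x * K (- y) - pscale c x) * K y - (K y * x) * (K (- y) * K y - 1) \<in> N"
      by (intro N_diff N_right[OF c] N_left[OF K_inv] C_mult K_C x)
    then show ?thesis
      by (simp add: left_diff_distrib right_diff_distrib mult.assoc pscale_mult_left)
  qed
  obtain bs where bs: "finite bs" "Modules.module.span int_scale bs = (UNIV :: 'y set)"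
    using Y unfolding fg_free_def by blast
  \<comment> \<open>Lattice generators and their negatives produce all group-like elements; plus and
    minus \<open>\<kappa> i\<close> are those occurring in the commutators of \<open>e i\<close> and
    \<open>f i\<close>.\<close>
  define Hs where "Hs = bs \<union> uminus ` bs \<union> \<kappa> ` I \<union> (\<lambda>i. - \<kappa> i) ` I"
  interpret T: triangular C N I Hs e f K
  proof
    show "finite Hs"
      using bs(1) S.finite_I by (simp add: Hs_def)
    show "e i \<in> C" "f i \<in> C" if "i \<in> I" for i
      using that by (rule e_C, rule f_C)
    show "K b \<in> C" for b
      by (rule K_C)
    show "e i * f j - f j * e i \<in> pvs.span (K ` Hs \<union> N)" if ij: "i \<in> I" "j \<in> I" for i j
    proof -
      let ?r = "if i = j then pscale (inverse (q_sub I d i - inverse (q_sub I d i))) (K (\<kappa> i) - K (- \<kappa> i)) else 0"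
      have "K (\<kappa> i) \<in> pvs.span (K ` Hs \<union> N)" "K (- \<kappa> i) \<in> pvs.span (K ` Hs \<union> N)"
        using ij by (auto simp: Hs_def intro!: pvs.span_base)
      then have "?r \<in> pvs.span (K ` Hs \<union> N)"
        by (auto intro: pvs.span_scale[OF pvs.span_diff] pvs.span_zero)
      moreover have "e i * f j - f j * e i - ?r \<in> pvs.span (K ` Hs \<union> N)"
        using e_f[OF ij] by (intro pvs.span_base) blast
      ultimately show ?thesis
        using pvs.span_add by fastforce
    qed
    show "\<exists>c c'. K b * f i - pscale c (f i * K b) - pscale c' (f i) \<in> N" if "i \<in> I" for b i
      using comm[OF f_C K_f, OF that that, of b] by (intro exI[of _ "q_root powi - p b (\<alpha> i)"] exI[of _ 0]) simp
    show "\<exists>c c'. e i * K b - pscale c (K b * e i) - pscale c' (e i) \<in> N" if "i \<in> I" for b i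
    proof -
      \<comment> \<open>The relation is solved for \<open>e i * K b\<close>, which brings in the
        inverse scalar.\<close>
      let ?c = "q_root powi p b (\<alpha> i)"
      have "?c \<noteq> 0"
        using q_root_nz by simp
      moreover have "pscale (- inverse ?c) (K b * e i - pscale ?c (e i * K b)) \<in> N"
        by (rule N_scale[OF comm[OF e_C K_e, OF that that, of b]])
      ultimately have "e i * K b - pscale (inverse ?c) (K b * e i) \<in> N"
        by (simp add: pvs.scale_right_diff_distrib)
      then show ?thesis
        by (intro exI[of _ "inverse ?c"] exI[of _ 0]) simp
    qed
    show "K b * K b' - K b' * K b \<in> N" for b b'
      using N_diff[OF K_add[of b' b] K_add[of b b']] by (simp add: add.commute)
  qed
  have UF_mult: "x * y \<in> (\<Union>m. filt T.gens m)"
    if "x \<in> (\<Union>m. filt T.gens m)" "y \<in> (\<Union>m. filt T.gens m)" for x y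
    by (rule Union_filt_mult[OF T.gens_C that])
  \<comment> \<open>Both signs are carried along so that the set of good \<open>y\<close> is closed
    under negation.\<close>
  have K_UF: "K y \<in> (\<Union>m. filt T.gens m) \<and> K (- y) \<in> (\<Union>m. filt T.gens m)" for y
  proof -
    let ?S = "{y. K y \<in> (\<Union>m. filt T.gens m) \<and> K (- y) \<in> (\<Union>m. filt T.gens m)}"
    have "y \<in> ?S"
    proof (rule additive_subgroup_eq_UNIV[OF bs(2)])
      show "bs \<subseteq> ?S"
      proof
        fix b assume "b \<in> bs"
        then have "K b \<in> T.gens" "K (- b) \<in> T.gens"
          unfolding T.gens_def unfolding Hs_def by blast+
        then show "b \<in> ?S"
          using gen_filt[of "K b" T.gens] gen_filt[of "K (- b)" T.gens] by blast
      qed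
      have "K 0 \<in> (\<Union>m. filt T.gens m)"
        using one_filt[of T.gens 0] by (intro filt_congruent[OF _ K_0]) blast
      then show "0 \<in> ?S"
        by simp
      have "K (y + z) \<in> (\<Union>m. filt T.gens m)"
        if "K y \<in> (\<Union>m. filt T.gens m)" "K z \<in> (\<Union>m. filt T.gens m)" for y z
        by (rule filt_congruent[OF UF_mult[OF that] K_add])
      then show "y + z \<in> ?S" if "y \<in> ?S" "z \<in> ?S" for y z
        using that by (simp only: mem_Collect_eq minus_add_distrib)
      show "- y \<in> ?S" if "y \<in> ?S" for y
        using that by simp
    qed
    then show ?thesis by simp
  qed
  have gen: "gen g \<in> (\<Union>m. filt T.gens m)" if g: "g \<in> ?G" for g
  proof -
    consider i where "i \<in> I" "g = QE i" | i where "i \<in> I" "g = QF i" | y where "g = QK y"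
      using g by (auto simp: q_generators_def)
    then show ?thesis
    proof cases
      case (1 i)
      then have "gen g = e i" "e i \<in> T.gens"
        unfolding T.gens_def by (simp add: e_def, blast)
      then show ?thesis
        using gen_filt[of "e i" T.gens] by (simp only:)
    next
      case (2 i)
      then have "gen g = f i" "f i \<in> T.gens"
        unfolding T.gens_def by (simp add: f_def, blast)
      then show ?thesis
        using gen_filt[of "f i" T.gens] by (simp only:)
    next
      case (3 y)
      then show ?thesis
        using K_UF[of y] by (simp add: K_def)
    qed
  qed
  \<comment> \<open>A general family \<open>g\<close> serves both \<open>e\<close> and
    \<open>f\<close>. The count is the one for the rational Serre algebra, carried over by
    specialization.\<close>
  have words: "\<exists>W\<subseteq>{w. set w \<subseteq> I \<and> length w = l}. finite W \<and> card W \<le> S.growth l \<and>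
      T.pl g ` {w. set w \<subseteq> I \<and> length w = l} \<subseteq> pvs.span (T.pl g ` W \<union> N)"
    if g: "\<And>i. i \<in> I \<Longrightarrow> g i \<in> C"
      "\<And>i j. i \<in> I \<Longrightarrow> j \<in> I \<Longrightarrow> i \<noteq> j \<Longrightarrow> q_serre (q_sub I d i) (nat (1 - a i j)) (g i) (g j) \<in> N"
    for g l
  proof -
    obtain W where W: "W \<subseteq> {w. set w \<subseteq> I \<and> length w = l}" "finite W" "card W \<le> S.growth l"
      "wd ` {w. set w \<subseteq> I \<and> length w = l} \<subseteq> pvs.span (wd ` W \<union> S.N)"
      using S.words_spanned[of l] by (elim exE conjE)
    have "(\<lambda>w. prod_list (map g w)) ` {w. set w \<subseteq> I \<and> length w = l} \<subseteq>
        pvs.span ((\<lambda>w. prod_list (map g w)) ` W \<union> N)"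
    proof (rule eval_words_spanned[OF g(1) _ W(1) q_words_spanned[OF S.finite_I S.d_pos W(1,4)]])
      fix r assume "r \<in> q_serre_rel I a d"
      then obtain i j where ij: "i \<in> I" "j \<in> I" "i \<noteq> j"
        "r = q_serre (q_sub I d i) (nat (1 - a i j)) (gen i) (gen j)"
        unfolding q_serre_rel_def by blast
      then show "eval_words (\<lambda>i. if i \<in> I then g i else 0) r \<in> N"
        using g(2) by (simp add: eval_q_serre)
    qed
    then show ?thesis
      using W unfolding T.pl_def by blast
  qed
  obtain r where r: "subexponential r"
    "\<And>m. \<exists>Z. finite Z \<and> card Z \<le> r m \<and> filt T.gens m \<subseteq> pvs.span (Z \<union> N)"
    using T.filt_growth[OF S.subexponential_growth words[OF e_C serre_e] words[OF f_C serre_f]] by blast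
  have U: "U = presented_algebra ?G ?R"
    by (simp add: U_def quantized_enveloping_algebra_def)
  have "?R \<subseteq> C"
    unfolding C_def by (rule q_relations_closed)
  then show ?thesis
    unfolding U
    by (intro presented_algebra_tempered[where X = T.gens and r = r])
      (use T.gens_C gen r B J in \<open>simp_all add: U flip: C_def N_def\<close>)
qed

section \<open>Lie relations read inside the enveloping algebra\<close>

section \<open>The enveloping algebra of a Kac--Moody algebra\<close>

lemma lookup_mbr: "Poly_Mapping.lookup (mbr f g) w =
    (case w of Leaf _ \<Rightarrow> 0 | Prod s t \<Rightarrow> Poly_Mapping.lookup f s * Poly_Mapping.lookup g t)"
proof (cases w)
  case (Leaf x)
  then show ?thesis
    by (simp add: mbr_def lookup_sum lookup_single)
next
  case (Prod u v)
  have "Poly_Mapping.lookup (mbr f g) w =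
      (\<Sum>s\<in>Poly_Mapping.keys f. \<Sum>t\<in>Poly_Mapping.keys g.
        if t = v then (if s = u then Poly_Mapping.lookup f s * Poly_Mapping.lookup g t else 0) else 0)"
    unfolding mbr_def lookup_sum
    by (intro sum.cong refl) (simp add: lookup_single when_def Prod)
  also have "\<dots> = (\<Sum>s\<in>Poly_Mapping.keys f.
      if s = u then Poly_Mapping.lookup f s * Poly_Mapping.lookup g v else 0)"
    by (intro sum.cong refl) (auto simp: sum.delta in_keys_iff)
  also have "\<dots> = Poly_Mapping.lookup f u * Poly_Mapping.lookup g v"
    by (auto simp: sum.delta in_keys_iff)
  finally show ?thesis
    by (simp add: Prod)
qed

lemma mbr_add_left: "mbr (f + f') g = mbr f g + mbr f' g"
  and mbr_add_right: "mbr f (g + g') = mbr f g + mbr f g'"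
  by (rule poly_mapping_eqI; simp add: lookup_mbr lookup_add algebra_simps split: magma.split)+

lemma mbr_single: "mbr (Poly_Mapping.single s b) (Poly_Mapping.single t c) = Poly_Mapping.single (Prod s t) (b * c)"
  by (rule poly_mapping_eqI) (auto simp: lookup_mbr lookup_single when_def split: magma.split)

lemma free_nonassoc_iff: "f \<in> free_nonassoc G \<longleftrightarrow> (\<forall>w. \<not> set_magma w \<subseteq> G \<longrightarrow> Poly_Mapping.lookup f w = 0)"
  by (auto simp: free_nonassoc_def in_keys_iff)

lemma free_nonassoc_0: "0 \<in> free_nonassoc G"
  and free_nonassoc_add: "f \<in> free_nonassoc G \<Longrightarrow> g \<in> free_nonassoc G \<Longrightarrow> f + g \<in> free_nonassoc G"
  and free_nonassoc_diff: "f \<in> free_nonassoc G \<Longrightarrow> g \<in> free_nonassoc G \<Longrightarrow> f - g \<in> free_nonassoc G"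
  and free_nonassoc_scale: "f \<in> free_nonassoc G \<Longrightarrow> pscale c f \<in> free_nonassoc G"
  by (simp_all add: free_nonassoc_iff lookup_add lookup_minus lookup_pscale)

lemma free_nonassoc_single: "set_magma w \<subseteq> G \<Longrightarrow> Poly_Mapping.single w c \<in> free_nonassoc G"
  by (auto simp: free_nonassoc_iff lookup_single when_def)

lemma free_nonassoc_mgen: "g \<in> G \<Longrightarrow> mgen g \<in> free_nonassoc G"
  unfolding mgen_def by (rule free_nonassoc_single) simp

lemma free_nonassoc_mbr:
  assumes "f \<in> free_nonassoc G" "g \<in> free_nonassoc G"
  shows "mbr f g \<in> free_nonassoc G"
  unfolding free_nonassoc_iff
proof (intro allI impI)
  fix w assume w: "\<not> set_magma w \<subseteq> G"
  show "Poly_Mapping.lookup (mbr f g) w = 0"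
  proof (cases w)
    case (Prod s t)
    then have "\<not> set_magma s \<subseteq> G \<or> \<not> set_magma t \<subseteq> G"
      using w by auto
    then show ?thesis
      using assms by (auto simp: Prod lookup_mbr free_nonassoc_iff)
  qed (simp add: lookup_mbr)
qed

lemma free_nonassoc_mbr_pow:
  "f \<in> free_nonassoc G \<Longrightarrow> g \<in> free_nonassoc G \<Longrightarrow> (mbr f ^^ n) g \<in> free_nonassoc G"
  by (induction n) (auto intro: free_nonassoc_mbr)

lemma lie_ideal_free_nonassoc:
  assumes "R \<subseteq> free_nonassoc G" "f \<in> lie_ideal G R"
  shows "f \<in> free_nonassoc G"
  using assms(2)
  by induction
    (use assms(1) in \<open>auto intro: free_nonassoc_0 free_nonassoc_add free_nonassoc_scale free_nonassoc_mbr\<close>)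

lemma lie_ideal_diff:
  assumes "f \<in> lie_ideal G R" "g \<in> lie_ideal G R"
  shows "f - g \<in> lie_ideal G R"
proof -
  have "f + pscale (- 1) g \<in> lie_ideal G R"
    by (intro lie_ideal.add lie_ideal.scale assms)
  then show ?thesis
    by simp
qed

lemma lie_coset_eq: "f - g \<in> lie_ideal G R \<Longrightarrow> lie_coset G R f = lie_coset G R g"
proof -
  have *: "lie_coset G R f \<subseteq> lie_coset G R g" if fg: "f - g \<in> lie_ideal G R" for f g
  proof
    fix x assume "x \<in> lie_coset G R f"
    then obtain r where r: "x = f + r" "r \<in> lie_ideal G R"
      by (auto simp: lie_coset_def)
    have "x = g + ((f - g) + r)"
      by (simp add: r(1))
    then show "x \<in> lie_coset G R g"
      unfolding lie_coset_def using lie_ideal.add[OF fg r(2)] by blast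
  qed
  assume fg: "f - g \<in> lie_ideal G R"
  have "g - f \<in> lie_ideal G R"
    using lie_ideal_diff[OF lie_ideal.zero fg] by simp
  then show ?thesis
    using *[OF fg] * by blast
qed

lemma UN_eq_const:
  assumes "a \<in> A" "\<And>x. x \<in> A \<Longrightarrow> F x = c"
  shows "(\<Union>x\<in>A. F x) = c"
  using assms by (intro SUP_eq_const) auto

lemma lie_coset_self: "f \<in> lie_coset G R f"
  unfolding lie_coset_def using lie_ideal.zero by force

context
  fixes G :: "'g set" and R :: "('g magma \<Rightarrow>\<^sub>0 'k::field) set"
  assumes R: "R \<subseteq> free_nonassoc G"
begin

lemma presented_lie_add:
  "lie_add (presented_lie_algebra G R) (lie_coset G R f) (lie_coset G R g) = lie_coset G R (f + g)"
proof -
  have "lie_coset G R (x + y) = lie_coset G R (f + g)"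
    if x: "x \<in> lie_coset G R f" and y: "y \<in> lie_coset G R g" for x y
  proof (rule lie_coset_eq)
    obtain r s where "x = f + r" "y = g + s" "r \<in> lie_ideal G R" "s \<in> lie_ideal G R"
      using x y by (auto simp: lie_coset_def)
    then show "x + y - (f + g) \<in> lie_ideal G R"
      using lie_ideal.add[of r G R s] by (simp add: algebra_simps)
  qed
  note eq = this
  have "(\<Union>y\<in>lie_coset G R g. lie_coset G R (x + y)) = lie_coset G R (f + g)"
    if "x \<in> lie_coset G R f" for x
    by (rule UN_eq_const[OF lie_coset_self]) (rule eq[OF that])
  then have "(\<Union>x\<in>lie_coset G R f. \<Union>y\<in>lie_coset G R g. lie_coset G R (x + y)) = lie_coset G R (f + g)"
    by (rule UN_eq_const[OF lie_coset_self])
  then show ?thesis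
    by (simp add: presented_lie_algebra_def)
qed

lemma presented_lie_smult:
  "lie_smult (presented_lie_algebra G R) c (lie_coset G R f) = lie_coset G R (pscale c f)"
proof -
  have "lie_coset G R (pscale c x) = lie_coset G R (pscale c f)" if x: "x \<in> lie_coset G R f" for x
  proof (rule lie_coset_eq)
    obtain r where "x = f + r" "r \<in> lie_ideal G R"
      using x by (auto simp: lie_coset_def)
    then show "pscale c x - pscale c f \<in> lie_ideal G R"
      using lie_ideal.scale[of r G R c] by (simp add: pvs.scale_right_distrib)
  qed
  then have "(\<Union>x\<in>lie_coset G R f. lie_coset G R (pscale c x)) = lie_coset G R (pscale c f)"
    by (rule UN_eq_const[OF lie_coset_self])
  then show ?thesis
    by (simp add: presented_lie_algebra_def)
qed

text \<open>Changing representatives alters the bracket by brackets with elements of the ideal. The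
  ideal absorbs brackets only with members of \<open>free_nonassoc G\<close>, whence the assumptions
  on \<open>f\<close> and \<open>g\<close>.\<close>

lemma presented_lie_bracket:
  assumes f: "f \<in> free_nonassoc G" and g: "g \<in> free_nonassoc G"
  shows "lie_bracket (presented_lie_algebra G R) (lie_coset G R f) (lie_coset G R g) = lie_coset G R (mbr f g)"
proof -
  have "lie_coset G R (mbr x y) = lie_coset G R (mbr f g)"
    if x: "x \<in> lie_coset G R f" and y: "y \<in> lie_coset G R g" for x y
  proof (rule lie_coset_eq)
    obtain r s where rs: "x = f + r" "y = g + s" "r \<in> lie_ideal G R" "s \<in> lie_ideal G R"
      using x y by (auto simp: lie_coset_def)
    have "mbr f s + (mbr r g + mbr r s) \<in> lie_ideal G R"
      using rs(3,4) f g lie_ideal_free_nonassoc[OF R]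
      by (intro lie_ideal.add) (auto intro: lie_ideal.left lie_ideal.right)
    also have "mbr f s + (mbr r g + mbr r s) = mbr x y - mbr f g"
      by (simp add: rs(1,2) mbr_add_left mbr_add_right algebra_simps)
    finally show "mbr x y - mbr f g \<in> lie_ideal G R" .
  qed
  note eq = this
  have "(\<Union>y\<in>lie_coset G R g. lie_coset G R (mbr x y)) = lie_coset G R (mbr f g)"
    if "x \<in> lie_coset G R f" for x
    by (rule UN_eq_const[OF lie_coset_self]) (rule eq[OF that])
  then have "(\<Union>x\<in>lie_coset G R f. \<Union>y\<in>lie_coset G R g. lie_coset G R (mbr x y)) = lie_coset G R (mbr f g)"
    by (rule UN_eq_const[OF lie_coset_self])
  then show ?thesis
    by (simp add: presented_lie_algebra_def)
qed

end

lemma km_relations_cartan_add: "mgen (KH (x + x')) - mgen (KH x) - mgen (KH x') \<in> km_relations I a p \<alpha>v \<alpha>"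
  unfolding km_relations_def Let_def by (intro UnI1) blast

lemma km_relations_cartan_scale:
  "mgen (KH (complexification_scale c x)) - pscale c (mgen (KH x)) \<in> km_relations I a p \<alpha>v \<alpha>"
  unfolding km_relations_def Let_def
  by (rule UnI1, rule UnI1, rule UnI1, rule UnI1, rule UnI1, rule UnI1, rule UnI2) blast

lemma km_relations_closed: "km_relations I a p \<alpha>v \<alpha> \<subseteq> free_nonassoc (km_generators I)"
  unfolding km_relations_def Let_def
  by (auto intro!: free_nonassoc_0 free_nonassoc_add free_nonassoc_diff free_nonassoc_scale
      free_nonassoc_mbr free_nonassoc_mbr_pow free_nonassoc_mgen simp: km_generators_def)

lemma of_lattice_add: "of_lattice (y + z) = of_lattice y + of_lattice z"
  unfolding tensor_null_def tensor_rel_def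
proof transfer
  fix y z :: 'a
  have "Poly_Mapping.single (y + z) 1 - Poly_Mapping.single y 1 - Poly_Mapping.single z 1 \<in> tensor_null"
    unfolding tensor_null_def by (rule module.span_base[OF module_pscale]) blast
  then show "tensor_rel (Poly_Mapping.single (y + z) 1) (Poly_Mapping.single y 1 + Poly_Mapping.single z 1)"
    by (simp add: tensor_rel_def diff_diff_eq)
qed

lemma of_lattice_uminus: "of_lattice (- y) = - of_lattice y"
proof -
  have "of_lattice (0 :: 'a) + of_lattice 0 = of_lattice 0"
    using of_lattice_add[of "0 :: 'a" 0] by simp
  then have "of_lattice (0 :: 'a) = 0"
    by simp
  then show ?thesis
    using of_lattice_add[of "- y" y] by (simp add: eq_neg_iff_add_eq_0)
qed

lemma complexification_uminus: "- h = complexification_scale (- 1) h"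
  by transfer (simp add: tensor_rel_def tensor_null_zero)

lemma complexification_induct:
  assumes add: "\<And>h h'. P h \<Longrightarrow> P h' \<Longrightarrow> P (h + h')"
    and scale: "\<And>c h. P h \<Longrightarrow> P (complexification_scale c h)"
    and lattice: "\<And>y. P (of_lattice y)"
  shows "P h"
proof (induction h)
  fix f :: "'a \<Rightarrow>\<^sub>0 complex"
  have "f \<in> pvs.span ((\<lambda>y. Poly_Mapping.single y 1) ` Poly_Mapping.keys f)"
    by (subst sum_singles) (intro pvs.span_sum pvs.span_scale pvs.span_base imageI)
  then show "P (abs_complexification f)"
  proof (induction rule: pvs.span_induct_alt)
    case base
    \<comment> \<open>Zero is reached as the zero multiple of a lattice element.\<close>
    have "complexification_scale 0 (of_lattice (0 :: 'a)) = abs_complexification 0"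
      by (simp add: of_lattice.abs_eq complexification_scale.abs_eq)
    then show ?case
      using scale[OF lattice[of 0], of 0] by simp
  next
    case (step c x y)
    then obtain z where "x = Poly_Mapping.single z 1"
      by blast
    then have "abs_complexification (pscale c x + y) =
        complexification_scale c (of_lattice z) + abs_complexification y"
      by (simp add: of_lattice.abs_eq complexification_scale.abs_eq plus_complexification.abs_eq
          del: pscale_single)
    then show ?case
      using add[OF scale[OF lattice] step(2)] by simp
  qed
qed

theorem enveloping_algebra_tempered:
  fixes I :: "'i set" and a d and p :: "'y::ab_group_add \<Rightarrow> 'x::ab_group_add \<Rightarrow> int"
    and \<alpha>v \<alpha>
  defines "U \<equiv> enveloping_algebra (kac_moody I a p \<alpha>v \<alpha>)"
  assumes I: "gcm I a" "symmetrized_by I a d" "finite_type I a \<or> affine_type I a"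
    and Y: "fg_free TYPE('y)"
    and B: "unital_subalgebra class_ring B U" and J: "completely_prime J (U\<lparr>carrier := B\<rparr>)"
  shows "tempered_domain class_ring (alg_quot (U\<lparr>carrier := B\<rparr>) J) \<and>
    ore_domain (alg_quot (U\<lparr>carrier := B\<rparr>) J)"
proof -
  interpret S: serre_affine I a "TYPE(complex)" d
    by unfold_locales (rule I)+
  let ?G = "km_generators I :: ('i, 'y complexification) km_gen set"
  let ?R = "km_relations I a p \<alpha>v \<alpha>"
  let ?L = "kac_moody I a p \<alpha>v \<alpha>"
  let ?M = "free_nonassoc ?G :: (('i, 'y complexification) km_gen magma \<Rightarrow>\<^sub>0 complex) set"
  define RU where "RU =
    {gen (lie_add ?L x y) - gen x - gen y | x y. x \<in> lie_carrier ?L \<and> y \<in> lie_carrier ?L} \<union>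
    {gen (lie_smult ?L c x) - pscale c (gen x) | c x. x \<in> lie_carrier ?L} \<union>
    {gen (lie_bracket ?L x y) - (gen x * gen y - gen y * gen x) | x y.
       x \<in> lie_carrier ?L \<and> y \<in> lie_carrier ?L}"
  define C where "C = (carrier (free_algebra (lie_carrier ?L)) :: (_ free_monoid \<Rightarrow>\<^sub>0 complex) set)"
  define N where "N = genideal (free_algebra (lie_carrier ?L)) RU"
  \<comment> \<open>The enveloping algebra has one generator for each Lie element; \<gamma> is
    linear and respects brackets modulo \<open>N\<close>.\<close>
  define \<gamma> where "\<gamma> f = (gen (lie_coset ?G ?R f) :: _ free_monoid \<Rightarrow>\<^sub>0 complex)" for f
  note Rsub = km_relations_closed[of I a p \<alpha>v \<alpha>]
  have L: "lie_carrier ?L = lie_coset ?G ?R ` ?M"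
    by (simp add: kac_moody_def presented_lie_algebra_def)
  have L_add: "lie_add ?L (lie_coset ?G ?R f) (lie_coset ?G ?R g) = lie_coset ?G ?R (f + g)"
    and L_smult: "lie_smult ?L c (lie_coset ?G ?R f) = lie_coset ?G ?R (pscale c f)" for f g c
    by (simp_all add: kac_moody_def presented_lie_add[OF Rsub] presented_lie_smult[OF Rsub])
  have L_bracket: "lie_bracket ?L (lie_coset ?G ?R f) (lie_coset ?G ?R g) = lie_coset ?G ?R (mbr f g)"
    if "f \<in> ?M" "g \<in> ?M" for f g
    unfolding kac_moody_def by (rule presented_lie_bracket[OF Rsub that])
  have \<gamma>_C: "\<gamma> f \<in> C" if "f \<in> ?M" for f
    using that by (simp add: \<gamma>_def C_def gen_free_algebra L)
  have RU_C: "RU \<subseteq> C"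
  proof
    fix r assume "r \<in> RU"
    then consider f g where "f \<in> ?M" "g \<in> ?M" "r = \<gamma> (f + g) - \<gamma> f - \<gamma> g"
      | c f where "f \<in> ?M" "r = \<gamma> (pscale c f) - pscale c (\<gamma> f)"
      | f g where "f \<in> ?M" "g \<in> ?M" "r = \<gamma> (mbr f g) - (\<gamma> f * \<gamma> g - \<gamma> g * \<gamma> f)"
      unfolding RU_def L \<gamma>_def by (auto simp: L_add L_smult L_bracket)
    then show "r \<in> C"
      by cases (auto intro!: \<gamma>_C[unfolded C_def] free_algebra_closed free_nonassoc_add
          free_nonassoc_scale free_nonassoc_mbr simp: C_def)
  qed
  interpret algebra_mod C N
    unfolding C_def N_def by (rule algebra_mod_genideal[OF RU_C[unfolded C_def]])
  interpret A: ring "free_algebra (lie_carrier ?L) :: (complex, _) module"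
    by (rule ring_free_algebra)
  have rel: "r \<in> N" if "r \<in> RU" for r
    using A.genideal_self[OF RU_C[unfolded C_def]] that unfolding N_def by blast
  have \<gamma>_add: "\<gamma> (f + g) - \<gamma> f - \<gamma> g \<in> N" if "f \<in> ?M" "g \<in> ?M" for f g
    unfolding \<gamma>_def L_add[symmetric]
    by (rule rel) (unfold RU_def L, use that in blast)
  have \<gamma>_scale: "\<gamma> (pscale c f) - pscale c (\<gamma> f) \<in> N" if "f \<in> ?M" for c f
    unfolding \<gamma>_def L_smult[symmetric]
    by (rule rel) (unfold RU_def L, use that in blast)
  have \<gamma>_mbr: "\<gamma> (mbr f g) - ad (\<gamma> f) (\<gamma> g) \<in> N" if "f \<in> ?M" "g \<in> ?M" for f g
    unfolding \<gamma>_def L_bracket[OF that, symmetric] ad_def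
    by (rule rel) (unfold RU_def L, use that in blast)
  have \<gamma>_0: "\<gamma> 0 \<in> N"
    using \<gamma>_scale[OF free_nonassoc_0, of 0] by simp
  have \<gamma>_ideal: "\<gamma> r \<in> N" if "r \<in> lie_ideal ?G ?R" for r
  proof -
    have "\<gamma> r = \<gamma> 0"
      unfolding \<gamma>_def using that by (intro arg_cong[of _ _ gen] lie_coset_eq) simp
    then show ?thesis
      using \<gamma>_0 by simp
  qed
  have \<gamma>_rel: "\<gamma> r \<in> N" if "r \<in> ?R" for r
    by (rule \<gamma>_ideal[OF lie_ideal.rel[OF that]])
  have \<gamma>_diff: "\<gamma> f - \<gamma> g - \<gamma> (f - g) \<in> N" if "f \<in> ?M" "g \<in> ?M" for f g
    using N_diff[OF N_0 \<gamma>_add[of "f - g" g]] free_nonassoc_diff[OF that] that(2)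
      \<gamma>_add[of "f - g" g] by (simp add: algebra_simps)
  define e f :: "'i \<Rightarrow> _" where "e = (\<lambda>i. \<gamma> (mgen (KE i)))" and "f = (\<lambda>i. \<gamma> (mgen (KF i)))"
  define h where "h y = \<gamma> (mgen (KH (of_lattice y)))" for y
  have E: "mgen (KE i) \<in> ?M" and F: "mgen (KF i) \<in> ?M" if "i \<in> I" for i
    using that by (auto intro!: free_nonassoc_mgen simp: km_generators_def)
  have H: "mgen (KH x) \<in> ?M" for x
    by (auto intro!: free_nonassoc_mgen simp: km_generators_def)
  have hh: "ad (\<gamma> (mgen (KH x))) (\<gamma> (mgen (KH x'))) \<in> N" for x x'
  proof -
    have "\<gamma> (mbr (mgen (KH x)) (mgen (KH x'))) \<in> N"
      by (rule \<gamma>_rel) (unfold km_relations_def Let_def, blast)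
    from N_diff[OF this \<gamma>_mbr[OF H[of x] H[of x']]] show ?thesis
      by simp
  qed
  have he: "\<exists>c. ad (h y) (e i) - pscale c (e i) \<in> N" if i: "i \<in> I" for y i
  proof -
    let ?c = "pairing_ext p (of_lattice y) (\<alpha> i)"
    let ?E = "mgen (KE i)" and ?H = "mgen (KH (of_lattice y))"
    have 1: "\<gamma> (mbr ?H ?E - pscale ?c ?E) \<in> N"
      by (rule \<gamma>_rel) (unfold km_relations_def Let_def, use i in blast)
    have 2: "\<gamma> (mbr ?H ?E) - \<gamma> (pscale ?c ?E) - \<gamma> (mbr ?H ?E - pscale ?c ?E) \<in> N"
      by (intro \<gamma>_diff free_nonassoc_mbr free_nonassoc_scale E H i)
    have "\<gamma> (mbr ?H ?E - pscale ?c ?E) +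
        (\<gamma> (mbr ?H ?E) - \<gamma> (pscale ?c ?E) - \<gamma> (mbr ?H ?E - pscale ?c ?E)) +
        (\<gamma> (pscale ?c ?E) - pscale ?c (\<gamma> ?E)) - (\<gamma> (mbr ?H ?E) - ad (\<gamma> ?H) (\<gamma> ?E)) \<in> N"
      by (intro N_add N_diff 1 2 \<gamma>_scale \<gamma>_mbr E H i)
    then have "ad (h y) (e i) - pscale ?c (e i) \<in> N"
      by (simp add: h_def e_def algebra_simps)
    then show ?thesis by blast
  qed
  have hf: "\<exists>c. ad (h y) (f i) - pscale c (f i) \<in> N" if i: "i \<in> I" for y i
  proof -
    let ?c = "pairing_ext p (of_lattice y) (\<alpha> i)"
    let ?F = "mgen (KF i)" and ?H = "mgen (KH (of_lattice y))"
    have 1: "\<gamma> (mbr ?H ?F + pscale ?c ?F) \<in> N"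
      by (rule \<gamma>_rel) (unfold km_relations_def Let_def, use i in blast)
    have 2: "\<gamma> (mbr ?H ?F + pscale ?c ?F) - \<gamma> (mbr ?H ?F) - \<gamma> (pscale ?c ?F) \<in> N"
      by (intro \<gamma>_add free_nonassoc_mbr free_nonassoc_scale F H i)
    have "\<gamma> (mbr ?H ?F + pscale ?c ?F) -
        (\<gamma> (mbr ?H ?F + pscale ?c ?F) - \<gamma> (mbr ?H ?F) - \<gamma> (pscale ?c ?F)) -
        (\<gamma> (pscale ?c ?F) - pscale ?c (\<gamma> ?F)) - (\<gamma> (mbr ?H ?F) - ad (\<gamma> ?H) (\<gamma> ?F)) \<in> N"
      by (intro N_add N_diff 1 2 \<gamma>_scale \<gamma>_mbr F H i)
    then have "ad (h y) (f i) - pscale (- ?c) (f i) \<in> N"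
      by (simp add: h_def f_def algebra_simps)
    then show ?thesis by blast
  qed
  have ef: "ad (e i) (f j) - (if i = j then h (\<alpha>v i) else 0) \<in> N" if ij: "i \<in> I" "j \<in> I" for i j
  proof -
    let ?E = "mgen (KE i)" and ?F = "mgen (KF j)"
    let ?H = "if i = j then mgen (KH (of_lattice (\<alpha>v i))) else 0"
    have HM: "?H \<in> ?M"
      by (simp add: H free_nonassoc_0)
    have 1: "\<gamma> (mbr ?E ?F - ?H) \<in> N"
      by (rule \<gamma>_rel) (unfold km_relations_def Let_def, use ij in blast)
    have 2: "\<gamma> (mbr ?E ?F) - \<gamma> ?H - \<gamma> (mbr ?E ?F - ?H) \<in> N"
      by (intro \<gamma>_diff free_nonassoc_mbr E F HM ij)
    have 3: "\<gamma> ?H - (if i = j then h (\<alpha>v i) else 0) \<in> N"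
      using \<gamma>_0 N_0 by (simp add: h_def)
    have "\<gamma> (mbr ?E ?F - ?H) + (\<gamma> (mbr ?E ?F) - \<gamma> ?H - \<gamma> (mbr ?E ?F - ?H)) +
        (\<gamma> ?H - (if i = j then h (\<alpha>v i) else 0)) - (\<gamma> (mbr ?E ?F) - ad (\<gamma> ?E) (\<gamma> ?F)) \<in> N"
      by (intro N_add N_diff 1 2 3 \<gamma>_mbr E F ij)
    then show ?thesis
      by (simp only: e_def f_def) (simp add: algebra_simps)
  qed
  \<comment> \<open>Iterated Lie brackets become iterated commutators; this carries over the Serre
    relations.\<close>
  have \<gamma>_pow: "\<gamma> ((mbr u ^^ n) v) - (ad (\<gamma> u) ^^ n) (\<gamma> v) \<in> N" if uv: "u \<in> ?M" "v \<in> ?M" for u v n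
  proof (induction n)
    case 0
    then show ?case by (simp add: N_0)
  next
    case (Suc n)
    let ?x = "(mbr u ^^ n) v" and ?y = "(ad (\<gamma> u) ^^ n) (\<gamma> v)"
    have "\<gamma> (mbr u ?x) - ad (\<gamma> u) (\<gamma> ?x) \<in> N"
      by (intro \<gamma>_mbr free_nonassoc_mbr_pow uv)
    moreover have "ad (\<gamma> u) d \<in> N" if "d \<in> N" for d
      unfolding ad_def using that uv by (intro N_diff N_left N_right \<gamma>_C)
    then have "ad (\<gamma> u) (\<gamma> ?x - ?y) \<in> N"
      using Suc.IH by blast
    ultimately have "(\<gamma> (mbr u ?x) - ad (\<gamma> u) (\<gamma> ?x)) + ad (\<gamma> u) (\<gamma> ?x - ?y) \<in> N"
      by (rule N_add)
    then show ?case
      by (simp add: klinear_diff[OF klinear_ad])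
  qed
  have serre: "(ad (\<gamma> u) ^^ n) (\<gamma> v) \<in> N" if "u \<in> ?M" "v \<in> ?M" "(mbr u ^^ n) v \<in> ?R" for u v n
    using N_diff[OF \<gamma>_rel[OF that(3)] \<gamma>_pow[OF that(1,2), of n]] by simp
  have serre_e: "(ad (e i) ^^ nat (1 - a i j)) (e j) \<in> N" if "i \<in> I" "j \<in> I" "i \<noteq> j" for i j
    unfolding e_def
    by (intro serre E that) (unfold km_relations_def Let_def, use that in blast)
  have serre_f: "(ad (f i) ^^ nat (1 - a i j)) (f j) \<in> N" if "i \<in> I" "j \<in> I" "i \<noteq> j" for i j
    unfolding f_def
    by (intro serre F that) (unfold km_relations_def Let_def, use that in blast)
  obtain bs where bs: "finite bs" "Modules.module.span int_scale bs = (UNIV :: 'y set)"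
    using Y unfolding fg_free_def by blast
  \<comment> \<open>Lattice generators span the Cartan subalgebra; the coroots are the commutators
    of \<open>e i\<close> with \<open>f i\<close>.\<close>
  define Hs where "Hs = bs \<union> \<alpha>v ` I"
  interpret T: triangular C N I Hs e f h
  proof
    show "finite Hs"
      using bs(1) S.finite_I by (simp add: Hs_def)
    show "e i \<in> C" "f i \<in> C" if "i \<in> I" for i
      using that by (simp_all add: e_def f_def \<gamma>_C E F)
    show "h b \<in> C" for b
      by (simp add: h_def \<gamma>_C H)
    show "e i * f j - f j * e i \<in> pvs.span (h ` Hs \<union> N)" if ij: "i \<in> I" "j \<in> I" for i j
    proof -
      let ?r = "if i = j then h (\<alpha>v i) else 0"
      have "?r \<in> pvs.span (h ` Hs \<union> N)"
        using ij by (auto simp: Hs_def pvs.span_zero intro!: pvs.span_base)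
      moreover have "ad (e i) (f j) - ?r \<in> pvs.span (h ` Hs \<union> N)"
        using ef[OF ij] by (intro pvs.span_base) blast
      ultimately show ?thesis
        using pvs.span_add unfolding ad_def by fastforce
    qed
    show "\<exists>c c'. h b * f i - pscale c (f i * h b) - pscale c' (f i) \<in> N" if i: "i \<in> I" for b i
    proof -
      obtain c where "ad (h b) (f i) - pscale c (f i) \<in> N"
        using hf[OF i] by blast
      then show ?thesis
        by (intro exI[of _ 1] exI[of _ c]) (simp add: ad_def)
    qed
    show "\<exists>c c'. e i * h b - pscale c (h b * e i) - pscale c' (e i) \<in> N" if i: "i \<in> I" for b i
    proof -
      obtain c where "ad (h b) (e i) - pscale c (e i) \<in> N"
        using he[OF i] by blast
      from N_diff[OF N_0 this] show ?thesis
        by (intro exI[of _ 1] exI[of _ "- c"]) (simp add: ad_def algebra_simps)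
    qed
    show "h b * h b' - h b' * h b \<in> N" for b b'
      using hh[of "of_lattice b" "of_lattice b'"] by (simp add: ad_def h_def)
  qed
  \<comment> \<open>The aim is that \<gamma> maps every Lie element into \<open>UF\<close>, so that
    finitely many generators reach all those of the presentation.\<close>
  define UF where "UF = (\<Union>m. filt T.gens m)"
  have UF: "pvs.subspace UF"
    unfolding UF_def by (rule Union_filt_subspace)
  have UF_mult: "x * y \<in> UF" if "x \<in> UF" "y \<in> UF" for x y
    using Union_filt_mult[OF T.gens_C] that unfolding UF_def by blast
  have UF_cong: "y \<in> UF" if "y - x \<in> N" "x \<in> UF" for x y
    using filt_congruent that unfolding UF_def by blast
  have UF_add: "\<gamma> (u + v) \<in> UF" if "u \<in> ?M" "v \<in> ?M" "\<gamma> u \<in> UF" "\<gamma> v \<in> UF" for u v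
    using UF_cong[of "\<gamma> (u + v)" "\<gamma> u + \<gamma> v"] \<gamma>_add[OF that(1,2)] pvs.subspace_add[OF UF that(3,4)]
    by (simp add: diff_diff_eq)
  have UF_scale: "\<gamma> (pscale c u) \<in> UF" if "u \<in> ?M" "\<gamma> u \<in> UF" for c u
    by (rule UF_cong[OF \<gamma>_scale[OF that(1)] pvs.subspace_scale[OF UF that(2)]])
  have UF_mbr: "\<gamma> (mbr u v) \<in> UF" if "u \<in> ?M" "v \<in> ?M" "\<gamma> u \<in> UF" "\<gamma> v \<in> UF" for u v
    using that by (intro UF_cong[OF \<gamma>_mbr]) (auto simp: ad_def intro!: pvs.subspace_diff[OF UF] UF_mult)
  \<comment> \<open>Congruent Lie elements have the same coset, so \<gamma> takes equal values on
    them.\<close>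
  have UF_ideal: "\<gamma> u \<in> UF" if "u \<in> ?M" "v \<in> ?M" "\<gamma> v \<in> UF" "u - v \<in> ?R" for u v
  proof -
    have "\<gamma> u = \<gamma> v"
      unfolding \<gamma>_def using lie_coset_eq[OF lie_ideal.rel[OF that(4)]] by simp
    then show ?thesis
      using that(3) by simp
  qed
  have gens_UF: "x \<in> UF" if "x \<in> T.gens" for x
    unfolding UF_def using gen_filt[OF that] .
  have H_add: "\<gamma> (mgen (KH (x + x'))) \<in> UF"
    if "\<gamma> (mgen (KH x)) \<in> UF" "\<gamma> (mgen (KH x')) \<in> UF" for x x'
  proof (rule UF_ideal[of _ "mgen (KH x) + mgen (KH x')"])
    show "mgen (KH (x + x')) - (mgen (KH x) + mgen (KH x')) \<in> ?R"
      unfolding diff_diff_eq[symmetric] by (rule km_relations_cartan_add)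
    show "\<gamma> (mgen (KH x) + mgen (KH x')) \<in> UF"
      by (rule UF_add[OF H H that])
  qed (rule H free_nonassoc_add[OF H H])+
  have H_scale: "\<gamma> (mgen (KH (complexification_scale c x))) \<in> UF" if "\<gamma> (mgen (KH x)) \<in> UF" for c x
  proof (rule UF_ideal[of _ "pscale c (mgen (KH x))"])
    show "mgen (KH (complexification_scale c x)) - pscale c (mgen (KH x)) \<in> ?R"
      by (rule km_relations_cartan_scale)
    show "\<gamma> (pscale c (mgen (KH x))) \<in> UF"
      by (rule UF_scale[OF H that])
  qed (rule H free_nonassoc_scale[OF H])+
  have lattice: "h y \<in> UF" for y
  proof -
    have "y \<in> {y. h y \<in> UF}"
    proof (rule additive_subgroup_eq_UNIV[OF bs(2)])
      show "bs \<subseteq> {y. h y \<in> UF}"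
        using gens_UF unfolding T.gens_def unfolding Hs_def by blast
      show add: "x + y \<in> {y. h y \<in> UF}" if "x \<in> {y. h y \<in> UF}" "y \<in> {y. h y \<in> UF}" for x y
        using that H_add by (simp add: h_def of_lattice_add)
      show neg: "- x \<in> {y. h y \<in> UF}" if "x \<in> {y. h y \<in> UF}" for x
        using that H_scale[of "of_lattice x" "- 1"]
        by (simp add: h_def of_lattice_uminus complexification_uminus)
      have "\<gamma> (mgen (KH 0)) \<in> UF"
      proof (rule UF_ideal[of _ 0])
        have "mgen (KH (complexification_scale 0 0)) - pscale 0 (mgen (KH 0)) \<in> ?R"
          by (rule km_relations_cartan_scale)
        moreover have "complexification_scale 0 0 = (0 :: 'y complexification)"
          by transfer (simp add: tensor_rel_def tensor_null_zero)
        ultimately show "mgen (KH 0) - 0 \<in> ?R"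
          by simp
        show "\<gamma> 0 \<in> UF"
          using \<gamma>_0 N_filt unfolding UF_def by blast
      qed (rule H free_nonassoc_0)+
      moreover have "of_lattice 0 = (0 :: 'y complexification)"
        using of_lattice_add[of "0 :: 'y" 0] by simp
      ultimately show "0 \<in> {y. h y \<in> UF}"
        by (simp add: h_def)
    qed
    then show ?thesis by simp
  qed
  have H_UF: "\<gamma> (mgen (KH x)) \<in> UF" for x
    by (induction x rule: complexification_induct) (auto intro: H_add H_scale lattice[unfolded h_def])
  \<comment> \<open>Induction over bracketings: a leaf is a generator, and an inner node is a
    commutator modulo \<open>N\<close>.\<close>
  have single: "\<gamma> (Poly_Mapping.single w 1) \<in> UF" if "set_magma w \<subseteq> ?G" for w
    using that
  proof (induction w)
    case (Leaf g)
    then consider i where "i \<in> I" "g = KE i" | i where "i \<in> I" "g = KF i" | x where "g = KH x"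
      by (auto simp: km_generators_def)
    then show ?case
    proof cases
      case (1 i)
      then have "e i \<in> T.gens"
        unfolding T.gens_def by blast
      then show ?thesis
        using gens_UF 1(2) by (simp add: e_def mgen_def)
    next
      case (2 i)
      then have "f i \<in> T.gens"
        unfolding T.gens_def by blast
      then show ?thesis
        using gens_UF 2(2) by (simp add: f_def mgen_def)
    next
      case (3 x)
      then show ?thesis
        using H_UF[of x] by (simp add: mgen_def)
    qed
  next
    case (Prod s t)
    have "Poly_Mapping.single (Prod s t) 1 = mbr (Poly_Mapping.single s 1) (Poly_Mapping.single t (1 :: complex))"
      by (simp add: mbr_single)
    moreover have "\<gamma> (mbr (Poly_Mapping.single s 1) (Poly_Mapping.single t 1)) \<in> UF"
      using Prod by (intro UF_mbr free_nonassoc_single) auto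
    ultimately show ?case
      by simp
  qed
  have gen: "gen x \<in> (\<Union>m. filt T.gens m)" if x: "x \<in> lie_carrier ?L" for x
  proof -
    obtain u where u: "x = lie_coset ?G ?R u" "u \<in> ?M"
      using x unfolding L by blast
    have "u \<in> pvs.span ((\<lambda>w. Poly_Mapping.single w 1) ` Poly_Mapping.keys u)"
      by (subst sum_singles) (intro pvs.span_sum pvs.span_scale pvs.span_base imageI)
    moreover have "Poly_Mapping.keys u \<subseteq> {w. set_magma w \<subseteq> ?G}"
      using u(2) by (auto simp: free_nonassoc_def)
    ultimately have "u \<in> pvs.span ((\<lambda>w. Poly_Mapping.single w 1) ` {w. set_magma w \<subseteq> ?G})"
      using pvs.span_mono[OF image_mono] by blast
    then have "u \<in> ?M \<and> \<gamma> u \<in> UF"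
    proof (induction rule: pvs.span_induct_alt)
      case base
      then show ?case
        using \<gamma>_0 N_filt free_nonassoc_0 unfolding UF_def by blast
    next
      case (step c y z)
      then obtain w where w: "y = Poly_Mapping.single w 1" "set_magma w \<subseteq> ?G"
        by blast
      then have "y \<in> ?M" "\<gamma> y \<in> UF"
        using free_nonassoc_single[OF w(2)] single[OF w(2)] by auto
      then show ?case
        using step(2) by (intro conjI UF_add UF_scale free_nonassoc_add free_nonassoc_scale) auto
    qed
    then show ?thesis
      by (simp add: u(1) UF_def \<gamma>_def)
  qed
  \<comment> \<open>Here the word bound is applied over the complex numbers directly.\<close>
  have words: "\<exists>W\<subseteq>{w. set w \<subseteq> I \<and> length w = l}. finite W \<and> card W \<le> S.growth l \<and>
      T.pl g ` {w. set w \<subseteq> I \<and> length w = l} \<subseteq> pvs.span (T.pl g ` W \<union> N)"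
    if g: "\<And>i. i \<in> I \<Longrightarrow> g i \<in> C"
      "\<And>i j. i \<in> I \<Longrightarrow> j \<in> I \<Longrightarrow> i \<noteq> j \<Longrightarrow> (ad (g i) ^^ nat (1 - a i j)) (g j) \<in> N"
    for g l
  proof -
    obtain W where W: "W \<subseteq> {w. set w \<subseteq> I \<and> length w = l}" "finite W" "card W \<le> S.growth l"
      "wd ` {w. set w \<subseteq> I \<and> length w = l} \<subseteq> pvs.span (wd ` W \<union> S.N)"
      using S.words_spanned[of l] by (elim exE conjE)
    have "(\<lambda>w. prod_list (map g w)) ` {w. set w \<subseteq> I \<and> length w = l} \<subseteq>
        pvs.span ((\<lambda>w. prod_list (map g w)) ` W \<union> N)"
    proof (rule eval_words_spanned[OF g(1) _ W(1,4)])
      fix r :: "'i free_monoid \<Rightarrow>\<^sub>0 complex" assume "r \<in> serre_rel I a"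
      then obtain i j where ij: "i \<in> I" "j \<in> I" "i \<noteq> j" "r = (ad (gen i) ^^ nat (1 - a i j)) (gen j)"
        unfolding serre_rel_def by blast
      then show "eval_words (\<lambda>i. if i \<in> I then g i else 0) r \<in> N"
        using g(2) by (simp add: eval_ad_pow)
    qed
    then show ?thesis
      using W unfolding T.pl_def by blast
  qed
  obtain r where r: "subexponential r"
    "\<And>m. \<exists>Z. finite Z \<and> card Z \<le> r m \<and> filt T.gens m \<subseteq> pvs.span (Z \<union> N)"
    using T.filt_growth[OF S.subexponential_growth words[OF T.e_C serre_e] words[OF T.f_C serre_f]] by blast
  have U: "U = presented_algebra (lie_carrier ?L) RU"
    unfolding U_def enveloping_algebra_def RU_def ..
  from RU_C show ?thesis
    unfolding U
    by (intro presented_algebra_tempered[where X = T.gens and r = r])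
      (use T.gens_C gen r B J in \<open>simp_all add: U flip: C_def N_def\<close>)
qed

theorem corollary2p15:
  fixes I :: "'i set" and a :: "'i \<Rightarrow> 'i \<Rightarrow> int" and d :: "'i \<Rightarrow> rat"
    and p :: "'y::ab_group_add \<Rightarrow> 'x::ab_group_add \<Rightarrow> int"
    and \<alpha>v :: "'i \<Rightarrow> 'y" and \<alpha> :: "'i \<Rightarrow> 'x"
  assumes "gcm I a" and "symmetrized_by I a d" and "finite_type I a \<or> affine_type I a"
    and "root_datum I a p \<alpha>v \<alpha>"
  defines "U \<equiv> enveloping_algebra (kac_moody I a p \<alpha>v \<alpha>)"
    and "U\<^sub>q \<equiv> quantized_enveloping_algebra I a d p \<alpha>v \<alpha>"
  shows "(\<forall>B J. unital_subalgebra (class_ring :: complex ring) B U \<and>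
            completely_prime J (U\<lparr>carrier := B\<rparr>) \<longrightarrow>
            tempered_domain (class_ring :: complex ring) (alg_quot (U\<lparr>carrier := B\<rparr>) J) \<and>
            ore_domain (alg_quot (U\<lparr>carrier := B\<rparr>) J))
       \<and> (\<forall>B J. unital_subalgebra (class_ring :: rat poly fract ring) B U\<^sub>q \<and>
            completely_prime J (U\<^sub>q\<lparr>carrier := B\<rparr>) \<longrightarrow>
            tempered_domain (class_ring :: rat poly fract ring) (alg_quot (U\<^sub>q\<lparr>carrier := B\<rparr>) J) \<and>
            ore_domain (alg_quot (U\<^sub>q\<lparr>carrier := B\<rparr>) J))"
proof -
  have Y: "fg_free TYPE('y)"
    using assms(4) by (simp add: root_datum_def)
  show ?thesis
    unfolding U_def U\<^sub>q_def
    using enveloping_algebra_tempered[OF assms(1-3) Y] quantized_enveloping_algebra_tempered[OF assms(1-3) Y]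
    by blast
qed

end
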